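(* Let $k$ be a field and let $\mathcal{P}$ be an operad over $k$ minimally generated by an $\mathbb{S}$-module $X\subset\mathcal{P}$, with a minimal $\mathbb{S}$-module of relations $R\subset\Gamma(X)$. Assume that $X$ and $R$ are both locally finite, that is, all their graded components $X(n)$, $R(n)$ are finite-dimensional over $k$. Suppose that the formal power series $$\left(1-\frac{X(z)}{z}+\frac{R(z)}{z}\right)^{-1}$$ has non-negative coefficients. Then the operad $\mathcal{P}$ is infinite.
   Context: All operads are symmetric $k$-linear operads $\mathcal{P}=(\mathcal{P}(n))_{n\ge 1}$ with $\mathcal{P}(0)=0$ and $\mathcal{P}(1)=k\,\mathrm{id}$. An $\mathbb{S}$-module is a sequence $Q=(Q(n))_{n\geq 1}$ of $k$-linear representations $Q(n)$ of the symmetric groups $S_n$; here $X$ is concentrated in arities $n\ge 2$. An operad is infinite if $\bigoplus_n\mathcal{P}(n)$ is infinite-dimensional over $k$. $\mathcal{P}$ is minimally generated by the sub-$\mathbb{S}$-module $X\subset\mathcal{P}$ if $X$ generates $\mathcal{P}$ as an operad and no proper sub-$\mathbb{S}$-module of $X$ does. $\Gamma(X)$ denotes the free operad on the $\mathbb{S}$-module $X$. A minimal $\mathbb{S}$-module of relations of $\mathcal{P}$ is a sub-$\mathbb{S}$-module $R\subset\Gamma(X)$ which generates, as a two-sided operadic ideal, the kernel of the canonical surjection $\Gamma(X)\to\mathcal{P}$, and which is minimal (no proper sub-$\mathbb{S}$-module of $R$ generates this ideal). For an $\mathbb{S}$-module $Q$ with all $Q(n)$ finite-dimensional, its generating function is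 the formal power series $Q(z)=\sum_{n\ge 1}\frac{\dim_k Q(n)}{n!}z^n$.
   Formalization: The generating S-module X is additionally assumed to be nonzero; for X = 0 one has P = k id and R = 0, the series equals 1 and has non-negative coefficients, but P is finite-dimensional, so the statement fails exactly in that case. *)

theory Defs
  imports
    "HOL-Algebra.AbelCoset"
    "Jordan_Normal_Form.Missing_VectorSpace"
    "HOL-Combinatorics.Permutations"
    "HOL-Computational_Algebra.Formal_Power_Series"
begin

section \<open>S-modules\<close>

text \<open>
  Sequences are indexed by \<open>n \<ge> 1\<close>: a field of the records below carries no
  information at arity 0, and every condition is imposed in arities \<open>n \<ge> 1\<close> only.
  The symmetric group on \<open>n\<close> letters consists of the \<open>\<sigma>\<close> with \<open>\<sigma> permutes {1..n}\<close>.
  Representations are left representations; on operations this is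
  \<open>(\<sigma> \<mu>)(x\<^sub>1, \<dots>, x\<^sub>n) = \<mu>(x\<^bsub>\<sigma> 1\<^esub>, \<dots>, x\<^bsub>\<sigma> n\<^esub>)\<close>, i.e. the usual right action of \<open>\<sigma>\<close> composed
  with inversion.
\<close>

record ('k, 'a) smod =
  cpt :: "nat \<Rightarrow> ('k, 'a) module"
  sact :: "nat \<Rightarrow> (nat \<Rightarrow> nat) \<Rightarrow> 'a \<Rightarrow> 'a"

locale s_module =
  fixes K :: "('k, 'm) ring_scheme" and Q :: "('k, 'a, 'z) smod_scheme"
  assumes vectorspace_cpt: "1 \<le> n \<Longrightarrow> vectorspace K (cpt Q n)"
    and sact_hom: "\<lbrakk>1 \<le> n; \<sigma> permutes {1..n}\<rbrakk> 
      \<Longrightarrow> sact Q n \<sigma> \<in> LinearCombinations.module_hom K (cpt Q n) (cpt Q n)"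
    and sact_id: "\<lbrakk>1 \<le> n; x \<in> carrier (cpt Q n)\<rbrakk> \<Longrightarrow> sact Q n id x = x"
    and sact_comp: "\<lbrakk>1 \<le> n; \<sigma> permutes {1..n}; \<tau> permutes {1..n}; x \<in> carrier (cpt Q n)\<rbrakk>
      \<Longrightarrow> sact Q n (\<sigma> \<circ> \<tau>) x = sact Q n \<sigma> (sact Q n \<tau> x)"

definition sub_s_module ::
  "('k, 'm) ring_scheme \<Rightarrow> ('k, 'a, 'z) smod_scheme \<Rightarrow> (nat \<Rightarrow> 'a set) \<Rightarrow> bool" where
  "sub_s_module K Q Y \<longleftrightarrow>
     (\<forall>n\<ge>1. VectorSpace.subspace K (Y n) (cpt Q n)) \<and>
     (\<forall>n\<ge>1. \<forall>\<sigma>. \<sigma> permutes {1..n} \<longrightarrow> (\<forall>x\<in>Y n. sact Q n \<sigma> x \<in> Y n))"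

definition restrict_smod ::
  "('k, 'a, 'z) smod_scheme \<Rightarrow> (nat \<Rightarrow> 'a set) \<Rightarrow> ('k, 'a) smod" where
  "restrict_smod Q Y = \<lparr>cpt = (\<lambda>n. (cpt Q n)\<lparr>carrier := Y n\<rparr>), sact = sact Q\<rparr>"

definition s_module_hom ::
  "('k, 'm) ring_scheme \<Rightarrow> ('k, 'a, 'z) smod_scheme \<Rightarrow> ('k, 'b, 'y) smod_scheme
    \<Rightarrow> (nat \<Rightarrow> 'a \<Rightarrow> 'b) \<Rightarrow> bool" where
  "s_module_hom K Q Q' f \<longleftrightarrow>
     (\<forall>n\<ge>1. f n \<in> LinearCombinations.module_hom K (cpt Q n) (cpt Q' n)) \<and>
     (\<forall>n\<ge>1. \<forall>\<sigma>. \<sigma> permutes {1..n} \<longrightarrow>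
        (\<forall>x\<in>carrier (cpt Q n). f n (sact Q n \<sigma> x) = sact Q' n \<sigma> (f n x)))"

definition locally_finite :: "('k, 'm) ring_scheme \<Rightarrow> ('k, 'a, 'z) smod_scheme \<Rightarrow> bool" where
  "locally_finite K Q \<longleftrightarrow> (\<forall>n\<ge>1. vectorspace.fin_dim K (cpt Q n))"

definition gen_fun :: "('k, 'm) ring_scheme \<Rightarrow> ('k, 'a, 'z) smod_scheme \<Rightarrow> real fps" where
  "gen_fun K Q =
     Abs_fps (\<lambda>n. if n = 0 then 0 else real (vectorspace.dim K (cpt Q n)) / fact n)"

text \<open>The fields \<open>mult\<close> and \<open>one\<close> that a module record inherits from the ring record are
  irrelevant.\<close>

definition direct_sum_cpt :: "('k, 'a, 'z) smod_scheme \<Rightarrow> ('k, nat \<Rightarrow> 'a) module" where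
  "direct_sum_cpt Q =
     \<lparr>carrier = {f \<in> (\<Pi>\<^sub>E n\<in>{1..}. carrier (cpt Q n)). finite {n \<in> {1..}. f n \<noteq> \<zero>\<^bsub>cpt Q n\<^esub>}},
      monoid.mult = undefined, one = undefined,
      zero = (\<lambda>n\<in>{1..}. \<zero>\<^bsub>cpt Q n\<^esub>),
      add = (\<lambda>f g. \<lambda>n\<in>{1..}. f n \<oplus>\<^bsub>cpt Q n\<^esub> g n),
      smult = (\<lambda>c f. \<lambda>n\<in>{1..}. c \<odot>\<^bsub>cpt Q n\<^esub> f n)\<rparr>"

section \<open>Operads\<close>

text \<open>
  The permutation by which \<open>\<sigma> \<mu> \<circ>\<^bsub>\<sigma> i\<^esub> \<tau> \<nu>\<close> differs from \<open>\<mu> \<circ>\<^sub>i \<nu>\<close>, for \<open>\<mu>\<close> of arity \<open>m\<close> and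
  \<open>\<nu>\<close> of arity \<open>n\<close>: the block \<open>{i..i+n-1}\<close> is moved to \<open>{\<sigma> i..\<sigma> i+n-1}\<close> and permuted
  by \<open>\<tau>\<close>, the remaining letters are permuted as by \<open>\<sigma>\<close>.
\<close>

definition perm_circ ::
  "nat \<Rightarrow> nat \<Rightarrow> nat \<Rightarrow> (nat \<Rightarrow> nat) \<Rightarrow> (nat \<Rightarrow> nat) \<Rightarrow> nat \<Rightarrow> nat" where
  "perm_circ m n i \<sigma> \<tau> =
     (let shift = (\<lambda>b. if b < \<sigma> i then b else b + n - 1) in
      (\<lambda>a. if a \<notin> {1..m + n - 1} then a
           else if a < i then shift (\<sigma> a)
           else if a < i + n then \<sigma> i + \<tau> (a - i + 1) - 1
           else shift (\<sigma> (a - n + 1))))"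

text \<open>Operads are given by partial compositions; \<open>circ P m n i \<mu> \<nu>\<close> is \<open>\<mu> \<circ>\<^sub>i \<nu>\<close> for
  \<open>\<mu>\<close> of arity \<open>m\<close> and \<open>\<nu>\<close> of arity \<open>n\<close>.\<close>

record ('k, 'a) opd = "('k, 'a) smod" +
  ounit :: 'a
  circ :: "nat \<Rightarrow> nat \<Rightarrow> nat \<Rightarrow> 'a \<Rightarrow> 'a \<Rightarrow> 'a"

locale operad = s_module K P
  for K :: "('k, 'm) ring_scheme" and P :: "('k, 'a, 'z) opd_scheme" +
  assumes ounit_closed: "ounit P \<in> carrier (cpt P 1)"
    and circ_hom_left: "\<lbrakk>1 \<le> m; 1 \<le> n; i \<in> {1..m}; \<nu> \<in> carrier (cpt P n)\<rbrakk>
      \<Longrightarrow> (\<lambda>\<mu>. circ P m n i \<mu> \<nu>) \<in> LinearCombinations.module_hom K (cpt P m) (cpt P (m + n - 1))"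
    and circ_hom_right: "\<lbrakk>1 \<le> m; 1 \<le> n; i \<in> {1..m}; \<mu> \<in> carrier (cpt P m)\<rbrakk>
      \<Longrightarrow> (\<lambda>\<nu>. circ P m n i \<mu> \<nu>) \<in> LinearCombinations.module_hom K (cpt P n) (cpt P (m + n - 1))"
    and circ_unit_left: "\<lbrakk>1 \<le> n; \<nu> \<in> carrier (cpt P n)\<rbrakk> \<Longrightarrow> circ P 1 n 1 (ounit P) \<nu> = \<nu>"
    and circ_unit_right: "\<lbrakk>1 \<le> m; i \<in> {1..m}; \<mu> \<in> carrier (cpt P m)\<rbrakk>
      \<Longrightarrow> circ P m 1 i \<mu> (ounit P) = \<mu>"
    and circ_sequential: "\<lbrakk>1 \<le> l; 1 \<le> m; 1 \<le> n; i \<in> {1..l}; j \<in> {1..m};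
        la \<in> carrier (cpt P l); \<mu> \<in> carrier (cpt P m); \<nu> \<in> carrier (cpt P n)\<rbrakk>
      \<Longrightarrow> circ P (l + m - 1) n (i - 1 + j) (circ P l m i la \<mu>) \<nu>
        = circ P l (m + n - 1) i la (circ P m n j \<mu> \<nu>)"
    and circ_parallel: "\<lbrakk>1 \<le> l; 1 \<le> m; 1 \<le> n; 1 \<le> i; i < j; j \<le> l;
        la \<in> carrier (cpt P l); \<mu> \<in> carrier (cpt P m); \<nu> \<in> carrier (cpt P n)\<rbrakk>
      \<Longrightarrow> circ P (l + m - 1) n (j - 1 + m) (circ P l m i la \<mu>) \<nu>
        = circ P (l + n - 1) m i (circ P l n j la \<nu>) \<mu>"
    and circ_equivariant: "\<lbrakk>1 \<le> m; 1 \<le> n; i \<in> {1..m}; \<sigma> permutes {1..m}; \<tau> permutes {1..n};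
        \<mu> \<in> carrier (cpt P m); \<nu> \<in> carrier (cpt P n)\<rbrakk>
      \<Longrightarrow> circ P m n (\<sigma> i) (sact P m \<sigma> \<mu>) (sact P n \<tau> \<nu>)
        = sact P (m + n - 1) (perm_circ m n i \<sigma> \<tau>) (circ P m n i \<mu> \<nu>)"

text \<open>\<open>P(1)\<close> is the line spanned by the identity, hence the identity is nonzero.\<close>

locale connected_operad = operad +
  assumes ounit_nonzero: "ounit P \<noteq> \<zero>\<^bsub>cpt P 1\<^esub>"
    and cpt_one: "carrier (cpt P 1) = {c \<odot>\<^bsub>cpt P 1\<^esub> ounit P | c. c \<in> carrier K}"

definition operad_hom ::
  "('k, 'm) ring_scheme \<Rightarrow> ('k, 'a, 'z) opd_scheme \<Rightarrow> ('k, 'b, 'y) opd_scheme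
    \<Rightarrow> (nat \<Rightarrow> 'a \<Rightarrow> 'b) \<Rightarrow> bool" where
  "operad_hom K P P' f \<longleftrightarrow>
     s_module_hom K P P' f \<and>
     f 1 (ounit P) = ounit P' \<and>
     (\<forall>m\<ge>1. \<forall>n\<ge>1. \<forall>i\<in>{1..m}. \<forall>\<mu>\<in>carrier (cpt P m). \<forall>\<nu>\<in>carrier (cpt P n).
        f (m + n - 1) (circ P m n i \<mu> \<nu>) = circ P' m n i (f m \<mu>) (f n \<nu>))"

definition infinite_operad :: "('k, 'm) ring_scheme \<Rightarrow> ('k, 'a, 'z) opd_scheme \<Rightarrow> bool" where
  "infinite_operad K P \<longleftrightarrow> \<not> vectorspace.fin_dim K (direct_sum_cpt P)"

definition suboperad ::
  "('k, 'm) ring_scheme \<Rightarrow> ('k, 'a, 'z) opd_scheme \<Rightarrow> (nat \<Rightarrow> 'a set) \<Rightarrow> bool" where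
  "suboperad K P S \<longleftrightarrow>
     sub_s_module K P S \<and> ounit P \<in> S 1 \<and>
     (\<forall>m\<ge>1. \<forall>n\<ge>1. \<forall>i\<in>{1..m}. \<forall>\<mu>\<in>S m. \<forall>\<nu>\<in>S n. circ P m n i \<mu> \<nu> \<in> S (m + n - 1))"

definition generates_operad ::
  "('k, 'm) ring_scheme \<Rightarrow> ('k, 'a, 'z) opd_scheme \<Rightarrow> (nat \<Rightarrow> 'a set) \<Rightarrow> bool" where
  "generates_operad K P X \<longleftrightarrow>
     (\<forall>n\<ge>1. \<Inter>{S n | S. suboperad K P S \<and> (\<forall>m\<ge>1. X m \<subseteq> S m)} = carrier (cpt P n))"

definition minimally_generated ::
  "('k, 'm) ring_scheme \<Rightarrow> ('k, 'a, 'z) opd_scheme \<Rightarrow> (nat \<Rightarrow> 'a set) \<Rightarrow> bool" where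
  "minimally_generated K P X \<longleftrightarrow>
     sub_s_module K P X \<and> generates_operad K P X \<and>
     (\<forall>Y. sub_s_module K P Y \<and> (\<forall>n\<ge>1. Y n \<subseteq> X n) \<and> generates_operad K P Y
        \<longrightarrow> (\<forall>n\<ge>1. Y n = X n))"

definition operad_ideal ::
  "('k, 'm) ring_scheme \<Rightarrow> ('k, 'a, 'z) opd_scheme \<Rightarrow> (nat \<Rightarrow> 'a set) \<Rightarrow> bool" where
  "operad_ideal K P I \<longleftrightarrow>
     sub_s_module K P I \<and>
     (\<forall>m\<ge>1. \<forall>n\<ge>1. \<forall>i\<in>{1..m}. \<forall>\<mu>\<in>I m. \<forall>\<nu>\<in>carrier (cpt P n).
        circ P m n i \<mu> \<nu> \<in> I (m + n - 1)) \<and>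
     (\<forall>m\<ge>1. \<forall>n\<ge>1. \<forall>i\<in>{1..m}. \<forall>\<mu>\<in>carrier (cpt P m). \<forall>\<nu>\<in>I n.
        circ P m n i \<mu> \<nu> \<in> I (m + n - 1))"

definition ideal_generated ::
  "('k, 'm) ring_scheme \<Rightarrow> ('k, 'a, 'z) opd_scheme \<Rightarrow> (nat \<Rightarrow> 'a set) \<Rightarrow> nat \<Rightarrow> 'a set" where
  "ideal_generated K P R n = \<Inter>{I n | I. operad_ideal K P I \<and> (\<forall>m\<ge>1. R m \<subseteq> I m)}"

section \<open>Free operads\<close>

text \<open>
  The free operad on an S-module \<open>X\<close> consists of the formal operadic expressions in elements
  of \<open>X\<close>, modulo the congruence generated by the axioms of an operad and the S-module
  structure of \<open>X\<close>. It is an operad by \<open>operad_free_operad\<close>; its universal property consists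
  of \<open>operad_hom_free_ext\<close> and \<open>free_ext_gen\<close> (existence) and \<open>free_operad_universal\<close>
  (uniqueness).
\<close>

datatype ('k, 'x) opexp =
    Gen nat 'x
  | Unit
  | Zero nat
  | Add "('k, 'x) opexp" "('k, 'x) opexp"
  | Smult 'k "('k, 'x) opexp"
  | Act "nat \<Rightarrow> nat" "('k, 'x) opexp"
  | Circ nat "('k, 'x) opexp" "('k, 'x) opexp"

inductive opexp_of ::
  "('k, 'm) ring_scheme \<Rightarrow> ('k, 'x, 'z) smod_scheme \<Rightarrow> nat \<Rightarrow> ('k, 'x) opexp \<Rightarrow> bool"
  for K :: "('k, 'm) ring_scheme" and X :: "('k, 'x, 'z) smod_scheme" where
  Gen: "\<lbrakk>1 \<le> n; x \<in> carrier (cpt X n)\<rbrakk> \<Longrightarrow> opexp_of K X n (Gen n x)"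
| Unit: "opexp_of K X 1 Unit"
| Zero: "1 \<le> n \<Longrightarrow> opexp_of K X n (Zero n)"
| Add: "\<lbrakk>opexp_of K X n s; opexp_of K X n t\<rbrakk> \<Longrightarrow> opexp_of K X n (Add s t)"
| Smult: "\<lbrakk>c \<in> carrier K; opexp_of K X n t\<rbrakk> \<Longrightarrow> opexp_of K X n (Smult c t)"
| Act: "\<lbrakk>\<sigma> permutes {1..n}; opexp_of K X n t\<rbrakk> \<Longrightarrow> opexp_of K X n (Act \<sigma> t)"
| Circ: "\<lbrakk>opexp_of K X m s; opexp_of K X n t; i \<in> {1..m}\<rbrakk>
    \<Longrightarrow> opexp_of K X (m + n - 1) (Circ i s t)"

inductive opexp_eq ::
  "('k, 'm) ring_scheme \<Rightarrow> ('k, 'x, 'z) smod_scheme \<Rightarrow> nat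
    \<Rightarrow> ('k, 'x) opexp \<Rightarrow> ('k, 'x) opexp \<Rightarrow> bool"
  for K :: "('k, 'm) ring_scheme" and X :: "('k, 'x, 'z) smod_scheme" where
  refl: "opexp_of K X n t \<Longrightarrow> opexp_eq K X n t t"
| sym: "opexp_eq K X n s t \<Longrightarrow> opexp_eq K X n t s"
| trans: "\<lbrakk>opexp_eq K X n s t; opexp_eq K X n t u\<rbrakk> \<Longrightarrow> opexp_eq K X n s u"
| cong_add: "\<lbrakk>opexp_eq K X n s s'; opexp_eq K X n t t'\<rbrakk>
    \<Longrightarrow> opexp_eq K X n (Add s t) (Add s' t')"
| cong_smult: "\<lbrakk>c \<in> carrier K; opexp_eq K X n t t'\<rbrakk>
    \<Longrightarrow> opexp_eq K X n (Smult c t) (Smult c t')"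
| cong_act: "\<lbrakk>\<sigma> permutes {1..n}; opexp_eq K X n t t'\<rbrakk>
    \<Longrightarrow> opexp_eq K X n (Act \<sigma> t) (Act \<sigma> t')"
| cong_circ: "\<lbrakk>opexp_eq K X m s s'; opexp_eq K X n t t'; i \<in> {1..m}\<rbrakk>
    \<Longrightarrow> opexp_eq K X (m + n - 1) (Circ i s t) (Circ i s' t')"
  \<comment> \<open>vector spaces\<close>
| add_assoc: "\<lbrakk>opexp_of K X n s; opexp_of K X n t; opexp_of K X n u\<rbrakk>
    \<Longrightarrow> opexp_eq K X n (Add (Add s t) u) (Add s (Add t u))"
| add_comm: "\<lbrakk>opexp_of K X n s; opexp_of K X n t\<rbrakk> \<Longrightarrow> opexp_eq K X n (Add s t) (Add t s)"
| add_zero: "opexp_of K X n t \<Longrightarrow> opexp_eq K X n (Add (Zero n) t) t"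
| add_neg: "opexp_of K X n t \<Longrightarrow> opexp_eq K X n (Add (Smult (\<ominus>\<^bsub>K\<^esub> \<one>\<^bsub>K\<^esub>) t) t) (Zero n)"
| smult_l_distr: "\<lbrakk>c \<in> carrier K; d \<in> carrier K; opexp_of K X n t\<rbrakk>
    \<Longrightarrow> opexp_eq K X n (Smult (c \<oplus>\<^bsub>K\<^esub> d) t) (Add (Smult c t) (Smult d t))"
| smult_r_distr: "\<lbrakk>c \<in> carrier K; opexp_of K X n s; opexp_of K X n t\<rbrakk>
    \<Longrightarrow> opexp_eq K X n (Smult c (Add s t)) (Add (Smult c s) (Smult c t))"
| smult_assoc: "\<lbrakk>c \<in> carrier K; d \<in> carrier K; opexp_of K X n t\<rbrakk>
    \<Longrightarrow> opexp_eq K X n (Smult (c \<otimes>\<^bsub>K\<^esub> d) t) (Smult c (Smult d t))"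
| smult_one: "opexp_of K X n t \<Longrightarrow> opexp_eq K X n (Smult \<one>\<^bsub>K\<^esub> t) t"
  \<comment> \<open>linear actions of the symmetric groups\<close>
| act_add: "\<lbrakk>\<sigma> permutes {1..n}; opexp_of K X n s; opexp_of K X n t\<rbrakk>
    \<Longrightarrow> opexp_eq K X n (Act \<sigma> (Add s t)) (Add (Act \<sigma> s) (Act \<sigma> t))"
| act_smult: "\<lbrakk>\<sigma> permutes {1..n}; c \<in> carrier K; opexp_of K X n t\<rbrakk>
    \<Longrightarrow> opexp_eq K X n (Act \<sigma> (Smult c t)) (Smult c (Act \<sigma> t))"
| act_id: "opexp_of K X n t \<Longrightarrow> opexp_eq K X n (Act id t) t"
| act_comp: "\<lbrakk>\<sigma> permutes {1..n}; \<tau> permutes {1..n}; opexp_of K X n t\<rbrakk>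
    \<Longrightarrow> opexp_eq K X n (Act (\<sigma> \<circ> \<tau>) t) (Act \<sigma> (Act \<tau> t))"
  \<comment> \<open>partial compositions\<close>
| circ_add_left: "\<lbrakk>opexp_of K X m s; opexp_of K X m s'; opexp_of K X n t; i \<in> {1..m}\<rbrakk>
    \<Longrightarrow> opexp_eq K X (m + n - 1) (Circ i (Add s s') t) (Add (Circ i s t) (Circ i s' t))"
| circ_smult_left: "\<lbrakk>c \<in> carrier K; opexp_of K X m s; opexp_of K X n t; i \<in> {1..m}\<rbrakk>
    \<Longrightarrow> opexp_eq K X (m + n - 1) (Circ i (Smult c s) t) (Smult c (Circ i s t))"
| circ_add_right: "\<lbrakk>opexp_of K X m s; opexp_of K X n t; opexp_of K X n t'; i \<in> {1..m}\<rbrakk>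
    \<Longrightarrow> opexp_eq K X (m + n - 1) (Circ i s (Add t t')) (Add (Circ i s t) (Circ i s t'))"
| circ_smult_right: "\<lbrakk>c \<in> carrier K; opexp_of K X m s; opexp_of K X n t; i \<in> {1..m}\<rbrakk>
    \<Longrightarrow> opexp_eq K X (m + n - 1) (Circ i s (Smult c t)) (Smult c (Circ i s t))"
| circ_unit_left: "opexp_of K X n t \<Longrightarrow> opexp_eq K X n (Circ 1 Unit t) t"
| circ_unit_right: "\<lbrakk>opexp_of K X m s; i \<in> {1..m}\<rbrakk> \<Longrightarrow> opexp_eq K X m (Circ i s Unit) s"
| circ_sequential: "\<lbrakk>opexp_of K X l s; opexp_of K X m t; opexp_of K X n u;
      i \<in> {1..l}; j \<in> {1..m}\<rbrakk>
    \<Longrightarrow> opexp_eq K X (l + m + n - 2) (Circ (i - 1 + j) (Circ i s t) u) (Circ i s (Circ j t u))"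
| circ_parallel: "\<lbrakk>opexp_of K X l s; opexp_of K X m t; opexp_of K X n u;
      1 \<le> i; i < j; j \<le> l\<rbrakk>
    \<Longrightarrow> opexp_eq K X (l + m + n - 2) (Circ (j - 1 + m) (Circ i s t) u) (Circ i (Circ j s u) t)"
| circ_equivariant: "\<lbrakk>opexp_of K X m s; opexp_of K X n t; i \<in> {1..m};
      \<sigma> permutes {1..m}; \<tau> permutes {1..n}\<rbrakk>
    \<Longrightarrow> opexp_eq K X (m + n - 1) (Circ (\<sigma> i) (Act \<sigma> s) (Act \<tau> t))
          (Act (perm_circ m n i \<sigma> \<tau>) (Circ i s t))"
  \<comment> \<open>generators\<close>
| gen_add: "\<lbrakk>1 \<le> n; x \<in> carrier (cpt X n); y \<in> carrier (cpt X n)\<rbrakk>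
    \<Longrightarrow> opexp_eq K X n (Gen n (x \<oplus>\<^bsub>cpt X n\<^esub> y)) (Add (Gen n x) (Gen n y))"
| gen_smult: "\<lbrakk>1 \<le> n; c \<in> carrier K; x \<in> carrier (cpt X n)\<rbrakk>
    \<Longrightarrow> opexp_eq K X n (Gen n (c \<odot>\<^bsub>cpt X n\<^esub> x)) (Smult c (Gen n x))"
| gen_act: "\<lbrakk>1 \<le> n; \<sigma> permutes {1..n}; x \<in> carrier (cpt X n)\<rbrakk>
    \<Longrightarrow> opexp_eq K X n (Gen n (sact X n \<sigma> x)) (Act \<sigma> (Gen n x))"

definition opexp_rel ::
  "('k, 'm) ring_scheme \<Rightarrow> ('k, 'x, 'z) smod_scheme \<Rightarrow> nat
    \<Rightarrow> (('k, 'x) opexp \<times> ('k, 'x) opexp) set" where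
  "opexp_rel K X n = {(s, t). opexp_eq K X n s t}"

definition free_operad ::
  "('k, 'm) ring_scheme \<Rightarrow> ('k, 'x, 'z) smod_scheme \<Rightarrow> ('k, ('k, 'x) opexp set) opd" where
  "free_operad K X =
     \<lparr>cpt = (\<lambda>n.
        \<lparr>carrier = {t. opexp_of K X n t} // opexp_rel K X n,
         monoid.mult = undefined, one = undefined,
         zero = opexp_rel K X n `` {Zero n},
         add = (\<lambda>A B. \<Union>s\<in>A. \<Union>t\<in>B. opexp_rel K X n `` {Add s t}),
         smult = (\<lambda>c A. \<Union>t\<in>A. opexp_rel K X n `` {Smult c t})\<rparr>),
      sact = (\<lambda>n \<sigma> A. \<Union>t\<in>A. opexp_rel K X n `` {Act \<sigma> t}),
      ounit = opexp_rel K X 1 `` {Unit},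
      circ = (\<lambda>m n i A B. \<Union>s\<in>A. \<Union>t\<in>B. opexp_rel K X (m + n - 1) `` {Circ i s t})\<rparr>"

definition free_gen ::
  "('k, 'm) ring_scheme \<Rightarrow> ('k, 'x, 'z) smod_scheme \<Rightarrow> nat \<Rightarrow> 'x \<Rightarrow> ('k, 'x) opexp set" where
  "free_gen K X n x = opexp_rel K X n `` {Gen n x}"

primrec opexp_arity :: "('k, 'x) opexp \<Rightarrow> nat" where
  "opexp_arity (Gen n x) = n"
| "opexp_arity Unit = 1"
| "opexp_arity (Zero n) = n"
| "opexp_arity (Add s t) = opexp_arity s"
| "opexp_arity (Smult c t) = opexp_arity t"
| "opexp_arity (Act \<sigma> t) = opexp_arity t"
| "opexp_arity (Circ i s t) = opexp_arity s + opexp_arity t - 1"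

primrec opexp_eval ::
  "('k, 'a, 'z) opd_scheme \<Rightarrow> (nat \<Rightarrow> 'x \<Rightarrow> 'a) \<Rightarrow> ('k, 'x) opexp \<Rightarrow> 'a" where
  "opexp_eval P f (Gen n x) = f n x"
| "opexp_eval P f Unit = ounit P"
| "opexp_eval P f (Zero n) = \<zero>\<^bsub>cpt P n\<^esub>"
| "opexp_eval P f (Add s t) = opexp_eval P f s \<oplus>\<^bsub>cpt P (opexp_arity s)\<^esub> opexp_eval P f t"
| "opexp_eval P f (Smult c t) = c \<odot>\<^bsub>cpt P (opexp_arity t)\<^esub> opexp_eval P f t"
| "opexp_eval P f (Act \<sigma> t) = sact P (opexp_arity t) \<sigma> (opexp_eval P f t)"
| "opexp_eval P f (Circ i s t) =
     circ P (opexp_arity s) (opexp_arity t) i (opexp_eval P f s) (opexp_eval P f t)"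

text \<open>The operad morphism out of the free operad that extends a morphism \<open>f\<close> of S-modules;
  all representatives of a class have the same value.\<close>

definition free_ext ::
  "('k, 'a, 'z) opd_scheme \<Rightarrow> (nat \<Rightarrow> 'x \<Rightarrow> 'a) \<Rightarrow> nat \<Rightarrow> ('k, 'x) opexp set \<Rightarrow> 'a" where
  "free_ext P f n A = the_elem (opexp_eval P f ` A)"

text \<open>The canonical morphism to \<open>P\<close> from the free operad on a sub-S-module \<open>X\<close> of \<open>P\<close> extends
  the inclusion.\<close>

definition relation_kernel ::
  "('k, 'm) ring_scheme \<Rightarrow> ('k, 'a, 'z) opd_scheme \<Rightarrow> (nat \<Rightarrow> 'a set)
    \<Rightarrow> nat \<Rightarrow> ('k, 'a) opexp set set" where
  "relation_kernel K P X n =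
     a_kernel (cpt (free_operad K (restrict_smod P X)) n) (cpt P n) (free_ext P (\<lambda>n x. x) n)"

definition minimal_relations ::
  "('k, 'm) ring_scheme \<Rightarrow> ('k, 'a, 'z) opd_scheme \<Rightarrow> (nat \<Rightarrow> 'a set)
    \<Rightarrow> (nat \<Rightarrow> ('k, 'a) opexp set set) \<Rightarrow> bool" where
  "minimal_relations K P X R \<longleftrightarrow>
     (let F = free_operad K (restrict_smod P X);
          generates = (\<lambda>R'. \<forall>n\<ge>1. ideal_generated K F R' n = relation_kernel K P X n)
      in sub_s_module K F R \<and> generates R \<and>
         (\<forall>R'. sub_s_module K F R' \<and> (\<forall>n\<ge>1. R' n \<subseteq> R n) \<and> generates R'
            \<longrightarrow> (\<forall>n\<ge>1. R' n = R n)))"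

section \<open>Universal property of the free operad, and direct sums\<close>


lemma opexp_of_pos: "opexp_of K X n t \<Longrightarrow> 1 \<le> n"
  by (induction rule: opexp_of.induct) auto

lemma perm_circ_permutes:
  assumes i: "i \<in> {1..m}" and n: "1 \<le> n"
    and \<sigma>: "\<sigma> permutes {1..m}" and \<tau>: "\<tau> permutes {1..n}"
  shows "perm_circ m n i \<sigma> \<tau> permutes {1..m + n - 1}"
proof -
  let ?p = "perm_circ m n i \<sigma> \<tau>"
  have s: "1 \<le> \<sigma> a \<and> \<sigma> a \<le> m" if "1 \<le> a" "a \<le> m" for a
    using permutes_in_image[OF \<sigma>, of a] that by auto
  have t: "1 \<le> \<tau> a \<and> \<tau> a \<le> n" if "1 \<le> a" "a \<le> n" for a
    using permutes_in_image[OF \<tau>, of a] that by auto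
  have si: "\<sigma> a = \<sigma> b \<longleftrightarrow> a = b" for a b
    using permutes_inj[OF \<sigma>] by (auto dest: injD)
  have ti: "\<tau> a = \<tau> b \<longleftrightarrow> a = b" for a b
    using permutes_inj[OF \<tau>] by (auto dest: injD)
  have p1: "?p a = (if \<sigma> a < \<sigma> i then \<sigma> a else \<sigma> a + n - 1)"
    if "1 \<le> a" "a < i" for a
    using that i n by (auto simp: perm_circ_def Let_def)
  have p2: "?p a = \<sigma> i + \<tau> (a - i + 1) - 1" if "i \<le> a" "a < i + n" for a
    using that i n by (auto simp: perm_circ_def Let_def)
  have p3: "?p a = (if \<sigma> (a - n + 1) < \<sigma> i then \<sigma> (a - n + 1) else \<sigma> (a - n + 1) + n - 1)"
    if "i + n \<le> a" "a \<le> m + n - 1" for a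
    using that i n by (auto simp: perm_circ_def Let_def)
  define c where "c a = (if a < i then a else a - n + 1)" for a
  have out: "1 \<le> c a \<and> c a \<le> m \<and> c a \<noteq> i \<and>
      ?p a = (if \<sigma> (c a) < \<sigma> i then \<sigma> (c a) else \<sigma> (c a) + n - 1)"
    if "a \<in> {1..m + n - 1}" "\<not> (i \<le> a \<and> a < i + n)" for a
    using that i n p1[of a] p3[of a] unfolding c_def by (cases "a < i") auto
  have cinj: "a = b" if "c a = c b" "\<not> (i \<le> a \<and> a < i + n)" "\<not> (i \<le> b \<and> b < i + n)" for a b
    using that n unfolding c_def by (auto split: if_splits)
  have inb: "\<sigma> i \<le> ?p a \<and> ?p a < \<sigma> i + n" if "i \<le> a" "a < i + n" for a
  proof -
    have "1 \<le> \<tau> (a - i + 1) \<and> \<tau> (a - i + 1) \<le> n" by (rule t) (use that in auto)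
    then show ?thesis using p2[OF that] s[of i] i by auto
  qed
  have outb: "\<not> (\<sigma> i \<le> ?p a \<and> ?p a < \<sigma> i + n) \<and> 1 \<le> ?p a \<and> ?p a \<le> m + n - 1"
    if "a \<in> {1..m + n - 1}" "\<not> (i \<le> a \<and> a < i + n)" for a
  proof -
    have o: "1 \<le> c a" "c a \<le> m" "c a \<noteq> i"
      "?p a = (if \<sigma> (c a) < \<sigma> i then \<sigma> (c a) else \<sigma> (c a) + n - 1)"
      using out[OF that] by auto
    have "\<sigma> (c a) \<noteq> \<sigma> i" using o si by auto
    then show ?thesis using o s[of "c a"] n by auto
  qed
  have maps: "?p ` {1..m + n - 1} \<subseteq> {1..m + n - 1}"
  proof clarify
    fix a assume a: "a \<in> {1..m + n - 1}"
    show "?p a \<in> {1..m + n - 1}"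
    proof (cases "i \<le> a \<and> a < i + n")
      case True
      then have "\<sigma> i \<le> ?p a" "?p a < \<sigma> i + n" using inb[of a] by auto
      then show ?thesis using s[of i] i by auto
    next
      case False
      then show ?thesis using outb[OF a] by auto
    qed
  qed
  have inj: "inj_on ?p {1..m + n - 1}"
  proof (rule inj_onI)
    fix a b assume a: "a \<in> {1..m + n - 1}" and b: "b \<in> {1..m + n - 1}" and eq: "?p a = ?p b"
    show "a = b"
    proof (cases "i \<le> a \<and> a < i + n"; cases "i \<le> b \<and> b < i + n")
      assume A: "i \<le> a \<and> a < i + n" and B: "i \<le> b \<and> b < i + n"
      have "1 \<le> \<tau> (a - i + 1) \<and> 1 \<le> \<tau> (b - i + 1)" using t A B by auto
      then have "\<tau> (a - i + 1) = \<tau> (b - i + 1)" using eq p2[of a] p2[of b] A B by linarith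
      then show ?thesis using ti A B by auto
    next
      assume "i \<le> a \<and> a < i + n" "\<not> (i \<le> b \<and> b < i + n)"
      then show ?thesis using inb[of a] outb[OF b] eq by auto
    next
      assume "\<not> (i \<le> a \<and> a < i + n)" "i \<le> b \<and> b < i + n"
      then show ?thesis using inb[of b] outb[OF a] eq by auto
    next
      assume A: "\<not> (i \<le> a \<and> a < i + n)" and B: "\<not> (i \<le> b \<and> b < i + n)"
      have oa: "1 \<le> c a" "c a \<le> m" "c a \<noteq> i"
        "?p a = (if \<sigma> (c a) < \<sigma> i then \<sigma> (c a) else \<sigma> (c a) + n - 1)"
        using out[OF a A] by auto
      have ob: "1 \<le> c b" "c b \<le> m" "c b \<noteq> i"
        "?p b = (if \<sigma> (c b) < \<sigma> i then \<sigma> (c b) else \<sigma> (c b) + n - 1)"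
        using out[OF b B] by auto
      have "\<sigma> (c a) \<noteq> \<sigma> i" "\<sigma> (c b) \<noteq> \<sigma> i" using oa ob si by auto
      then have "\<sigma> (c a) = \<sigma> (c b)"
        using eq oa(4) ob(4) n by (auto split: if_splits)
      then show ?thesis using si cinj A B by auto
    qed
  qed
  have "bij_betw ?p {1..m + n - 1} {1..m + n - 1}"
    using inj maps by (simp add: bij_betw_def endo_inj_surj)
  moreover have "?p a = a" if "a \<notin> {1..m + n - 1}" for a
    using that by (simp add: perm_circ_def Let_def)
  ultimately show ?thesis by (rule bij_imp_permutes)
qed

context
  fixes K :: "('k, 'm) ring_scheme" and X :: "('k, 'x, 'z) smod_scheme"
  assumes X: "s_module K X"
begin

interpretation X: s_module K X by (rule X)

lemma opexp_ring: "vectorspace K (cpt X 1)"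
  using X.vectorspace_cpt by simp

interpretation V: vectorspace K "cpt X 1" by (rule opexp_ring)

lemma opexp_circI: "\<lbrakk>opexp_of K X m s; opexp_of K X n t; i \<in> {1..m}; k = m + n - 1\<rbrakk>
    \<Longrightarrow> opexp_of K X k (Circ i s t)"
  using opexp_of.Circ by blast

lemma opexp_hom_closed:
  "\<lbrakk>f \<in> LinearCombinations.module_hom K M N; x \<in> carrier M\<rbrakk> \<Longrightarrow> f x \<in> carrier N"
  by (auto simp: LinearCombinations.module_hom_def)

lemma opexp_eq_of:
  assumes "opexp_eq K X n s t"
  shows "opexp_of K X n s \<and> opexp_of K X n t"
  using assms
proof (induction rule: opexp_eq.induct)
  case (circ_unit_left n t)
  show ?case using circ_unit_left opexp_of_pos[OF circ_unit_left] 
    by (auto intro!: opexp_circI opexp_of.Unit)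
next
  case (circ_unit_right m s i)
  then show ?case by (auto intro!: opexp_circI[where n=1] opexp_of.Unit)
next
  case (circ_sequential l s m t n u i j)
  note p = circ_sequential(1-3)[THEN opexp_of_pos]
  have "opexp_of K X (l + m - 1) (Circ i s t)" "opexp_of K X (m + n - 1) (Circ j t u)"
    using circ_sequential opexp_of.Circ by blast+
  then have "opexp_of K X (l + m - 1 + n - 1) (Circ (i - 1 + j) (Circ i s t) u)"
    "opexp_of K X (l + (m + n - 1) - 1) (Circ i s (Circ j t u))"
    using circ_sequential by (intro opexp_of.Circ; auto)+
  moreover have "l + m - 1 + n - 1 = l + m + n - 2" "l + (m + n - 1) - 1 = l + m + n - 2"
    using p by auto
  ultimately show ?case by simp
next
  case (circ_parallel l s m t n u i j)
  note p = circ_parallel(1-3)[THEN opexp_of_pos]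
  have "opexp_of K X (l + m - 1) (Circ i s t)" "opexp_of K X (l + n - 1) (Circ j s u)"
    using circ_parallel by (auto intro!: opexp_circI)
  then have "opexp_of K X (l + m - 1 + n - 1) (Circ (j - 1 + m) (Circ i s t) u)"
    "opexp_of K X (l + n - 1 + m - 1) (Circ i (Circ j s u) t)"
    using circ_parallel p by (intro opexp_of.Circ; auto)+
  moreover have "l + m - 1 + n - 1 = l + m + n - 2" "l + n - 1 + m - 1 = l + m + n - 2"
    using p by auto
  ultimately show ?case by simp
next
  case (circ_equivariant m s n t i \<sigma> \<tau>)
  then have "perm_circ m n i \<sigma> \<tau> permutes {1..m + n - 1}"
    by (intro perm_circ_permutes) (auto dest: opexp_of_pos)
  moreover have "\<sigma> i \<in> {1..m}" using permutes_in_image[OF circ_equivariant(4)] circ_equivariant(3) by simp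
  ultimately show ?case
    using circ_equivariant by (auto intro!: opexp_of.intros simp del: One_nat_def)
next
  case (gen_add n x y)
  interpret W: vectorspace K "cpt X n" using X.vectorspace_cpt gen_add by simp
  show ?case using gen_add by (auto intro!: opexp_of.intros)
next
  case (gen_smult n c x)
  interpret W: vectorspace K "cpt X n" using X.vectorspace_cpt gen_smult by simp
  show ?case using gen_smult by (auto intro!: opexp_of.intros)
next
  case (gen_act n \<sigma> x)
  then have "sact X n \<sigma> x \<in> carrier (cpt X n)"
    using opexp_hom_closed[OF X.sact_hom[OF gen_act(1,2)]] by simp
  then show ?case using gen_act by (auto intro!: opexp_of.intros)
next
  case (act_id n t)
  then show ?case by (simp add: opexp_of.Act[OF permutes_id])
next
  case (act_comp \<sigma> n \<tau> t)
  then show ?case by (simp add: opexp_of.Act permutes_compose)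
next
  case (add_zero n t)
  then show ?case using opexp_of_pos[OF add_zero] by (simp add: opexp_of.intros)
next
  case (add_neg n t)
  then show ?case using opexp_of_pos[OF add_neg] by (simp add: opexp_of.intros)
qed (auto intro!: opexp_of.intros simp del: One_nat_def)


lemma equiv_opexp_rel: "equiv {t. opexp_of K X n t} (opexp_rel K X n)"
proof (rule equivI)
  show "opexp_rel K X n \<subseteq> {t. opexp_of K X n t} \<times> {t. opexp_of K X n t}"
    using opexp_eq_of by (auto simp: opexp_rel_def)
  show "refl_on {t. opexp_of K X n t} (opexp_rel K X n)"
    by (auto simp: refl_on_def opexp_rel_def intro: opexp_eq.refl)
  show "Relation.sym (opexp_rel K X n)"
    by (auto simp: sym_def opexp_rel_def intro: opexp_eq.sym)
  show "Relation.trans (opexp_rel K X n)"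
    by (auto simp: trans_def opexp_rel_def intro: opexp_eq.trans)
qed

abbreviation cls :: "nat \<Rightarrow> ('k, 'x) opexp \<Rightarrow> ('k, 'x) opexp set" where
  "cls n t \<equiv> opexp_rel K X n `` {t}"

lemma cls_eqI: "opexp_eq K X n s t \<Longrightarrow> cls n s = cls n t"
  using equiv_class_eq[OF equiv_opexp_rel] by (simp add: opexp_rel_def)

lemma in_cls_self: "opexp_of K X n t \<Longrightarrow> t \<in> cls n t"
  by (simp add: opexp_rel_def opexp_eq.refl)

lemma UN_cls:
  assumes "opexp_of K X n t" "\<And>t'. opexp_eq K X n t t' \<Longrightarrow> opexp_eq K X k (F t) (F t')"
  shows "(\<Union>t\<in>cls n t. cls k (F t)) = cls k (F t)"
proof -
  have "cls k (F t') = cls k (F t)" if "t' \<in> cls n t" for t'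
    using cls_eqI assms(2)[of t'] that by (auto simp: opexp_rel_def)
  then show ?thesis using in_cls_self[OF assms(1)] by blast
qed

lemma UN_cls2:
  assumes "opexp_of K X m s" "opexp_of K X n t"
    "\<And>s' t'. \<lbrakk>opexp_eq K X m s s'; opexp_eq K X n t t'\<rbrakk> \<Longrightarrow> opexp_eq K X k (F s t) (F s' t')"
  shows "(\<Union>s\<in>cls m s. \<Union>t\<in>cls n t. cls k (F s t)) = cls k (F s t)"
proof -
  have "cls k (F s' t') = cls k (F s t)" if "s' \<in> cls m s" "t' \<in> cls n t" for s' t'
    using cls_eqI assms(3)[of s' t'] that by (auto simp: opexp_rel_def)
  then show ?thesis using in_cls_self[OF assms(1)] in_cls_self[OF assms(2)] by blast
qed

lemma free_add_cls: "\<lbrakk>opexp_of K X n s; opexp_of K X n t\<rbrakk>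
    \<Longrightarrow> cls n s \<oplus>\<^bsub>cpt (free_operad K X) n\<^esub> cls n t = cls n (Add s t)"
  by (simp add: free_operad_def UN_cls2 opexp_eq.cong_add)

lemma free_smult_cls: "\<lbrakk>c \<in> carrier K; opexp_of K X n t\<rbrakk>
    \<Longrightarrow> c \<odot>\<^bsub>cpt (free_operad K X) n\<^esub> cls n t = cls n (Smult c t)"
  by (simp add: free_operad_def UN_cls opexp_eq.cong_smult)

lemma free_sact_cls: "\<lbrakk>\<sigma> permutes {1..n}; opexp_of K X n t\<rbrakk>
    \<Longrightarrow> sact (free_operad K X) n \<sigma> (cls n t) = cls n (Act \<sigma> t)"
  by (simp add: free_operad_def UN_cls opexp_eq.cong_act)

lemma free_circ_cls: "\<lbrakk>opexp_of K X m s; opexp_of K X n t; i \<in> {1..m}\<rbrakk>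
    \<Longrightarrow> circ (free_operad K X) m n i (cls m s) (cls n t) = cls (m + n - 1) (Circ i s t)"
  unfolding free_operad_def opd.simps by (rule UN_cls2) (assumption | blast intro: opexp_eq.cong_circ)+

lemma free_zero_cls: "\<zero>\<^bsub>cpt (free_operad K X) n\<^esub> = cls n (Zero n)"
  by (simp add: free_operad_def)

lemma free_ounit_cls: "ounit (free_operad K X) = cls 1 Unit"
  by (simp add: free_operad_def)

lemma free_carrier: "carrier (cpt (free_operad K X) n) = {cls n t | t. opexp_of K X n t}"
  by (auto simp: free_operad_def quotient_def)

lemma cls_in_carrier: "opexp_of K X n t \<Longrightarrow> cls n t \<in> carrier (cpt (free_operad K X) n)"
  by (auto simp: free_carrier)

lemma free_carrierE:
  assumes "A \<in> carrier (cpt (free_operad K X) n)"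
  obtains t where "opexp_of K X n t" "A = cls n t"
  using assms by (auto simp: free_carrier)

lemmas free_cls =
  free_add_cls free_smult_cls free_sact_cls free_circ_cls free_zero_cls free_ounit_cls

lemma vectorspace_free_operad:
  assumes n: "1 \<le> n"
  shows "vectorspace K (cpt (free_operad K X) n)"
proof -
  let ?F = "cpt (free_operad K X) n"
  have ab: "abelian_group ?F"
  proof (rule abelian_groupI)
    fix x y assume "x \<in> carrier ?F" "y \<in> carrier ?F"
    then show "x \<oplus>\<^bsub>?F\<^esub> y \<in> carrier ?F"
      by (auto elim!: free_carrierE simp: free_cls intro!: cls_in_carrier opexp_of.intros)
  next
    show "\<zero>\<^bsub>?F\<^esub> \<in> carrier ?F" using n
      by (auto simp: free_cls intro!: cls_in_carrier opexp_of.intros)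
  next
    fix x y z assume "x \<in> carrier ?F" "y \<in> carrier ?F" "z \<in> carrier ?F"
    then show "x \<oplus>\<^bsub>?F\<^esub> y \<oplus>\<^bsub>?F\<^esub> z = x \<oplus>\<^bsub>?F\<^esub> (y \<oplus>\<^bsub>?F\<^esub> z)"
      by (elim free_carrierE) (simp add: free_cls opexp_of.intros cls_eqI[OF opexp_eq.add_assoc])
  next
    fix x y assume "x \<in> carrier ?F" "y \<in> carrier ?F"
    then show "x \<oplus>\<^bsub>?F\<^esub> y = y \<oplus>\<^bsub>?F\<^esub> x"
      by (elim free_carrierE) (simp add: free_cls opexp_of.intros cls_eqI[OF opexp_eq.add_comm])
  next
    fix x assume "x \<in> carrier ?F"
    then show "\<zero>\<^bsub>?F\<^esub> \<oplus>\<^bsub>?F\<^esub> x = x" using n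
      by (elim free_carrierE) (simp add: free_cls opexp_of.intros cls_eqI[OF opexp_eq.add_zero])
  next
    fix x assume "x \<in> carrier ?F"
    then obtain t where t: "opexp_of K X n t" "x = cls n t" by (rule free_carrierE)
    have m1: "\<ominus>\<^bsub>K\<^esub> \<one>\<^bsub>K\<^esub> \<in> carrier K" by simp
    have "cls n (Smult (\<ominus>\<^bsub>K\<^esub> \<one>\<^bsub>K\<^esub>) t) \<oplus>\<^bsub>?F\<^esub> x = \<zero>\<^bsub>?F\<^esub>"
      using t m1 by (simp add: free_cls opexp_of.intros cls_eqI[OF opexp_eq.add_neg])
    then show "\<exists>y\<in>carrier ?F. y \<oplus>\<^bsub>?F\<^esub> x = \<zero>\<^bsub>?F\<^esub>"
      using t m1 by (blast intro: cls_in_carrier opexp_of.intros)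
  qed
  have "Module.module K ?F"
  proof (rule moduleI)
    show "cring K" by (rule V.is_cring)
    show "abelian_group ?F" by (rule ab)
    fix a x assume a: "a \<in> carrier K" and "x \<in> carrier ?F"
    then obtain t where t: "opexp_of K X n t" "x = cls n t" by (blast elim: free_carrierE)
    show "a \<odot>\<^bsub>?F\<^esub> x \<in> carrier ?F"
      using a t by (auto simp: free_cls intro!: cls_in_carrier opexp_of.intros)
  next
    fix a b x assume a: "a \<in> carrier K" and b: "b \<in> carrier K" and "x \<in> carrier ?F"
    then obtain t where t: "opexp_of K X n t" "x = cls n t" by (blast elim: free_carrierE)
    show "(a \<oplus>\<^bsub>K\<^esub> b) \<odot>\<^bsub>?F\<^esub> x = a \<odot>\<^bsub>?F\<^esub> x \<oplus>\<^bsub>?F\<^esub> b \<odot>\<^bsub>?F\<^esub> x"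
      using a b t by (simp add: free_cls opexp_of.intros cls_eqI[OF opexp_eq.smult_l_distr])
    show "(a \<otimes>\<^bsub>K\<^esub> b) \<odot>\<^bsub>?F\<^esub> x = a \<odot>\<^bsub>?F\<^esub> (b \<odot>\<^bsub>?F\<^esub> x)"
      using a b t by (simp add: free_cls opexp_of.intros cls_eqI[OF opexp_eq.smult_assoc])
  next
    fix a x y assume "a \<in> carrier K" "x \<in> carrier ?F" "y \<in> carrier ?F"
    then show "a \<odot>\<^bsub>?F\<^esub> (x \<oplus>\<^bsub>?F\<^esub> y) = a \<odot>\<^bsub>?F\<^esub> x \<oplus>\<^bsub>?F\<^esub> a \<odot>\<^bsub>?F\<^esub> y"
      by (elim free_carrierE) (simp add: free_cls opexp_of.intros cls_eqI[OF opexp_eq.smult_r_distr])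
  next
    fix x assume "x \<in> carrier ?F"
    then show "\<one>\<^bsub>K\<^esub> \<odot>\<^bsub>?F\<^esub> x = x"
      by (elim free_carrierE) (simp add: free_cls opexp_of.intros cls_eqI[OF opexp_eq.smult_one])
  qed
  then show ?thesis
    by (simp add: vectorspace_def V.field_axioms)
qed

theorem operad_free_operad: "operad K (free_operad K X)"
proof -
  let ?F = "free_operad K X"
  show ?thesis
  proof (intro operad.intro s_module.intro operad_axioms.intro)
    fix n :: nat assume "1 \<le> n"
    then show "vectorspace K (cpt ?F n)" by (rule vectorspace_free_operad)
  next
    fix n :: nat and \<sigma> assume "1 \<le> n" "\<sigma> permutes {1..n}"
    then show "sact ?F n \<sigma> \<in> LinearCombinations.module_hom K (cpt ?F n) (cpt ?F n)"
      unfolding LinearCombinations.module_hom_def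
      by (auto elim!: free_carrierE simp: free_cls opexp_of.intros
          cls_eqI[OF opexp_eq.act_add] cls_eqI[OF opexp_eq.act_smult]
          intro!: cls_in_carrier opexp_of.Act)
  next
    fix n :: nat and x assume "1 \<le> n" "x \<in> carrier (cpt ?F n)"
    then show "sact ?F n id x = x"
      by (elim free_carrierE) (simp add: free_cls permutes_id cls_eqI[OF opexp_eq.act_id])
  next
    fix n :: nat and \<sigma> \<tau> x assume "1 \<le> n" "\<sigma> permutes {1..n}" "\<tau> permutes {1..n}" "x \<in> carrier (cpt ?F n)"
    then show "sact ?F n (\<sigma> \<circ> \<tau>) x = sact ?F n \<sigma> (sact ?F n \<tau> x)"
      by (elim free_carrierE) (simp add: free_cls permutes_compose opexp_of.intros
          cls_eqI[OF opexp_eq.act_comp])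
  next
    show "ounit ?F \<in> carrier (cpt ?F 1)"
      unfolding free_ounit_cls by (rule cls_in_carrier[OF opexp_of.Unit])
  next
    fix m n i :: nat and \<nu> assume "1 \<le> m" "1 \<le> n" "i \<in> {1..m}" "\<nu> \<in> carrier (cpt ?F n)"
    then show "(\<lambda>\<mu>. circ ?F m n i \<mu> \<nu>) \<in> LinearCombinations.module_hom K (cpt ?F m) (cpt ?F (m + n - 1))"
      unfolding LinearCombinations.module_hom_def
      by (auto elim!: free_carrierE simp: free_cls opexp_of.intros
          cls_eqI[OF opexp_eq.circ_add_left] cls_eqI[OF opexp_eq.circ_smult_left]
          simp del: One_nat_def intro!: cls_in_carrier opexp_of.Circ)
  next
    fix m n i :: nat and \<mu> assume "1 \<le> m" "1 \<le> n" "i \<in> {1..m}" "\<mu> \<in> carrier (cpt ?F m)"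
    then show "(\<lambda>\<nu>. circ ?F m n i \<mu> \<nu>) \<in> LinearCombinations.module_hom K (cpt ?F n) (cpt ?F (m + n - 1))"
      unfolding LinearCombinations.module_hom_def
      by (auto elim!: free_carrierE simp: free_cls opexp_of.intros
          cls_eqI[OF opexp_eq.circ_add_right] cls_eqI[OF opexp_eq.circ_smult_right]
          simp del: One_nat_def intro!: cls_in_carrier opexp_of.Circ)
  next
    fix n :: nat and \<nu> assume "1 \<le> n" "\<nu> \<in> carrier (cpt ?F n)"
    then obtain t where t: "opexp_of K X n t" "\<nu> = cls n t" by (blast elim: free_carrierE)
    have "circ ?F 1 n 1 (ounit ?F) \<nu> = cls (1 + n - 1) (Circ 1 Unit t)"
      unfolding free_ounit_cls t(2) by (rule free_circ_cls[OF opexp_of.Unit t(1)]) simp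
    also have "1 + n - 1 = n" by simp
    finally show "circ ?F 1 n 1 (ounit ?F) \<nu> = \<nu>"
      using cls_eqI[OF opexp_eq.circ_unit_left[OF t(1)]] t(2) by simp
  next
    fix m i :: nat and \<mu> assume i: "1 \<le> m" "i \<in> {1..m}" and "\<mu> \<in> carrier (cpt ?F m)"
    then obtain t where t: "opexp_of K X m t" "\<mu> = cls m t" by (blast elim: free_carrierE)
    have "circ ?F m 1 i \<mu> (ounit ?F) = cls (m + 1 - 1) (Circ i t Unit)"
      unfolding free_ounit_cls t(2) by (rule free_circ_cls[OF t(1) opexp_of.Unit i(2)])
    then show "circ ?F m 1 i \<mu> (ounit ?F) = \<mu>"
      using cls_eqI[OF opexp_eq.circ_unit_right[OF t(1) i(2)]] t(2) by simp
  next
    fix l m n i j :: nat and la \<mu> \<nu>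
    assume a: "1 \<le> l" "1 \<le> m" "1 \<le> n" "i \<in> {1..l}" "j \<in> {1..m}"
      "la \<in> carrier (cpt ?F l)" "\<mu> \<in> carrier (cpt ?F m)" "\<nu> \<in> carrier (cpt ?F n)"
    obtain s where s: "opexp_of K X l s" "la = cls l s" using a by (blast elim: free_carrierE)
    obtain t where t: "opexp_of K X m t" "\<mu> = cls m t" using a by (blast elim: free_carrierE)
    obtain u where u: "opexp_of K X n u" "\<nu> = cls n u" using a by (blast elim: free_carrierE)
    have ar: "l + m - 1 + n - 1 = l + m + n - 2" "l + (m + n - 1) - 1 = l + m + n - 2"
      using a(1-3) by auto
    have ij: "i - 1 + j \<in> {1..l + m - 1}" using a by auto
    have 1: "circ ?F (l + m - 1) n (i - 1 + j) (circ ?F l m i la \<mu>) \<nu>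
        = cls (l + m - 1 + n - 1) (Circ (i - 1 + j) (Circ i s t) u)"
      unfolding s(2) t(2) u(2) free_circ_cls[OF s(1) t(1) a(4)]
      by (rule free_circ_cls[OF opexp_of.Circ[OF s(1) t(1) a(4)] u(1) ij])
    have 2: "circ ?F l (m + n - 1) i la (circ ?F m n j \<mu> \<nu>)
        = cls (l + (m + n - 1) - 1) (Circ i s (Circ j t u))"
      unfolding s(2) t(2) u(2) free_circ_cls[OF t(1) u(1) a(5)]
      by (rule free_circ_cls[OF s(1) opexp_of.Circ[OF t(1) u(1) a(5)] a(4)])
    show "circ ?F (l + m - 1) n (i - 1 + j) (circ ?F l m i la \<mu>) \<nu>
        = circ ?F l (m + n - 1) i la (circ ?F m n j \<mu> \<nu>)"
      unfolding 1 2 ar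
      by (rule cls_eqI[OF opexp_eq.circ_sequential[OF s(1) t(1) u(1) a(4,5)]])
  next
    fix l m n i j :: nat and la \<mu> \<nu>
    assume a: "1 \<le> l" "1 \<le> m" "1 \<le> n" "1 \<le> i" "i < j" "j \<le> l"
      "la \<in> carrier (cpt ?F l)" "\<mu> \<in> carrier (cpt ?F m)" "\<nu> \<in> carrier (cpt ?F n)"
    obtain s where s: "opexp_of K X l s" "la = cls l s" using a by (blast elim: free_carrierE)
    obtain t where t: "opexp_of K X m t" "\<mu> = cls m t" using a by (blast elim: free_carrierE)
    obtain u where u: "opexp_of K X n u" "\<nu> = cls n u" using a by (blast elim: free_carrierE)
    have ar: "l + m - 1 + n - 1 = l + m + n - 2" "l + n - 1 + m - 1 = l + m + n - 2"
      using a(1-3) by auto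
    have ij: "j - 1 + m \<in> {1..l + m - 1}" "i \<in> {1..l}" "j \<in> {1..l}" "i \<in> {1..l + n - 1}"
      using a by auto
    have 1: "circ ?F (l + m - 1) n (j - 1 + m) (circ ?F l m i la \<mu>) \<nu>
        = cls (l + m - 1 + n - 1) (Circ (j - 1 + m) (Circ i s t) u)"
      unfolding s(2) t(2) u(2) free_circ_cls[OF s(1) t(1) ij(2)]
      by (rule free_circ_cls[OF opexp_of.Circ[OF s(1) t(1) ij(2)] u(1) ij(1)])
    have 2: "circ ?F (l + n - 1) m i (circ ?F l n j la \<nu>) \<mu>
        = cls (l + n - 1 + m - 1) (Circ i (Circ j s u) t)"
      unfolding s(2) t(2) u(2) free_circ_cls[OF s(1) u(1) ij(3)]
      by (rule free_circ_cls[OF opexp_of.Circ[OF s(1) u(1) ij(3)] t(1) ij(4)])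
    show "circ ?F (l + m - 1) n (j - 1 + m) (circ ?F l m i la \<mu>) \<nu>
        = circ ?F (l + n - 1) m i (circ ?F l n j la \<nu>) \<mu>"
      unfolding 1 2 ar
      by (rule cls_eqI[OF opexp_eq.circ_parallel[OF s(1) t(1) u(1) a(4-6)]])
  next
    fix m n i :: nat and \<sigma> \<tau> \<mu> \<nu>
    assume a: "1 \<le> m" "1 \<le> n" "i \<in> {1..m}" "\<sigma> permutes {1..m}" "\<tau> permutes {1..n}"
      "\<mu> \<in> carrier (cpt ?F m)" "\<nu> \<in> carrier (cpt ?F n)"
    obtain t where t: "opexp_of K X m t" "\<mu> = cls m t" using a by (blast elim: free_carrierE)
    obtain u where u: "opexp_of K X n u" "\<nu> = cls n u" using a by (blast elim: free_carrierE)
    have p: "perm_circ m n i \<sigma> \<tau> permutes {1..m + n - 1}"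
      using a by (intro perm_circ_permutes) auto
    have si: "\<sigma> i \<in> {1..m}" using permutes_in_image[OF a(4)] a(3) by simp
    show "circ ?F m n (\<sigma> i) (sact ?F m \<sigma> \<mu>) (sact ?F n \<tau> \<nu>)
      = sact ?F (m + n - 1) (perm_circ m n i \<sigma> \<tau>) (circ ?F m n i \<mu> \<nu>)"
      unfolding t(2) u(2) free_sact_cls[OF a(4) t(1)] free_sact_cls[OF a(5) u(1)]
        free_circ_cls[OF t(1) u(1) a(3)]
        free_circ_cls[OF opexp_of.Act[OF a(4) t(1)] opexp_of.Act[OF a(5) u(1)] si]
        free_sact_cls[OF p opexp_of.Circ[OF t(1) u(1) a(3)]]
      by (rule cls_eqI[OF opexp_eq.circ_equivariant[OF t(1) u(1) a(3-5)]])
  qed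
qed

lemma s_module_hom_free_gen: "s_module_hom K X (free_operad K X) (free_gen K X)"
proof -
  have "free_gen K X n \<in> LinearCombinations.module_hom K (cpt X n) (cpt (free_operad K X) n)"
    if n: "1 \<le> n" for n
    unfolding LinearCombinations.module_hom_def free_gen_def
    using n by (auto simp: free_cls opexp_of.Gen cls_eqI[OF opexp_eq.gen_add]
        cls_eqI[OF opexp_eq.gen_smult] intro!: cls_in_carrier opexp_of.Gen)
  moreover have "free_gen K X n (sact X n \<sigma> x) = sact (free_operad K X) n \<sigma> (free_gen K X n x)"
    if "1 \<le> n" "\<sigma> permutes {1..n}" "x \<in> carrier (cpt X n)" for n \<sigma> x
    unfolding free_gen_def
    using that by (simp add: free_cls opexp_of.Gen cls_eqI[OF opexp_eq.gen_act])
  ultimately show ?thesis by (auto simp: s_module_hom_def)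
qed

lemma opexp_arity_of: "opexp_of K X n t \<Longrightarrow> opexp_arity t = n"
  by (induction rule: opexp_of.induct) auto

context
  fixes P :: "('k, 'a, 'y) opd_scheme" and f :: "nat \<Rightarrow> 'x \<Rightarrow> 'a"
  assumes P: "operad K P" and f: "s_module_hom K X P f"
begin

interpretation P: operad K P by (rule P)

lemma gen_hom: "1 \<le> n \<Longrightarrow> f n \<in> LinearCombinations.module_hom K (cpt X n) (cpt P n)"
  using f by (simp add: s_module_hom_def)

lemma opexp_eval_closed: "opexp_of K X n t \<Longrightarrow> opexp_eval P f t \<in> carrier (cpt P n)"
proof (induction rule: opexp_of.induct)
  case (Gen n x)
  then show ?case using opexp_hom_closed[OF gen_hom] by simp
next
  case Unit
  then show ?case using P.ounit_closed by simp
next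
  case (Zero n)
  interpret W: vectorspace K "cpt P n" using P.vectorspace_cpt Zero by simp
  show ?case by simp
next
  case (Add n s t)
  interpret W: vectorspace K "cpt P n" using P.vectorspace_cpt Add opexp_of_pos by blast
  show ?case using Add opexp_arity_of by simp
next
  case (Smult c n t)
  interpret W: vectorspace K "cpt P n" using P.vectorspace_cpt Smult opexp_of_pos by blast
  show ?case using Smult opexp_arity_of by simp
next
  case (Act \<sigma> n t)
  show ?case
    using opexp_hom_closed[OF P.sact_hom[OF opexp_of_pos[OF Act(2)] Act(1)] Act(3)]
    by (simp add: opexp_arity_of[OF Act(2)])
next
  case (Circ m s n t i)
  show ?case
    using opexp_hom_closed[OF P.circ_hom_left[OF opexp_of_pos[OF Circ(1)] opexp_of_pos[OF Circ(2)]
        Circ(3,5)] Circ(4)]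
    by (simp add: opexp_arity_of[OF Circ(1)] opexp_arity_of[OF Circ(2)])
qed

lemma opexp_hom_add: "\<lbrakk>g \<in> LinearCombinations.module_hom K M N; x \<in> carrier M; y \<in> carrier M\<rbrakk>
    \<Longrightarrow> g (x \<oplus>\<^bsub>M\<^esub> y) = g x \<oplus>\<^bsub>N\<^esub> g y"
  by (auto simp: LinearCombinations.module_hom_def)

lemma opexp_hom_smult: "\<lbrakk>g \<in> LinearCombinations.module_hom K M N; c \<in> carrier K; x \<in> carrier M\<rbrakk>
    \<Longrightarrow> g (c \<odot>\<^bsub>M\<^esub> x) = c \<odot>\<^bsub>N\<^esub> g x"
  by (auto simp: LinearCombinations.module_hom_def)

lemma opexp_eval_cong:
  "opexp_eq K X n s t \<Longrightarrow> opexp_eval P f s = opexp_eval P f t"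
proof (induction rule: opexp_eq.induct)
  case (cong_add n s s' t t')
  then show ?case using opexp_eq_of opexp_arity_of by (metis opexp_eval.simps(4))
next
  case (cong_smult c n t t')
  then show ?case using opexp_eq_of opexp_arity_of by (metis opexp_eval.simps(5))
next
  case (cong_act \<sigma> n t t')
  then show ?case using opexp_eq_of opexp_arity_of by (metis opexp_eval.simps(6))
next
  case (cong_circ m s s' n t t' i)
  then show ?case using opexp_eq_of opexp_arity_of by (metis opexp_eval.simps(7))
next
  case (add_assoc n s t u)
  interpret W: vectorspace K "cpt P n" using P.vectorspace_cpt add_assoc opexp_of_pos by blast
  show ?case using add_assoc
    by (simp add: opexp_arity_of opexp_eval_closed W.M.a_assoc)
next
  case (add_comm n s t)
  interpret W: vectorspace K "cpt P n" using P.vectorspace_cpt add_comm opexp_of_pos by blast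
  show ?case using add_comm
    by (simp add: opexp_arity_of opexp_eval_closed W.M.a_comm)
next
  case (add_zero n t)
  interpret W: vectorspace K "cpt P n" using P.vectorspace_cpt add_zero opexp_of_pos by blast
  show ?case using add_zero
    by (simp add: opexp_arity_of opexp_eval_closed)
next
  case (add_neg n t)
  interpret W: vectorspace K "cpt P n" using P.vectorspace_cpt add_neg opexp_of_pos by blast
  show ?case using add_neg
    by (simp add: opexp_arity_of opexp_eval_closed W.smult_l_minus W.M.l_neg)
next
  case (smult_l_distr c d n t)
  interpret W: vectorspace K "cpt P n" using P.vectorspace_cpt smult_l_distr opexp_of_pos by blast
  show ?case using smult_l_distr
    by (simp add: opexp_arity_of opexp_eval_closed W.smult_l_distr)
next
  case (smult_r_distr c n s t)
  interpret W: vectorspace K "cpt P n" using P.vectorspace_cpt smult_r_distr opexp_of_pos by blast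
  show ?case using smult_r_distr
    by (simp add: opexp_arity_of opexp_eval_closed W.smult_r_distr)
next
  case (smult_assoc c d n t)
  interpret W: vectorspace K "cpt P n" using P.vectorspace_cpt smult_assoc opexp_of_pos by blast
  show ?case using smult_assoc
    by (simp add: opexp_arity_of opexp_eval_closed W.smult_assoc1)
next
  case (smult_one n t)
  interpret W: vectorspace K "cpt P n" using P.vectorspace_cpt smult_one opexp_of_pos by blast
  show ?case using smult_one
    by (simp add: opexp_arity_of opexp_eval_closed)
next
  case (act_add \<sigma> n s t)
  then show ?case
    using opexp_hom_add[OF P.sact_hom[OF opexp_of_pos[OF act_add(2)] act_add(1)]]
    by (simp add: opexp_arity_of opexp_eval_closed)
next
  case (act_smult \<sigma> n c t)
  then show ?case
    using opexp_hom_smult[OF P.sact_hom[OF opexp_of_pos[OF act_smult(3)] act_smult(1)]]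
    by (simp add: opexp_arity_of opexp_eval_closed)
next
  case (act_id n t)
  then show ?case
    using P.sact_id[OF opexp_of_pos[OF act_id]] by (simp add: opexp_arity_of opexp_eval_closed)
next
  case (act_comp \<sigma> n \<tau> t)
  then show ?case
    using P.sact_comp[OF opexp_of_pos[OF act_comp(3)]] by (simp add: opexp_arity_of opexp_eval_closed)
next
  case (circ_add_left m s s' n t i)
  then show ?case
    using opexp_hom_add[OF P.circ_hom_left[OF opexp_of_pos[OF circ_add_left(1)] opexp_of_pos[OF circ_add_left(3)] circ_add_left(4)]]
    by (simp add: opexp_arity_of opexp_eval_closed)
next
  case (circ_smult_left c m s n t i)
  then show ?case
    using opexp_hom_smult[OF P.circ_hom_left[OF opexp_of_pos[OF circ_smult_left(2)] opexp_of_pos[OF circ_smult_left(3)] circ_smult_left(4)]]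
    by (simp add: opexp_arity_of opexp_eval_closed)
next
  case (circ_add_right m s n t t' i)
  then show ?case
    using opexp_hom_add[OF P.circ_hom_right[OF opexp_of_pos[OF circ_add_right(1)] opexp_of_pos[OF circ_add_right(2)] circ_add_right(4)]]
    by (simp add: opexp_arity_of opexp_eval_closed)
next
  case (circ_smult_right c m s n t i)
  then show ?case
    using opexp_hom_smult[OF P.circ_hom_right[OF opexp_of_pos[OF circ_smult_right(2)] opexp_of_pos[OF circ_smult_right(3)] circ_smult_right(4)]]
    by (simp add: opexp_arity_of opexp_eval_closed)
next
  case (circ_unit_left n t)
  then show ?case
    using P.circ_unit_left[OF opexp_of_pos[OF circ_unit_left]] by (simp add: opexp_arity_of opexp_eval_closed)
next
  case (circ_unit_right m s i)
  then show ?case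
    using P.circ_unit_right[OF opexp_of_pos[OF circ_unit_right(1)]] by (simp add: opexp_arity_of opexp_eval_closed)
next
  case (circ_sequential l s m t n u i j)
  then show ?case
    using P.circ_sequential[OF opexp_of_pos[OF circ_sequential(1)] opexp_of_pos[OF circ_sequential(2)] opexp_of_pos[OF circ_sequential(3)] circ_sequential(4,5)]
    by (simp add: opexp_arity_of opexp_eval_closed)
next
  case (circ_parallel l s m t n u i j)
  then show ?case
    using P.circ_parallel[OF opexp_of_pos[OF circ_parallel(1)] opexp_of_pos[OF circ_parallel(2)] opexp_of_pos[OF circ_parallel(3)] circ_parallel(4-6)]
    by (simp add: opexp_arity_of opexp_eval_closed)
next
  case (circ_equivariant m s n t i \<sigma> \<tau>)
  then show ?case
    using P.circ_equivariant[OF opexp_of_pos[OF circ_equivariant(1)] opexp_of_pos[OF circ_equivariant(2)] circ_equivariant(3-5)]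
    by (simp add: opexp_arity_of opexp_eval_closed)
next
  case (gen_add n x y)
  then show ?case using opexp_hom_add[OF gen_hom] by simp
next
  case (gen_smult n c x)
  then show ?case using opexp_hom_smult[OF gen_hom] by simp
next
  case (gen_act n \<sigma> x)
  then show ?case using f by (simp add: s_module_hom_def)
qed auto

lemma free_ext_cls:
  assumes "opexp_of K X n t"
  shows "free_ext P f n (cls n t) = opexp_eval P f t"
proof -
  have "opexp_eval P f s = opexp_eval P f t" if "s \<in> cls n t" for s
    using that opexp_eval_cong[of n t s] by (simp add: opexp_rel_def)
  then have "opexp_eval P f ` cls n t = {opexp_eval P f t}"
    using in_cls_self[OF assms] by blast
  then show ?thesis by (simp add: free_ext_def)
qed

lemma free_ext_gen:
  assumes "1 \<le> n" "x \<in> carrier (cpt X n)"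
  shows "free_ext P f n (free_gen K X n x) = f n x"
  using free_ext_cls[OF opexp_of.Gen[OF assms]] by (simp add: free_gen_def)

theorem operad_hom_free_ext: "operad_hom K (free_operad K X) P (free_ext P f)"
proof -
  let ?F = "free_operad K X" and ?g = "free_ext P f"
  have "?g n \<in> LinearCombinations.module_hom K (cpt ?F n) (cpt P n)" for n
    unfolding LinearCombinations.module_hom_def
    by (auto elim!: free_carrierE simp: free_cls free_ext_cls opexp_of.intros opexp_arity_of
        intro: opexp_eval_closed)
  moreover have "?g n (sact ?F n \<sigma> x) = sact P n \<sigma> (?g n x)"
    if "\<sigma> permutes {1..n}" "x \<in> carrier (cpt ?F n)" for n \<sigma> x
    using that
    by (auto elim!: free_carrierE simp: free_cls free_ext_cls opexp_of.intros opexp_arity_of)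
  moreover have "?g 1 (ounit ?F) = ounit P"
    unfolding free_ounit_cls free_ext_cls[OF opexp_of.Unit] by simp
  moreover have "?g (m + n - 1) (circ ?F m n i \<mu> \<nu>) = circ P m n i (?g m \<mu>) (?g n \<nu>)"
    if "i \<in> {1..m}" "\<mu> \<in> carrier (cpt ?F m)" "\<nu> \<in> carrier (cpt ?F n)" for m n i \<mu> \<nu>
    using that
    by (auto elim!: free_carrierE simp: free_circ_cls free_ext_cls opexp_of.intros opexp_arity_of
        simp del: One_nat_def)
  ultimately show ?thesis unfolding operad_hom_def s_module_hom_def by blast
qed

theorem free_operad_universal:
  assumes g: "operad_hom K (free_operad K X) P g"
    and ext: "\<And>n x. \<lbrakk>1 \<le> n; x \<in> carrier (cpt X n)\<rbrakk> \<Longrightarrow> g n (free_gen K X n x) = f n x"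
    and A: "A \<in> carrier (cpt (free_operad K X) n)"
  shows "g n A = free_ext P f n A"
proof -
  let ?F = "free_operad K X"
  have gh: "g n \<in> LinearCombinations.module_hom K (cpt ?F n) (cpt P n)" if "1 \<le> n" for n
    using g that by (simp add: operad_hom_def s_module_hom_def)
  have "g n (cls n t) = opexp_eval P f t" if "opexp_of K X n t" for t
    using that
  proof (induction rule: opexp_of.induct)
    case (Gen n x)
    then show ?case using ext by (simp add: free_gen_def)
  next
    case Unit
    then show ?case using g by (simp add: operad_hom_def free_ounit_cls)
  next
    case (Zero n)
    interpret W: mod_hom K "cpt ?F n" "cpt P n" "g n"
      using vectorspace_free_operad[OF Zero] P.vectorspace_cpt[OF Zero] gh[OF Zero]
      by (auto simp: mod_hom_def mod_hom_axioms_def vectorspace_def)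
    show ?case using W.f0_is_0 by (simp add: free_zero_cls)
  next
    case (Add n s t)
    then show ?case
      using opexp_hom_add[OF gh[OF opexp_of_pos[OF Add(1)]] cls_in_carrier[OF Add(1)] cls_in_carrier[OF Add(2)]]
      by (simp add: free_add_cls opexp_arity_of)
  next
    case (Smult c n t)
    then show ?case
      using opexp_hom_smult[OF gh[OF opexp_of_pos[OF Smult(2)]] Smult(1) cls_in_carrier[OF Smult(2)]]
      by (simp add: free_smult_cls opexp_arity_of)
  next
    case (Act \<sigma> n t)
    then have "g n (sact ?F n \<sigma> (cls n t)) = sact P n \<sigma> (g n (cls n t))"
      using g cls_in_carrier[OF Act(2)] opexp_of_pos[OF Act(2)]
      by (simp add: operad_hom_def s_module_hom_def)
    then show ?case using Act by (simp add: free_sact_cls opexp_arity_of)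
  next
    case (Circ m s n t i)
    then have "g (m + n - 1) (circ ?F m n i (cls m s) (cls n t))
        = circ P m n i (g m (cls m s)) (g n (cls n t))"
      using g cls_in_carrier[OF Circ(1)] cls_in_carrier[OF Circ(2)]
        opexp_of_pos[OF Circ(1)] opexp_of_pos[OF Circ(2)]
      by (simp add: operad_hom_def)
    then show ?case unfolding free_circ_cls[OF Circ(1-3)]
      using Circ by (simp add: opexp_arity_of)
  qed
  then show ?thesis using A by (auto elim!: free_carrierE simp: free_ext_cls)
qed

end

end


lemma s_module_restrict_smod:
  assumes Q: "s_module K Q" and Y: "sub_s_module K Q Y"
  shows "s_module K (restrict_smod Q Y)"
proof -
  interpret Q: s_module K Q by (rule Q)
  have sub: "VectorSpace.subspace K (Y n) (cpt Q n)" if "1 \<le> n" for n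
    using Y that by (simp add: sub_s_module_def)
  have sub': "Y n \<subseteq> carrier (cpt Q n)" if "1 \<le> n" for n
    using sub[OF that] submodule.subset VectorSpace.subspace.submod by blast
  show ?thesis
  proof (rule s_module.intro)
    fix n :: nat assume n: "1 \<le> n"
    interpret V: vectorspace K "cpt Q n" using Q.vectorspace_cpt n by simp
    show "vectorspace K (cpt (restrict_smod Q Y) n)"
      using V.subspace_is_vs[OF sub[OF n]] by (simp add: restrict_smod_def)
  next
    fix n :: nat and \<sigma> assume a: "1 \<le> n" "\<sigma> permutes {1..n}"
    show "sact (restrict_smod Q Y) n \<sigma> \<in> LinearCombinations.module_hom K
        (cpt (restrict_smod Q Y) n) (cpt (restrict_smod Q Y) n)"
      using Q.sact_hom[OF a] sub'[OF a(1)] Y a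
      by (auto simp: restrict_smod_def LinearCombinations.module_hom_def sub_s_module_def subset_iff)
  next
    fix n :: nat and x assume "1 \<le> n" "x \<in> carrier (cpt (restrict_smod Q Y) n)"
    then show "sact (restrict_smod Q Y) n id x = x"
      using Q.sact_id sub' by (auto simp: restrict_smod_def)
  next
    fix n :: nat and \<sigma> \<tau> x assume "1 \<le> n" "\<sigma> permutes {1..n}" "\<tau> permutes {1..n}"
      "x \<in> carrier (cpt (restrict_smod Q Y) n)"
    then show "sact (restrict_smod Q Y) n (\<sigma> \<circ> \<tau>) x
        = sact (restrict_smod Q Y) n \<sigma> (sact (restrict_smod Q Y) n \<tau> x)"
      using Q.sact_comp[of n \<sigma> \<tau> x] sub'[of n] by (auto simp: restrict_smod_def)
  qed
qed

lemma vectorspace_direct_sum_cpt: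
  assumes Q: "s_module K Q"
  shows "vectorspace K (direct_sum_cpt Q)"
proof -
  interpret Q: s_module K Q by (rule Q)
  let ?D = "direct_sum_cpt Q"
  have vs: "vectorspace K (cpt Q n)" if "n \<in> {1..}" for n using Q.vectorspace_cpt that by simp
  interpret V1: vectorspace K "cpt Q 1" by (rule vs) simp
  have md: "Module.module K (cpt Q n)" if "n \<in> {1..}" for n
    using vs[OF that] by (simp add: vectorspace_def)
  have ab: "abelian_group (cpt Q n)" if "n \<in> {1..}" for n
    using md[OF that] by (simp add: Module.module_def)
  have car: "f n \<in> carrier (cpt Q n)" if "f \<in> carrier ?D" "n \<in> {1..}" for f n
    using that by (auto simp: direct_sum_cpt_def PiE_def)
  have fin: "finite {n \<in> {1..}. f n \<noteq> \<zero>\<^bsub>cpt Q n\<^esub>}" if "f \<in> carrier ?D" for f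
    using that by (simp add: direct_sum_cpt_def)
  have DI: "f \<in> carrier ?D" if "f \<in> extensional {1..}"
    "\<And>n. n \<in> {1..} \<Longrightarrow> f n \<in> carrier (cpt Q n)"
    "finite {n \<in> {1..}. f n \<noteq> \<zero>\<^bsub>cpt Q n\<^esub>}" for f
    using that by (auto simp: direct_sum_cpt_def PiE_def)
  have eqI: "f = g" if "f \<in> extensional {1..}" "g \<in> extensional {1..}"
    "\<And>n. n \<in> {1..} \<Longrightarrow> f n = g n" for f g :: "nat \<Rightarrow> 'c"
    using that by (rule extensionalityI)
  have ex: "f \<in> extensional {1..}" if "f \<in> carrier ?D" for f
    using that by (auto simp: direct_sum_cpt_def PiE_def)
  have exa: "f \<oplus>\<^bsub>?D\<^esub> g \<in> extensional {1..}" "c \<odot>\<^bsub>?D\<^esub> f \<in> extensional {1..}"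
    "\<zero>\<^bsub>?D\<^esub> \<in> extensional {1..}" for f g c
    by (simp_all add: direct_sum_cpt_def)
  have ap: "(f \<oplus>\<^bsub>?D\<^esub> g) n = f n \<oplus>\<^bsub>cpt Q n\<^esub> g n" "(c \<odot>\<^bsub>?D\<^esub> f) n = c \<odot>\<^bsub>cpt Q n\<^esub> f n"
    "\<zero>\<^bsub>?D\<^esub> n = \<zero>\<^bsub>cpt Q n\<^esub>" if "n \<in> {1..}" for f g n c
    using that by (simp_all add: direct_sum_cpt_def)
  have c_smult: "c \<odot>\<^bsub>?D\<^esub> f \<in> carrier ?D" if f: "f \<in> carrier ?D" and c: "c \<in> carrier K" for c f
  proof (rule DI[OF exa(2)])
    fix n :: nat assume n: "n \<in> {1..}"
    interpret V: vectorspace K "cpt Q n" by (rule vs[OF n])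
    show "(c \<odot>\<^bsub>?D\<^esub> f) n \<in> carrier (cpt Q n)" unfolding ap[OF n] using car[OF f n] c by simp
  next
    have "c \<odot>\<^bsub>cpt Q n\<^esub> f n = \<zero>\<^bsub>cpt Q n\<^esub>" if "f n = \<zero>\<^bsub>cpt Q n\<^esub>" "n \<in> {1..}" for n
    proof -
      interpret V: vectorspace K "cpt Q n" by (rule vs[OF that(2)])
      show ?thesis using that c by simp
    qed
    then show "finite {n \<in> {1..}. (c \<odot>\<^bsub>?D\<^esub> f) n \<noteq> \<zero>\<^bsub>cpt Q n\<^esub>}"
      using ap by (intro finite_subset[OF _ fin[OF f]]) auto
  qed
  have DG: "abelian_group ?D"
  proof (rule abelian_groupI)
    fix f g assume f: "f \<in> carrier ?D" and g: "g \<in> carrier ?D"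
    show "f \<oplus>\<^bsub>?D\<^esub> g \<in> carrier ?D"
    proof (rule DI[OF exa(1)])
      fix n :: nat assume n: "n \<in> {1..}"
      interpret V: abelian_group "cpt Q n" by (rule ab[OF n])
      show "(f \<oplus>\<^bsub>?D\<^esub> g) n \<in> carrier (cpt Q n)" unfolding ap[OF n] using car n f g by simp
    next
      have "f n \<oplus>\<^bsub>cpt Q n\<^esub> g n = \<zero>\<^bsub>cpt Q n\<^esub>"
        if "f n = \<zero>\<^bsub>cpt Q n\<^esub>" "g n = \<zero>\<^bsub>cpt Q n\<^esub>" "n \<in> {1..}" for n
      proof -
        interpret V: abelian_group "cpt Q n" by (rule ab[OF that(3)])
        show ?thesis using that by simp
      qed
      then show "finite {n \<in> {1..}. (f \<oplus>\<^bsub>?D\<^esub> g) n \<noteq> \<zero>\<^bsub>cpt Q n\<^esub>}"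
        using ap by (intro finite_subset[OF _ finite_UnI[OF fin[OF f] fin[OF g]]]) auto
    qed
    show "f \<oplus>\<^bsub>?D\<^esub> g = g \<oplus>\<^bsub>?D\<^esub> f"
    proof (rule eqI[OF exa(1) exa(1)])
      fix n :: nat assume n: "n \<in> {1..}"
      interpret V: abelian_group "cpt Q n" by (rule ab[OF n])
      show "(f \<oplus>\<^bsub>?D\<^esub> g) n = (g \<oplus>\<^bsub>?D\<^esub> f) n"
        unfolding ap[OF n] using car n f g by (simp add: V.a_comm)
    qed
    fix h assume h: "h \<in> carrier ?D"
    show "f \<oplus>\<^bsub>?D\<^esub> g \<oplus>\<^bsub>?D\<^esub> h = f \<oplus>\<^bsub>?D\<^esub> (g \<oplus>\<^bsub>?D\<^esub> h)"
    proof (rule eqI[OF exa(1) exa(1)])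
      fix n :: nat assume n: "n \<in> {1..}"
      interpret V: abelian_group "cpt Q n" by (rule ab[OF n])
      show "(f \<oplus>\<^bsub>?D\<^esub> g \<oplus>\<^bsub>?D\<^esub> h) n = (f \<oplus>\<^bsub>?D\<^esub> (g \<oplus>\<^bsub>?D\<^esub> h)) n"
        unfolding ap[OF n] using car n f g h by (simp add: V.a_assoc)
    qed
  next
    show "\<zero>\<^bsub>?D\<^esub> \<in> carrier ?D"
    proof (rule DI[OF exa(3)])
      fix n :: nat assume n: "n \<in> {1..}"
      interpret V: abelian_group "cpt Q n" by (rule ab[OF n])
      show "\<zero>\<^bsub>?D\<^esub> n \<in> carrier (cpt Q n)" unfolding ap[OF n] by simp
    next
      have "{n \<in> {1..}. \<zero>\<^bsub>?D\<^esub> n \<noteq> \<zero>\<^bsub>cpt Q n\<^esub>} = {}" using ap(3) by auto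
      then show "finite {n \<in> {1..}. \<zero>\<^bsub>?D\<^esub> n \<noteq> \<zero>\<^bsub>cpt Q n\<^esub>}" by (simp only: finite.emptyI)
    qed
  next
    fix f assume f: "f \<in> carrier ?D"
    show "\<zero>\<^bsub>?D\<^esub> \<oplus>\<^bsub>?D\<^esub> f = f"
    proof (rule eqI[OF exa(1) ex[OF f]])
      fix n :: nat assume n: "n \<in> {1..}"
      interpret V: abelian_group "cpt Q n" by (rule ab[OF n])
      show "(\<zero>\<^bsub>?D\<^esub> \<oplus>\<^bsub>?D\<^esub> f) n = f n" unfolding ap[OF n] using car[OF f n] by simp
    qed
    have m1: "\<ominus>\<^bsub>K\<^esub> \<one>\<^bsub>K\<^esub> \<in> carrier K" by simp
    have "(\<ominus>\<^bsub>K\<^esub> \<one>\<^bsub>K\<^esub>) \<odot>\<^bsub>?D\<^esub> f \<oplus>\<^bsub>?D\<^esub> f = \<zero>\<^bsub>?D\<^esub>"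
    proof (rule eqI[OF exa(1) exa(3)])
      fix n :: nat assume n: "n \<in> {1..}"
      interpret V: vectorspace K "cpt Q n" by (rule vs[OF n])
      show "((\<ominus>\<^bsub>K\<^esub> \<one>\<^bsub>K\<^esub>) \<odot>\<^bsub>?D\<^esub> f \<oplus>\<^bsub>?D\<^esub> f) n = \<zero>\<^bsub>?D\<^esub> n"
        unfolding ap[OF n] using car[OF f n] by (simp add: V.smult_l_minus V.M.l_neg)
    qed
    then show "\<exists>g\<in>carrier ?D. g \<oplus>\<^bsub>?D\<^esub> f = \<zero>\<^bsub>?D\<^esub>"
      using c_smult[OF f m1] by blast
  qed
  have "Module.module K ?D"
  proof (rule moduleI)
    show "cring K" by (rule V1.is_cring)
    show "abelian_group ?D" by (rule DG)
  next
    fix a f assume "a \<in> carrier K" "f \<in> carrier ?D"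
    then show "a \<odot>\<^bsub>?D\<^esub> f \<in> carrier ?D" using c_smult by blast
  next
    fix a b f assume a: "a \<in> carrier K" "b \<in> carrier K" and f: "f \<in> carrier ?D"
    show "(a \<oplus>\<^bsub>K\<^esub> b) \<odot>\<^bsub>?D\<^esub> f = a \<odot>\<^bsub>?D\<^esub> f \<oplus>\<^bsub>?D\<^esub> b \<odot>\<^bsub>?D\<^esub> f"
    proof (rule eqI[OF exa(2) exa(1)])
      fix n :: nat assume n: "n \<in> {1..}"
      interpret V: vectorspace K "cpt Q n" by (rule vs[OF n])
      show "((a \<oplus>\<^bsub>K\<^esub> b) \<odot>\<^bsub>?D\<^esub> f) n = (a \<odot>\<^bsub>?D\<^esub> f \<oplus>\<^bsub>?D\<^esub> b \<odot>\<^bsub>?D\<^esub> f) n"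
        unfolding ap[OF n] using a car[OF f n] by (simp add: V.smult_l_distr)
    qed
    show "(a \<otimes>\<^bsub>K\<^esub> b) \<odot>\<^bsub>?D\<^esub> f = a \<odot>\<^bsub>?D\<^esub> (b \<odot>\<^bsub>?D\<^esub> f)"
    proof (rule eqI[OF exa(2) exa(2)])
      fix n :: nat assume n: "n \<in> {1..}"
      interpret V: vectorspace K "cpt Q n" by (rule vs[OF n])
      show "((a \<otimes>\<^bsub>K\<^esub> b) \<odot>\<^bsub>?D\<^esub> f) n = (a \<odot>\<^bsub>?D\<^esub> (b \<odot>\<^bsub>?D\<^esub> f)) n"
        unfolding ap[OF n] using a car[OF f n] by (simp add: V.smult_assoc1)
    qed
  next
    fix a f g assume a: "a \<in> carrier K" and f: "f \<in> carrier ?D" "g \<in> carrier ?D"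
    show "a \<odot>\<^bsub>?D\<^esub> (f \<oplus>\<^bsub>?D\<^esub> g) = a \<odot>\<^bsub>?D\<^esub> f \<oplus>\<^bsub>?D\<^esub> a \<odot>\<^bsub>?D\<^esub> g"
    proof (rule eqI[OF exa(2) exa(1)])
      fix n :: nat assume n: "n \<in> {1..}"
      interpret V: vectorspace K "cpt Q n" by (rule vs[OF n])
      show "(a \<odot>\<^bsub>?D\<^esub> (f \<oplus>\<^bsub>?D\<^esub> g)) n = (a \<odot>\<^bsub>?D\<^esub> f \<oplus>\<^bsub>?D\<^esub> a \<odot>\<^bsub>?D\<^esub> g) n"
        unfolding ap[OF n] using a car n f by (simp add: V.smult_r_distr)
    qed
  next
    fix f assume f: "f \<in> carrier ?D"
    show "\<one>\<^bsub>K\<^esub> \<odot>\<^bsub>?D\<^esub> f = f"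
    proof (rule eqI[OF exa(2) ex[OF f]])
      fix n :: nat assume n: "n \<in> {1..}"
      interpret V: vectorspace K "cpt Q n" by (rule vs[OF n])
      show "(\<one>\<^bsub>K\<^esub> \<odot>\<^bsub>?D\<^esub> f) n = f n" unfolding ap[OF n] using car[OF f n] by simp
    qed
  qed
  then show ?thesis by (simp add: vectorspace_def V1.field_axioms)
qed

end

theory Submission
  imports Defs
begin

text \<open>
  Let \<open>x\<close> and \<open>r\<close> be the dimensions of the generators and relations and
  \<open>G(z) = z - X(z) + R(z)\<close>, so that the hypothesis reads \<open>H = z / G \<ge> 0\<close>. In an operation of \<open>P\<close>,
  mark one input and discard every composition that is not along the path from the root to the
  marked input. This makes the combs of generators into an associative algebra, graded by the finite
  sets of labels of the remaining inputs, with generators \<open>X'\<close> and relations \<open>R'\<close>; its component of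
  degree \<open>L\<close> is a quotient of \<open>P(|L| + 1)\<close>. The usual Golod-Shafarevich argument gives
  \<open>d\<^sub>L \<ge> \<Sum> (x - r)\<^bsub>|B| + 1\<^esub> d\<^bsub>L - B\<^esub>\<close> over nonempty \<open>B \<subseteq> L\<close> for the dimensions \<open>d\<close> of these components.
  Now \<open>G' H\<^sup>2 = H - z H' = 1 - U\<close> with \<open>U \<ge> 0\<close>, so \<open>1 / G' = H\<^sup>2 / (1 - U)\<close> has nonnegative
  coefficients, and the inequality integrates to \<open>P' \<ge> 1 / G'\<close> coefficientwise. If \<open>P\<close> were finite, \<open>1 / G'\<close> would
  be a polynomial, which forces \<open>U = 0\<close> and \<open>H = 1 + h z\<close>; as \<open>X\<close> is then bounded in arity,
  the signs of the coefficients of \<open>1 / H\<close> give \<open>h = 0\<close>, hence \<open>X(z) = R(z)\<close>. But there are no relations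
  in the lowest arity of a generator.
\<close>

text \<open>Elements of the free operad are classes of expressions without normal forms, so
  independence of combs cannot be read off there. It is tested in a model: the operations of
  \<open>comb_operad\<close> turn words into words, the universal property supplies a morphism
  \<open>phi\<close> into it, and coefficients of words separate the generators. The model itself
  discards compositions off the marked path, since two proper insertions at different inputs would
  need two marked arguments. Degrees are sets rather than numbers: the symmetric groups act on X and
  R in an arbitrary way, so every set L carries its own dimension, and factorials are divided by
  only in real power series. An operation in X(n) with one marked input leaves n - 1 inputs to
  label, whence the derivative X'. The relations are controlled from outside: the operations that
  send the comb algebra into \<open>J\<close>, with only zero in arity 1, form an operadic ideal
  containing R. Quotient spaces are never formed; dimensions are compared through independent
  families and spanning lists modulo a subspace.\<close>

unbundle fps_syntax

section \<open>The numerical inequality\<close>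

lemma sum_Pow_card:
  fixes f :: "nat \<Rightarrow> real"
  assumes "finite A"
  shows "(\<Sum>B\<in>Pow A. f (card B)) = (\<Sum>s\<le>card A. real (card A choose s) * f s)"
proof -
  have "(\<Sum>B\<in>Pow A. f (card B)) = (\<Sum>s\<le>card A. \<Sum>B\<in>{B\<in>Pow A. card B = s}. f (card B))"
    using assms by (intro sum.group[symmetric]) (auto intro: card_mono)
  also have "\<dots> = (\<Sum>s\<le>card A. real (card A choose s) * f s)"
  proof (rule sum.cong[OF HOL.refl])
    fix s
    have "card {B\<in>Pow A. card B = s} = card A choose s"
      using n_subsets[OF assms, of s] by (simp add: Pow_def conj_commute)
    then show "(\<Sum>B\<in>{B\<in>Pow A. card B = s}. f (card B)) = real (card A choose s) * f s"
      by simp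
  qed
  finally show ?thesis .
qed

text \<open>With \<open>e\<close> the defect of the inequality, \<open>d\<close> is the subset convolution of \<open>c\<close> and \<open>e\<close>.\<close>

lemma subset_convolution_ge:
  fixes c y :: "nat \<Rightarrow> real" and d :: "'a set \<Rightarrow> real"
  assumes c_pos: "\<And>k. 0 \<le> c k" and c0: "c 0 = 1"
    and c_rec: "\<And>k. 1 \<le> k \<Longrightarrow> c k = (\<Sum>s=1..k. real (k choose s) * y s * c (k - s))"
    and d0: "1 \<le> d {}"
    and d_rec: "\<And>L. \<lbrakk>finite L; L \<subseteq> U; L \<noteq> {}\<rbrakk>
      \<Longrightarrow> (\<Sum>B\<in>Pow L - {{}}. y (card B) * d (L - B)) \<le> d L"
    and L: "finite L" "L \<subseteq> U"
  shows "c (card L) \<le> d L"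
proof -
  define e where "e L = d L - (\<Sum>B\<in>Pow L - {{}}. y (card B) * d (L - B))" for L
  \<comment> \<open>Grouping the subsets \<open>B\<close> of \<open>A\<close> by size turns the
    binomial recursion of \<open>c\<close> into one over sets.\<close>
  have c_set: "(\<Sum>B\<in>Pow A - {{}}. y (card B) * c (card (A - B))) = c (card A)"
    if A: "finite A" "A \<noteq> {}" for A :: "'a set"
  proof -
    define g where "g s = (if s = 0 then 0 else y s * c (card A - s))" for s
    have fin: "finite B" if "B \<subseteq> A" for B using that A finite_subset by blast
    have "(\<Sum>B\<in>Pow A - {{}}. y (card B) * c (card (A - B))) = (\<Sum>B\<in>Pow A - {{}}. g (card B))"
      using fin by (intro sum.cong HOL.refl) (auto simp: g_def card_Diff_subset)
    also have "\<dots> = (\<Sum>B\<in>Pow A. g (card B))"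
      using A by (intro sum.mono_neutral_left) (auto simp: g_def)
    also have "\<dots> = (\<Sum>s\<le>card A. real (card A choose s) * g s)"
      by (rule sum_Pow_card[OF A(1)])
    also have "\<dots> = (\<Sum>s=1..card A. real (card A choose s) * g s)"
      by (rule sum.mono_neutral_right) (auto simp: g_def)
    also have "\<dots> = (\<Sum>s=1..card A. real (card A choose s) * y s * c (card A - s))"
      by (intro sum.cong HOL.refl) (auto simp: g_def)
    also have "\<dots> = c (card A)"
    proof (rule c_rec[symmetric])
      show "1 \<le> card A" using A by (simp add: Suc_le_eq card_gt_0_iff)
    qed
    finally show ?thesis .
  qed
  have d_eq: "d L = (\<Sum>A\<in>Pow L. c (card (L - A)) * e A)" if "finite L" for L
    using that
  proof (induction L rule: finite_psubset_induct)
    case (psubset L)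
    have IH: "d (L - B) = (\<Sum>A\<in>Pow (L - B). c (card (L - B - A)) * e A)"
      if "B \<in> Pow L - {{}}" for B
      using that by (intro psubset) auto
    have "(\<Sum>B\<in>Pow L - {{}}. y (card B) * d (L - B))
        = (\<Sum>B\<in>Pow L - {{}}. \<Sum>A\<in>Pow (L - B). y (card B) * (c (card (L - B - A)) * e A))"
      using IH by (simp add: sum_distrib_left)
    also have "\<dots> = (\<Sum>A\<in>Pow L - {L}. \<Sum>B\<in>Pow (L - A) - {{}}.
        y (card B) * (c (card (L - B - A)) * e A))"
    proof -
      \<comment> \<open>Both orders of summation run over the disjoint pairs of a nonempty
        \<open>B\<close> and some \<open>A\<close> in \<open>L\<close>; disjointness from a nonempty
        \<open>B\<close> excludes \<open>A = L\<close>.\<close>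
      have 1: "Pow (L - B) = {A. A \<in> Pow L - {L} \<and> B \<inter> A = {}}" if "B \<in> Pow L - {{}}" for B
        using that by auto
      have 2: "Pow (L - A) - {{}} = {B. B \<in> Pow L - {{}} \<and> B \<inter> A = {}}" if "A \<in> Pow L - {L}" for A
        by auto
      have "finite (Pow L - {{}})" "finite (Pow L - {L})" using psubset(1) by auto
      note swap = sum.swap_restrict[OF this, of "\<lambda>B A. y (card B) * (c (card (L - B - A)) * e A)"
          "\<lambda>B A. B \<inter> A = {}"]
      show ?thesis
        by (rule HOL.trans[OF sum.cong[OF HOL.refl] HOL.trans[OF swap sum.cong[OF HOL.refl]]];
            rule sum.cong[OF _ HOL.refl]; use 1 2 in blast)
    qed
    also have "\<dots> = (\<Sum>A\<in>Pow L - {L}. c (card (L - A)) * e A)"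
    proof (rule sum.cong[OF HOL.refl])
      fix A assume "A \<in> Pow L - {L}"
      then have A: "finite (L - A)" "L - A \<noteq> {}" using psubset(1) by auto
      have "L - B - A = L - A - B" for B by auto
      then have "(\<Sum>B\<in>Pow (L - A) - {{}}. y (card B) * (c (card (L - B - A)) * e A))
          = (\<Sum>B\<in>Pow (L - A) - {{}}. y (card B) * c (card (L - A - B))) * e A"
        by (simp add: sum_distrib_right mult.assoc)
      then show "(\<Sum>B\<in>Pow (L - A) - {{}}. y (card B) * (c (card (L - B - A)) * e A))
          = c (card (L - A)) * e A"
        using c_set[OF A] by simp
    qed
    finally have "d L = e L + (\<Sum>A\<in>Pow L - {L}. c (card (L - A)) * e A)"
      by (simp add: e_def)
    also have "\<dots> = (\<Sum>A\<in>Pow L. c (card (L - A)) * e A)"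
      using psubset(1) c0 by (subst sum.remove[of "Pow L" L]) auto
    finally show ?case .
  qed
  have e_pos: "0 \<le> e A" if "A \<in> Pow L" for A
  proof (cases "A = {}")
    case True then show ?thesis using d0 by (simp add: e_def)
  next
    case False
    then show ?thesis using d_rec[of A] that L finite_subset[of A L] by (auto simp: e_def)
  qed
  \<comment> \<open>Only the term of the empty set is kept; the others are nonnegative, and
    \<open>e {} = d {}\<close> is at least 1.\<close>
  have "c (card L) \<le> c (card (L - {})) * e {}"
    using mult_left_mono[OF d0 c_pos, of "card L"] by (simp add: e_def)
  also have "\<dots> \<le> (\<Sum>A\<in>Pow L. c (card (L - A)) * e A)"
    by (rule member_le_sum[of "{}" "Pow L" "\<lambda>A. c (card (L - A)) * e A"]) (use L e_pos c_pos in auto)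
  finally show ?thesis using d_eq[OF L(1)] by simp
qed

text \<open>For \<open>q = 1 / H\<close> this is the quotient rule for \<open>z / H\<close>, cleared
  of denominators.\<close>

lemma fps_deriv_X_inverse:
  fixes H q :: "real fps"
  assumes "q * H = 1"
  shows "fps_deriv (fps_X * q) * H ^ 2 = H - fps_X * fps_deriv H"
proof -
  have "fps_deriv (q * H) = 0" using assms by simp
  then have *: "fps_deriv q * H = - (q * fps_deriv H)"
    unfolding fps_deriv_mult eq_neg_iff_add_eq_0 by (simp only: add.commute)
  have "fps_deriv (fps_X * q) * H ^ 2 = H * (q * H) + fps_X * H * (fps_deriv q * H)"
    by (simp add: fps_deriv_mult algebra_simps power2_eq_square)
  also have "\<dots> = H - fps_X * (q * H) * fps_deriv H"
    unfolding * using assms by (simp add: algebra_simps)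
  finally show ?thesis using assms by simp
qed

text \<open>\<open>C\<close> is \<open>W / (1 - U)\<close>, a geometric series. As \<open>U\<close>
  has no constant term, coefficient \<open>k\<close> of \<open>U * C\<close> involves only earlier
  coefficients of \<open>C\<close>.\<close>

lemma fps_geometric_nonneg:
  fixes C U W :: "real fps"
  assumes CU: "C = W + U * C" and U: "\<And>k. 0 \<le> U $ k" "U $ 0 = 0" and W: "\<And>k. 0 \<le> W $ k"
  shows "0 \<le> C $ k"
proof (induction k rule: less_induct)
  case (less k)
  have "C $ k = (W + U * C) $ k" using CU by (rule arg_cong)
  moreover have "0 \<le> U $ i * C $ (k - i)" if "i \<in> {0..k}" for i
    using less U that by (cases "i = 0") auto
  ultimately show ?case using W[of k] by (auto simp: fps_mult_nth intro!: add_nonneg_nonneg sum_nonneg)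
qed

text \<open>Being nonnegative and not positive from \<open>N\<close> on, \<open>C\<close> is a
  polynomial, of degree \<open>D\<close> say. A nonzero \<open>U $ k\<close>, where necessarily
  \<open>k > 0\<close>, would make coefficient \<open>k + D\<close> of \<open>C\<close> at least
  \<open>U $ k * C $ D > 0\<close>, beyond the degree.\<close>

lemma fps_geometric_vanishing:
  fixes C U W :: "real fps"
  assumes CU: "C = W + U * C" and U: "\<And>k. 0 \<le> U $ k" "U $ 0 = 0" and W: "\<And>k. 0 \<le> W $ k"
    and C0: "C $ 0 \<noteq> 0" and N: "\<And>k. N \<le> k \<Longrightarrow> C $ k \<le> 0"
  shows "U $ k = 0"
proof (rule ccontr)
  assume nz: "U $ k \<noteq> 0"
  have Cn: "0 \<le> C $ j" for j by (rule fps_geometric_nonneg[OF CU U W])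
  define D where "D = Max {n. C $ n \<noteq> 0}"
  have "{n. C $ n \<noteq> 0} \<subseteq> {..N}"
  proof
    fix n assume "n \<in> {n. C $ n \<noteq> 0}"
    then have "C $ n \<noteq> 0" by simp
    then have "\<not> N \<le> n" using N[of n] Cn[of n] by linarith
    then show "n \<in> {..N}" by simp
  qed
  then have fin: "finite {n. C $ n \<noteq> 0}" by (rule finite_subset) simp
  have "D \<in> {n. C $ n \<noteq> 0}" unfolding D_def by (rule Max_in[OF fin]) (use C0 in blast)
  then have "0 < C $ D" using Cn[of D] by (simp add: less_le)
  moreover have "0 < U $ k" using nz U(1)[of k] by linarith
  ultimately have "0 < U $ k * C $ (k + D - k)" by simp
  also have "\<dots> \<le> (\<Sum>i=0..k + D. U $ i * C $ (k + D - i))"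
    by (rule member_le_sum[of k _ "\<lambda>i. U $ i * C $ (k + D - i)"]) (use U Cn in auto)
  also have "\<dots> \<le> (W + U * C) $ (k + D)" using W[of "k + D"] by (simp add: fps_mult_nth)
  also have "\<dots> = C $ (k + D)" using CU by (rule arg_cong[OF HOL.sym])
  finally have "k + D \<in> {n. C $ n \<noteq> 0}" by simp
  then have "k + D \<le> D" unfolding D_def by (rule Max_ge[OF fin])
  then show False using nz U(2) by simp
qed

lemma
  fixes q :: "real fps"
  assumes q0: "q $ 0 = 1" and H: "\<And>k. 0 \<le> inverse q $ k"
  shows fps_inverse_deriv_X_nonneg: "0 \<le> inverse (fps_deriv (fps_X * q)) $ k"
    and fps_inverse_deriv_X_vanishing:
      "(\<And>k. N \<le> k \<Longrightarrow> inverse (fps_deriv (fps_X * q)) $ k \<le> 0) \<Longrightarrow> 2 \<le> k \<Longrightarrow> inverse q $ k = 0"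
proof -
  define H where "H = inverse q"
  define G where "G = fps_deriv (fps_X * q)"
  define C where "C = inverse G"
  define U where "U = 1 - H + fps_X * fps_deriv H"
  have qH: "q * H = 1" using q0 by (simp add: H_def inverse_mult_eq_1')
  have H0: "H $ 0 = 1" using q0 by (simp add: H_def)
  have G0: "G $ 0 = 1" using q0 by (simp add: G_def)
  have C0: "C $ 0 \<noteq> 0" using G0 by (simp add: C_def)
  have "C * (1 - U) = C * (G * H ^ 2)"
    unfolding G_def fps_deriv_X_inverse[OF qH] U_def by simp
  also have "\<dots> = H ^ 2" using G0 by (simp add: C_def inverse_mult_eq_1 mult.assoc[symmetric])
  finally have CU: "C = H ^ 2 + U * C" by (simp add: algebra_simps)
  have Hn: "0 \<le> H $ k" for k using H by (simp add: H_def)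
  \<comment> \<open>The constant term cancels since \<open>H $ 0 = 1\<close>, and the factor
    \<open>k - 1\<close> is nonnegative from \<open>k = 1\<close> on. It vanishes at
    \<open>k = 1\<close>, so \<open>U = 0\<close> leaves \<open>H $ 1\<close> free.\<close>
  have U_nth: "U $ k = (if k = 0 then 0 else (real k - 1) * H $ k)" for k
    using H0 by (cases k) (auto simp: U_def algebra_simps)
  then have U: "0 \<le> U $ k" "U $ 0 = 0" for k using Hn by (cases k, auto)
  have H2: "0 \<le> (H ^ 2) $ k" for k
    using Hn by (simp add: power2_eq_square fps_mult_nth sum_nonneg)
  show "0 \<le> inverse (fps_deriv (fps_X * q)) $ k"
    using fps_geometric_nonneg[OF CU U H2] by (simp add: C_def G_def)
  show "inverse q $ k = 0"
    if "\<And>k. N \<le> k \<Longrightarrow> inverse (fps_deriv (fps_X * q)) $ k \<le> 0" "2 \<le> k"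
    using fps_geometric_vanishing[OF CU U H2 C0, of N k] that by (simp add: U_nth H_def C_def G_def)
qed

text \<open>With \<open>1 / q = 1 + h z\<close>, the series \<open>q\<close> is geometric with ratio
  \<open>- h z\<close>.\<close>

lemma fps_linear_inverse_nth:
  fixes q :: "real fps"
  assumes "q $ 0 = 1" "\<And>k. 2 \<le> k \<Longrightarrow> inverse q $ k = 0"
  shows "q $ k = (- (inverse q $ 1)) ^ k"
proof (induction k)
  case (Suc k)
  have H: "inverse q = 1 + fps_const (inverse q $ 1) * fps_X"
  proof (rule fps_ext)
    fix n :: nat
    consider "n = 0" | "n = 1" | "2 \<le> n" by linarith
    then show "inverse q $ n = (1 + fps_const (inverse q $ 1) * fps_X) $ n"
      using assms by cases auto
  qed
  have "inverse q * q = 1" using assms(1) by (simp add: inverse_mult_eq_1)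
  then have "q + fps_X * (fps_const (inverse q $ 1) * q) = 1"
    by (subst (asm) H) (simp add: algebra_simps)
  then have "(q + fps_X * (fps_const (inverse q $ 1) * q)) $ Suc k = 0" by simp
  then show ?case using Suc by simp
qed (use assms in simp)

text \<open>The operad enters only through dimensions: \<open>q\<close> is \<open>G / z\<close>, and
  \<open>N\<close> bounds both the arities of the generators and the degrees in which the comb
  algebra survives.\<close>

lemma golod_shafarevich_numeric:
  fixes q :: "real fps" and x r :: "nat \<Rightarrow> nat" and d :: "nat set \<Rightarrow> nat"
  assumes q: "\<And>k. q $ k = (if k = 0 then 1 else (real (r (k + 1)) - real (x (k + 1))) / fact (k + 1))"
    and H: "\<And>k. 0 \<le> inverse q $ k"
    and d0: "1 \<le> d {}"
    and d_rec: "\<And>L. \<lbrakk>finite L; 0 \<notin> L; L \<noteq> {}\<rbrakk> \<Longrightarrow> (\<Sum>B\<in>Pow L - {{}}. x (card B + 1) * d (L - B))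
       \<le> d L + (\<Sum>B\<in>Pow L - {{}}. r (card B + 1) * d (L - B))"
    and d_zero: "\<And>L. \<lbrakk>finite L; 0 \<notin> L; N \<le> card L\<rbrakk> \<Longrightarrow> d L = 0"
    and x_zero: "\<And>n. N \<le> n \<Longrightarrow> x n = 0"
    and k: "2 \<le> n"
  shows "x n = r n"
proof -
  define G where "G = fps_deriv (fps_X * q)"
  define C where "C = inverse G"
  define c where "c k = fact k * C $ k" for k
  define y where "y s = real (x (s + 1)) - real (r (s + 1))" for s
  have q0: "q $ 0 = 1" by (simp add: q)
  \<comment> \<open>The factor \<open>s + 1\<close> from differentiation turns
    \<open>fact (s + 1)\<close> into \<open>fact s\<close>, so that \<open>G\<close> is the
    exponential generating function of \<open>- y\<close>, apart from the constant term 1.\<close>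
  have G_nth: "G $ s = (if s = 0 then 1 else - y s / fact s)" for s
  proof (cases s)
    case (Suc t)
    have "G $ s = real (s + 1) * q $ s" using Suc by (simp add: G_def algebra_simps)
    also have "\<dots> = real (s + 1) * ((real (r (s + 1)) - real (x (s + 1))) / (real (s + 1) * fact s))"
      using q[of s] Suc by simp
    also have "\<dots> = - y s / fact s" by (simp add: y_def del: of_nat_add of_nat_Suc)
    finally show ?thesis using Suc by simp
  qed (simp add: G_def q0)
  have C_nn: "0 \<le> C $ k" for k
    using fps_inverse_deriv_X_nonneg[OF q0 H] by (simp add: C_def G_def)
  \<comment> \<open>This is coefficient \<open>k\<close> of \<open>G * C = 1\<close>, multiplied by
    \<open>fact k\<close>.\<close>
  have c_rec: "c k = (\<Sum>s=1..k. real (k choose s) * y s * c (k - s))" if "1 \<le> k" for k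
  proof -
    have "(G * C) $ k = 0" using that G_nth[of 0] by (simp add: C_def inverse_mult_eq_1')
    then have "0 = (\<Sum>s=0..k. G $ s * C $ (k - s))" by (simp add: fps_mult_nth)
    also have "\<dots> = C $ k + (\<Sum>s=1..k. G $ s * C $ (k - s))"
      using G_nth by (subst sum.atLeast_Suc_atMost) auto
    also have "(\<Sum>s=1..k. G $ s * C $ (k - s)) = - (\<Sum>s=1..k. y s / fact s * C $ (k - s))"
      using G_nth by (auto simp: sum_negf[symmetric] intro!: sum.cong)
    finally have "c k = (\<Sum>s=1..k. fact k * (y s / fact s * C $ (k - s)))"
      by (simp add: c_def sum_distrib_left)
    also have "\<dots> = (\<Sum>s=1..k. real (k choose s) * y s * c (k - s))"
      by (intro sum.cong HOL.refl) (simp add: c_def binomial_fact field_simps)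
    finally show ?thesis .
  qed
  have C0: "C $ 0 = 1" using G_nth[of 0] by (simp add: C_def)
  have c_le: "c (card L) \<le> real (d L)" if "finite L" "0 \<notin> L" for L
  proof (rule subset_convolution_ge[where y = y and U = "{0<..}"])
    fix L :: "nat set" assume L: "finite L" "L \<subseteq> {0<..}" "L \<noteq> {}"
    then have "real (\<Sum>B\<in>Pow L - {{}}. x (card B + 1) * d (L - B))
       \<le> real (d L + (\<Sum>B\<in>Pow L - {{}}. r (card B + 1) * d (L - B)))"
      using d_rec[of L] by (subst of_nat_le_iff) auto
    then show "(\<Sum>B\<in>Pow L - {{}}. y (card B) * real (d (L - B))) \<le> real (d L)"
      by (simp add: y_def left_diff_distrib sum_subtractf)
  qed (use that C_nn C0 c_rec d0 in \<open>auto simp: c_def intro!: Nat.gr0I\<close>)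
  have "C $ k \<le> 0" if "N \<le> k" for k
  proof -
    have "c (card {1..k}) \<le> real (d {1..k})" by (rule c_le) auto
    also have "\<dots> = 0" using that by (subst d_zero) auto
    finally have "fact k * C $ k \<le> 0" by (simp add: c_def)
    then show ?thesis using fact_gt_zero[of k, where 'a = real] by (simp add: mult_le_0_iff not_le[symmetric] del: fact_gt_zero)
  qed
  then have "inverse q $ k = 0" if "2 \<le> k" for k
    using fps_inverse_deriv_X_vanishing[OF q0 H _ that] by (auto simp: C_def G_def)
  then have q_nth: "q $ k = (- (inverse q $ 1)) ^ k" for k
    by (rule fps_linear_inverse_nth[OF q0])
  \<comment> \<open>The index is odd and lies beyond the support of \<open>x\<close>. So the
    coefficient is nonnegative, while it equals minus an odd power of \<open>inverse q $ 1\<close>,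
    which is itself nonnegative by \<open>H\<close>.\<close>
  have "0 \<le> q $ (2 * N + 1)" using q x_zero by simp
  then have h: "(inverse q $ 1) ^ (2 * N + 1) \<le> 0" unfolding q_nth by simp
  have "inverse q $ 1 = 0"
  proof (rule ccontr)
    assume "inverse q $ 1 \<noteq> 0"
    then have "0 < inverse q $ 1" using H[of 1] by linarith
    then have "0 < (inverse q $ 1) ^ (2 * N + 1)" by (rule zero_less_power)
    then show False using h by linarith
  qed
  then have "q $ (n - 1) = 0" using q_nth[of "n - 1"] k by simp
  then show ?thesis using q[of "n - 1"] k by (simp split: if_splits)
qed

section \<open>Linear algebra modulo a subspace\<close>

context vectorspace
begin

lemma subspaceI:
  assumes "A \<subseteq> carrier V" "\<zero>\<^bsub>V\<^esub> \<in> A"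
    "\<And>v w. \<lbrakk>v \<in> A; w \<in> A\<rbrakk> \<Longrightarrow> v \<oplus>\<^bsub>V\<^esub> w \<in> A"
    "\<And>c v. \<lbrakk>c \<in> carrier K; v \<in> A\<rbrakk> \<Longrightarrow> c \<odot>\<^bsub>V\<^esub> v \<in> A"
  shows "VectorSpace.subspace K A V"
  using assms vectorspace_axioms
  by (auto simp: VectorSpace.subspace_def submodule_def vectorspace_def)

lemma
  assumes "VectorSpace.subspace K A V"
  shows subspace_carrier: "A \<subseteq> carrier V"
    and subspace_zero: "\<zero>\<^bsub>V\<^esub> \<in> A"
    and subspace_add: "\<lbrakk>v \<in> A; w \<in> A\<rbrakk> \<Longrightarrow> v \<oplus>\<^bsub>V\<^esub> w \<in> A"
    and subspace_smult: "\<lbrakk>c \<in> carrier K; v \<in> A\<rbrakk> \<Longrightarrow> c \<odot>\<^bsub>V\<^esub> v \<in> A"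
  using assms by (auto simp: VectorSpace.subspace_def submodule_def)

lemma smult_minus_one: "v \<in> carrier V \<Longrightarrow> (\<ominus>\<^bsub>K\<^esub> \<one>\<^bsub>K\<^esub>) \<odot>\<^bsub>V\<^esub> v = \<ominus>\<^bsub>V\<^esub> v"
  by (simp add: smult_l_minus)

lemma subspace_minus:
  assumes "VectorSpace.subspace K A V" "v \<in> A" "w \<in> A"
  shows "v \<ominus>\<^bsub>V\<^esub> w \<in> A"
proof -
  have "w \<in> carrier V" using assms subspace_carrier by blast
  then have "v \<ominus>\<^bsub>V\<^esub> w = v \<oplus>\<^bsub>V\<^esub> (\<ominus>\<^bsub>K\<^esub> \<one>\<^bsub>K\<^esub>) \<odot>\<^bsub>V\<^esub> w" by (simp add: smult_minus_one a_minus_def)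
  moreover have "\<ominus>\<^bsub>K\<^esub> \<one>\<^bsub>K\<^esub> \<in> carrier K" by simp
  ultimately show ?thesis using subspace_add subspace_smult assms by metis
qed

lemma subspace_finsum:
  assumes A: "VectorSpace.subspace K A V" and "finite I" "\<And>i. i \<in> I \<Longrightarrow> f i \<in> A"
  shows "finsum V f I \<in> A"
  using assms(2,3)
proof (induction I rule: finite_induct)
  case empty
  then show ?case using subspace_zero[OF A] by simp
next
  case (insert i I)
  then have "f i \<in> A" "f i \<in> carrier V" "f \<in> I \<rightarrow> carrier V" using subspace_carrier[OF A] by auto
  then show ?case using insert subspace_add[OF A] by simp
qed

text \<open>A list rather than a set of vectors, since \<open>length ts\<close> serves as the upper
  bound for the dimension modulo \<open>N\<close>, and the recursion on the list drives the
  elimination in \<open>relation_mod_exists\<close>.\<close>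

fun span_mod :: "'c set \<Rightarrow> 'c list \<Rightarrow> 'c set" where
  "span_mod N [] = N"
| "span_mod N (t # ts) = {w \<oplus>\<^bsub>V\<^esub> a \<odot>\<^bsub>V\<^esub> t | w a. w \<in> span_mod N ts \<and> a \<in> carrier K}"

lemma span_mod_ConsI:
  "\<lbrakk>v = w \<oplus>\<^bsub>V\<^esub> a \<odot>\<^bsub>V\<^esub> t; w \<in> span_mod N ts; a \<in> carrier K\<rbrakk> \<Longrightarrow> v \<in> span_mod N (t # ts)"
  by auto

lemma span_mod_subspace:
  assumes N: "VectorSpace.subspace K N V" and "set ts \<subseteq> carrier V"
  shows "VectorSpace.subspace K (span_mod N ts) V"
  using assms(2)
proof (induction ts)
  case (Cons t ts)
  then have S: "VectorSpace.subspace K (span_mod N ts) V" and t: "t \<in> carrier V" by auto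
  note c = subsetD[OF subspace_carrier[OF S]]
  show ?case
  proof (rule subspaceI)
    show "span_mod N (t # ts) \<subseteq> carrier V" using c t by auto
  next
    have "\<zero>\<^bsub>V\<^esub> = \<zero>\<^bsub>V\<^esub> \<oplus>\<^bsub>V\<^esub> \<zero>\<^bsub>K\<^esub> \<odot>\<^bsub>V\<^esub> t" using t by simp
    then show "\<zero>\<^bsub>V\<^esub> \<in> span_mod N (t # ts)"
      by (rule span_mod_ConsI) (use subspace_zero[OF S] in simp_all)
  next
    fix v w assume "v \<in> span_mod N (t # ts)" "w \<in> span_mod N (t # ts)"
    then obtain v' w' a b where v: "v = v' \<oplus>\<^bsub>V\<^esub> a \<odot>\<^bsub>V\<^esub> t" "w = w' \<oplus>\<^bsub>V\<^esub> b \<odot>\<^bsub>V\<^esub> t"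
      and m: "v' \<in> span_mod N ts" "w' \<in> span_mod N ts" "a \<in> carrier K" "b \<in> carrier K"
      by auto
    have "v \<oplus>\<^bsub>V\<^esub> w = (v' \<oplus>\<^bsub>V\<^esub> w') \<oplus>\<^bsub>V\<^esub> (a \<oplus>\<^bsub>K\<^esub> b) \<odot>\<^bsub>V\<^esub> t"
      using m c t by (simp add: v smult_l_distr M.a_ac)
    then show "v \<oplus>\<^bsub>V\<^esub> w \<in> span_mod N (t # ts)"
      by (rule span_mod_ConsI) (use m subspace_add[OF S] in simp_all)
  next
    fix k v assume k: "k \<in> carrier K" and "v \<in> span_mod N (t # ts)"
    then obtain v' a where v: "v = v' \<oplus>\<^bsub>V\<^esub> a \<odot>\<^bsub>V\<^esub> t" and m: "v' \<in> span_mod N ts" "a \<in> carrier K"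
      by auto
    have "k \<odot>\<^bsub>V\<^esub> v = k \<odot>\<^bsub>V\<^esub> v' \<oplus>\<^bsub>V\<^esub> (k \<otimes>\<^bsub>K\<^esub> a) \<odot>\<^bsub>V\<^esub> t"
      using m c t k by (simp add: v smult_r_distr smult_assoc1)
    then show "k \<odot>\<^bsub>V\<^esub> v \<in> span_mod N (t # ts)"
      by (rule span_mod_ConsI) (use m k subspace_smult[OF S] in simp_all)
  qed
qed (use N in simp)

lemma span_mod_base:
  assumes N: "VectorSpace.subspace K N V" and "set ts \<subseteq> carrier V"
  shows "N \<subseteq> span_mod N ts"
  using assms(2)
proof (induction ts)
  case (Cons t ts)
  show ?case
  proof
    fix v assume v: "v \<in> N"
    then have "v = v \<oplus>\<^bsub>V\<^esub> \<zero>\<^bsub>K\<^esub> \<odot>\<^bsub>V\<^esub> t" using Cons subspace_carrier[OF N] by auto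
    then show "v \<in> span_mod N (t # ts)" by (rule span_mod_ConsI) (use v Cons in auto)
  qed
qed simp

lemma span_mod_gen:
  assumes N: "VectorSpace.subspace K N V" and "set ts \<subseteq> carrier V"
  shows "set ts \<subseteq> span_mod N ts"
  using assms(2)
proof (induction ts)
  case (Cons t ts)
  have S: "VectorSpace.subspace K (span_mod N ts) V" using span_mod_subspace[OF N] Cons by simp
  have "v \<in> span_mod N (t # ts)" if v: "v \<in> set ts" for v
  proof -
    have "v = v \<oplus>\<^bsub>V\<^esub> \<zero>\<^bsub>K\<^esub> \<odot>\<^bsub>V\<^esub> t" using Cons v by auto
    then show ?thesis by (rule span_mod_ConsI) (use v Cons in auto)
  qed
  moreover have "t = \<zero>\<^bsub>V\<^esub> \<oplus>\<^bsub>V\<^esub> \<one>\<^bsub>K\<^esub> \<odot>\<^bsub>V\<^esub> t" using Cons by simp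
  then have "t \<in> span_mod N (t # ts)" by (rule span_mod_ConsI) (use subspace_zero[OF S] in simp_all)
  ultimately show ?case by auto
qed simp

lemma span_mod_least:
  assumes S: "VectorSpace.subspace K S V" and "N \<subseteq> S" "set ts \<subseteq> S"
  shows "span_mod N ts \<subseteq> S"
  using assms(3)
proof (induction ts)
  case (Cons t ts)
  then show ?case using subspace_add[OF S] subspace_smult[OF S] by auto
qed (use assms in simp)

lemma finsum_smult_distr_vec:
  assumes "finite I" "a \<in> I \<rightarrow> carrier K" "v \<in> carrier V"
  shows "finsum V (\<lambda>i. a i \<odot>\<^bsub>V\<^esub> v) I = finsum K a I \<odot>\<^bsub>V\<^esub> v"
  using assms
proof (induction I rule: finite_induct)
  case (insert i I)
  then have "a \<in> I \<rightarrow> carrier K" "a i \<in> carrier K" by auto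
  moreover then have "(\<lambda>i. a i \<odot>\<^bsub>V\<^esub> v) \<in> I \<rightarrow> carrier V" using insert by auto
  ultimately show ?case using insert by (simp add: smult_l_distr)
qed simp

text \<open>One step of Gaussian elimination removes \<open>t\<close>.\<close>

lemma relation_mod_exists:
  assumes N: "VectorSpace.subspace K N V" and "set ts \<subseteq> carrier V" "finite I" "length ts < card I"
    "\<And>i. i \<in> I \<Longrightarrow> u i \<in> span_mod N ts"
  shows "\<exists>c. c \<in> I \<rightarrow> carrier K \<and> (\<exists>i\<in>I. c i \<noteq> \<zero>\<^bsub>K\<^esub>) \<and> finsum V (\<lambda>i. c i \<odot>\<^bsub>V\<^esub> u i) I \<in> N"
  using assms(2-)
proof (induction ts arbitrary: I u)
  case Nil
  \<comment> \<open>With no vectors on the list, every \<open>u i\<close> lies in \<open>N\<close>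
    already, so the coefficients can all be 1.\<close>
  have "finsum V (\<lambda>i. \<one>\<^bsub>K\<^esub> \<odot>\<^bsub>V\<^esub> u i) I \<in> N"
    using Nil subspace_smult[OF N] by (intro subspace_finsum[OF N]) auto
  moreover have "I \<noteq> {}" using Nil by auto
  ultimately show ?case by (intro exI[of _ "\<lambda>_. \<one>\<^bsub>K\<^esub>"]) auto
next
  case (Cons t ts)
  have S: "VectorSpace.subspace K (span_mod N ts) V" using span_mod_subspace[OF N] Cons by simp
  note Sc = subsetD[OF subspace_carrier[OF S]]
  have t: "t \<in> carrier V" using Cons by simp
  have "\<forall>i\<in>I. \<exists>w a. w \<in> span_mod N ts \<and> a \<in> carrier K \<and> u i = w \<oplus>\<^bsub>V\<^esub> a \<odot>\<^bsub>V\<^esub> t"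
    using Cons.prems(4) by simp blast
  then obtain w a where wa: "\<And>i. i \<in> I \<Longrightarrow> w i \<in> span_mod N ts"
    "\<And>i. i \<in> I \<Longrightarrow> a i \<in> carrier K" "\<And>i. i \<in> I \<Longrightarrow> u i = w i \<oplus>\<^bsub>V\<^esub> a i \<odot>\<^bsub>V\<^esub> t"
    by metis
  show ?case
  proof (cases "\<forall>i\<in>I. a i = \<zero>\<^bsub>K\<^esub>")
    case True
    then have "u i \<in> span_mod N ts" if "i \<in> I" for i
      using wa that t Sc[OF wa(1)[OF that]] by simp
    then show ?thesis using Cons by simp
  next
    case False
    then obtain j where j: "j \<in> I" "a j \<noteq> \<zero>\<^bsub>K\<^esub>" by blast
    \<comment> \<open>With \<open>j\<close> as pivot, \<open>b i\<close> is chosen so that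
      \<open>t\<close> cancels in \<open>u i - b i u j\<close>.\<close>
    define b where "b i = a i \<otimes>\<^bsub>K\<^esub> inv\<^bsub>K\<^esub> a j" for i
    have aj: "a j \<in> Units K" using j wa by (simp add: field_Units)
    have b: "b i \<in> carrier K" "b i \<otimes>\<^bsub>K\<^esub> a j = a i" if "i \<in> I" for i
      using wa(2)[OF that] aj wa(2)[OF j(1)] by (simp_all add: b_def m_assoc)
    define v where "v i = u i \<ominus>\<^bsub>V\<^esub> b i \<odot>\<^bsub>V\<^esub> u j" for i
    have uc: "u i \<in> carrier V" if "i \<in> I" for i using wa[OF that] Sc t by simp
    have v: "v i \<in> span_mod N ts" if i: "i \<in> I" for i
    proof -
      have wc: "w i \<in> carrier V" "w j \<in> carrier V" using Sc wa i j by auto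
      have "b i \<odot>\<^bsub>V\<^esub> u j = b i \<odot>\<^bsub>V\<^esub> w j \<oplus>\<^bsub>V\<^esub> a i \<odot>\<^bsub>V\<^esub> t"
        using wa(3)[OF j(1)] wa(2)[OF j(1)] b[OF i] wc t
        by (simp add: smult_r_distr smult_assoc1[symmetric])
      then have "v i = (w i \<oplus>\<^bsub>V\<^esub> a i \<odot>\<^bsub>V\<^esub> t) \<ominus>\<^bsub>V\<^esub> (b i \<odot>\<^bsub>V\<^esub> w j \<oplus>\<^bsub>V\<^esub> a i \<odot>\<^bsub>V\<^esub> t)"
        using wa(3)[OF i] by (simp add: v_def)
      also have "\<dots> = w i \<ominus>\<^bsub>V\<^esub> b i \<odot>\<^bsub>V\<^esub> w j"
        using wc t b[OF i] wa(2)[OF i] M.r_neg[of "a i \<odot>\<^bsub>V\<^esub> t"]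
        by (simp add: a_minus_def M.minus_add M.a_ac M.r_neg2 M.r_neg1)
      finally show ?thesis
        using subspace_minus[OF S] subspace_smult[OF S] wa i j b by simp
    qed
    let ?I = "I - {j}"
    have fI: "finite ?I" using Cons by simp
    have "\<exists>c. c \<in> ?I \<rightarrow> carrier K \<and> (\<exists>i\<in>?I. c i \<noteq> \<zero>\<^bsub>K\<^esub>) \<and> finsum V (\<lambda>i. c i \<odot>\<^bsub>V\<^esub> v i) ?I \<in> N"
      using Cons j v by (intro Cons.IH) auto
    then obtain c where c: "c \<in> ?I \<rightarrow> carrier K" "\<exists>i\<in>?I. c i \<noteq> \<zero>\<^bsub>K\<^esub>"
      "finsum V (\<lambda>i. c i \<odot>\<^bsub>V\<^esub> v i) ?I \<in> N" by blast
    have cb: "(\<lambda>i. \<ominus>\<^bsub>K\<^esub> (c i \<otimes>\<^bsub>K\<^esub> b i)) \<in> ?I \<rightarrow> carrier K"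
    proof (rule Pi_I)
      fix i assume "i \<in> ?I"
      then have "c i \<in> carrier K" "b i \<in> carrier K" using c(1) b by auto
      then show "\<ominus>\<^bsub>K\<^esub> (c i \<otimes>\<^bsub>K\<^esub> b i) \<in> carrier K" by simp
    qed
    \<comment> \<open>The coefficient at \<open>j\<close> collects the multiples of
      \<open>u j\<close> that are subtracted in the vectors \<open>v i\<close>.\<close>
    define c' where "c' = c(j := finsum K (\<lambda>i. \<ominus>\<^bsub>K\<^esub> (c i \<otimes>\<^bsub>K\<^esub> b i)) ?I)"
    have c'j: "c' j \<in> carrier K" unfolding c'_def using cb by simp
    have c'C: "c' \<in> I \<rightarrow> carrier K" using c(1) c'j by (auto simp: c'_def)
    have cu: "(\<lambda>i. c i \<odot>\<^bsub>V\<^esub> u i) \<in> ?I \<rightarrow> carrier V" using c uc by auto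
    have cbu: "(\<lambda>i. (\<ominus>\<^bsub>K\<^esub> (c i \<otimes>\<^bsub>K\<^esub> b i)) \<odot>\<^bsub>V\<^esub> u j) \<in> ?I \<rightarrow> carrier V" using cb uc[OF j(1)] by auto
    have c'u: "finsum V (\<lambda>i. c' i \<odot>\<^bsub>V\<^esub> u i) ?I = finsum V (\<lambda>i. c i \<odot>\<^bsub>V\<^esub> u i) ?I"
      using cu by (intro M.finsum_cong') (auto simp: c'_def)
    have "I = insert j ?I" using j by auto
    then have "finsum V (\<lambda>i. c' i \<odot>\<^bsub>V\<^esub> u i) I = finsum V (\<lambda>i. c' i \<odot>\<^bsub>V\<^esub> u i) (insert j ?I)" by simp
    also have "\<dots> = c' j \<odot>\<^bsub>V\<^esub> u j \<oplus>\<^bsub>V\<^esub> finsum V (\<lambda>i. c' i \<odot>\<^bsub>V\<^esub> u i) ?I"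
      using fI c'C uc j by (intro M.finsum_insert) auto
    also have "\<dots> = finsum V (\<lambda>i. c i \<odot>\<^bsub>V\<^esub> u i) ?I \<oplus>\<^bsub>V\<^esub> finsum V (\<lambda>i. (\<ominus>\<^bsub>K\<^esub> (c i \<otimes>\<^bsub>K\<^esub> b i)) \<odot>\<^bsub>V\<^esub> u j) ?I"
      unfolding c'u finsum_smult_distr_vec[OF fI cb uc[OF j(1)]]
      using cu c'j uc[OF j(1)] by (simp add: c'_def M.a_comm)
    also have "\<dots> = finsum V (\<lambda>i. c i \<odot>\<^bsub>V\<^esub> u i \<oplus>\<^bsub>V\<^esub> (\<ominus>\<^bsub>K\<^esub> (c i \<otimes>\<^bsub>K\<^esub> b i)) \<odot>\<^bsub>V\<^esub> u j) ?I"
      using M.finsum_addf[OF cu cbu] by simp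
    also have "\<dots> = finsum V (\<lambda>i. c i \<odot>\<^bsub>V\<^esub> v i) ?I"
    proof (intro M.finsum_cong' HOL.refl)
      show "(\<lambda>i. c i \<odot>\<^bsub>V\<^esub> v i) \<in> ?I \<rightarrow> carrier V" using c(1) v Sc by auto
      fix i assume i: "i \<in> ?I"
      then have "c i \<in> carrier K" "b i \<in> carrier K" "u i \<in> carrier V" "u j \<in> carrier V"
        using c(1) b uc j by auto
      then show "c i \<odot>\<^bsub>V\<^esub> u i \<oplus>\<^bsub>V\<^esub> (\<ominus>\<^bsub>K\<^esub> (c i \<otimes>\<^bsub>K\<^esub> b i)) \<odot>\<^bsub>V\<^esub> u j = c i \<odot>\<^bsub>V\<^esub> v i"
        by (simp add: v_def a_minus_def smult_r_distr smult_l_minus smult_r_minus smult_assoc1)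
    qed
    finally have "finsum V (\<lambda>i. c' i \<odot>\<^bsub>V\<^esub> u i) I \<in> N" using c(3) by simp
    moreover have "\<exists>i\<in>I. c' i \<noteq> \<zero>\<^bsub>K\<^esub>" using c(2) by (auto simp: c'_def)
    ultimately show ?thesis using c'C by blast
  qed
qed

section \<open>Independence modulo a subspace, bases and coordinates\<close>

definition indep_mod :: "'c set \<Rightarrow> (nat \<Rightarrow> 'c) \<Rightarrow> nat \<Rightarrow> bool" where
  "indep_mod N u d \<longleftrightarrow> (\<forall>c. c \<in> {..<d} \<rightarrow> carrier K \<longrightarrow>
     finsum V (\<lambda>i. c i \<odot>\<^bsub>V\<^esub> u i) {..<d} \<in> N \<longrightarrow> (\<forall>i<d. c i = \<zero>\<^bsub>K\<^esub>))"

text \<open>An independent family of maximal length spans, as a vector outside its span could be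
  appended. The bound \<open>D\<close> stands in for finite dimension modulo
  \<open>N\<close>.\<close>

lemma maximal_indep_mod:
  assumes N: "VectorSpace.subspace K N V" and S: "S \<subseteq> carrier V"
    and bound: "\<And>d u. \<lbrakk>\<And>i. i < d \<Longrightarrow> u i \<in> S; indep_mod N u d\<rbrakk> \<Longrightarrow> d \<le> D"
  shows "\<exists>d u. (\<forall>i<d. u i \<in> S) \<and> indep_mod N u d \<and> S \<subseteq> span_mod N (map u [0..<d])"
proof -
  define Q where "Q d \<longleftrightarrow> (\<exists>u. (\<forall>i<d. u i \<in> S) \<and> indep_mod N u d)" for d
  have "Q 0" by (simp add: Q_def indep_mod_def)
  moreover have "\<forall>d. Q d \<longrightarrow> d \<le> D" using bound unfolding Q_def by blast
  ultimately obtain d where "Q d" and dmax: "\<And>d'. Q d' \<Longrightarrow> d' \<le> d"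
    using GreatestI_nat[of Q 0 D] Greatest_le_nat[of Q _ D] by blast
  then obtain u where u: "\<And>i. i < d \<Longrightarrow> u i \<in> S" "indep_mod N u d" by (auto simp: Q_def)
  have uS: "set (map u [0..<d]) \<subseteq> carrier V" using u S by auto
  note sub = span_mod_subspace[OF N uS]
  have "v \<in> span_mod N (map u [0..<d])" if v: "v \<in> S" for v
  proof -
    let ?u = "u(d := v)"
    have "\<not> Q (Suc d)" using dmax by fastforce
    moreover have "\<forall>i<Suc d. ?u i \<in> S" using u v by (auto simp: less_Suc_eq)
    ultimately have "\<not> indep_mod N ?u (Suc d)" unfolding Q_def by blast
    then obtain c i where c: "c \<in> {..<Suc d} \<rightarrow> carrier K"
      and cN: "finsum V (\<lambda>i. c i \<odot>\<^bsub>V\<^esub> ?u i) {..<Suc d} \<in> N" and i: "i < Suc d" "c i \<noteq> \<zero>\<^bsub>K\<^esub>"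
      unfolding indep_mod_def by blast
    have cC: "c \<in> {..<d} \<rightarrow> carrier K" "c d \<in> carrier K" using c by auto
    have uc: "u i \<in> carrier V" if "i < d" for i using u(1)[OF that] S by auto
    have vc: "v \<in> carrier V" using v S by auto
    let ?s = "finsum V (\<lambda>i. c i \<odot>\<^bsub>V\<^esub> u i) {..<d}"
    have f: "(\<lambda>i. c i \<odot>\<^bsub>V\<^esub> u i) \<in> {..<d} \<rightarrow> carrier V" using cC uc by auto
    have s: "finsum V (\<lambda>i. c i \<odot>\<^bsub>V\<^esub> ?u i) {..<d} = ?s"
      using f by (intro M.finsum_cong') auto
    have "finsum V (\<lambda>i. c i \<odot>\<^bsub>V\<^esub> ?u i) {..<Suc d} = c d \<odot>\<^bsub>V\<^esub> v \<oplus>\<^bsub>V\<^esub> finsum V (\<lambda>i. c i \<odot>\<^bsub>V\<^esub> ?u i) {..<d}"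
      unfolding lessThan_Suc using cC uc vc by (subst M.finsum_insert) auto
    then have eq: "c d \<odot>\<^bsub>V\<^esub> v \<oplus>\<^bsub>V\<^esub> ?s \<in> N" using cN s by simp
    \<comment> \<open>A relation that does not involve \<open>v\<close> would contradict the
      independence of \<open>u\<close>; hence the relation can be solved for
      \<open>v\<close>.\<close>
    have cd: "c d \<noteq> \<zero>\<^bsub>K\<^esub>"
    proof
      assume z: "c d = \<zero>\<^bsub>K\<^esub>"
      then have "?s \<in> N" using eq vc f by simp
      then have "\<forall>i<d. c i = \<zero>\<^bsub>K\<^esub>" using u(2) cC unfolding indep_mod_def by blast
      then show False using i z less_Suc_eq by auto
    qed
    have sS: "?s \<in> span_mod N (map u [0..<d])"
    proof (rule subspace_finsum[OF sub])
      fix i assume "i \<in> {..<d}"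
      then show "c i \<odot>\<^bsub>V\<^esub> u i \<in> span_mod N (map u [0..<d])"
        using cC span_mod_gen[OF N uS] by (intro subspace_smult[OF sub]) auto
    qed simp
    have "(c d \<odot>\<^bsub>V\<^esub> v \<oplus>\<^bsub>V\<^esub> ?s) \<ominus>\<^bsub>V\<^esub> ?s \<in> span_mod N (map u [0..<d])"
      using eq span_mod_base[OF N uS] sS by (intro subspace_minus[OF sub]) auto
    moreover have "(c d \<odot>\<^bsub>V\<^esub> v \<oplus>\<^bsub>V\<^esub> ?s) \<ominus>\<^bsub>V\<^esub> ?s = c d \<odot>\<^bsub>V\<^esub> v"
      using f vc cC by (simp add: a_minus_def M.a_assoc M.r_neg)
    ultimately have "c d \<odot>\<^bsub>V\<^esub> v \<in> span_mod N (map u [0..<d])" by simp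
    moreover have U: "c d \<in> Units K" using cd cC by (simp add: field_Units)
    ultimately have "inv\<^bsub>K\<^esub> c d \<odot>\<^bsub>V\<^esub> (c d \<odot>\<^bsub>V\<^esub> v) \<in> span_mod N (map u [0..<d])"
      using subspace_smult[OF sub Units_inv_closed] by blast
    moreover have "inv\<^bsub>K\<^esub> c d \<odot>\<^bsub>V\<^esub> (c d \<odot>\<^bsub>V\<^esub> v) = v"
      using U cC vc by (simp add: smult_assoc1[symmetric])
    ultimately show ?thesis by simp
  qed
  then show ?thesis using u by blast
qed

lemma dim_spanning_list:
  assumes fin_dim
  obtains ts where "set ts \<subseteq> carrier V" "length ts = dim" "carrier V = span_mod {\<zero>\<^bsub>V\<^esub>} ts"
proof -
  obtain A where A: "finite A" "basis A" using finite_basis_exists assms by blast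
  obtain ts where ts: "set ts = A" "distinct ts" using finite_distinct_list[OF A(1)] by blast
  have AC: "A \<subseteq> carrier V" "span A = carrier V" using A by (auto simp: basis_def)
  have z: "VectorSpace.subspace K {\<zero>\<^bsub>V\<^esub>} V" by (rule subspaceI) auto
  have S: "VectorSpace.subspace K (span_mod {\<zero>\<^bsub>V\<^esub>} ts) V" using span_mod_subspace[OF z] ts AC by simp
  have "A \<subseteq> span_mod {\<zero>\<^bsub>V\<^esub>} ts" using span_mod_gen[OF z] ts AC by auto
  then have "span A \<subseteq> span_mod {\<zero>\<^bsub>V\<^esub>} ts" using S by (intro span_is_subset) auto
  then have "carrier V = span_mod {\<zero>\<^bsub>V\<^esub>} ts" using AC subspace_carrier[OF S] by auto
  moreover have "length ts = dim" using dim_basis[OF A] ts distinct_card by metis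
  ultimately show thesis using that ts AC by blast
qed

text \<open>A biorthogonal system: vectors together with linear functionals dual to them, which is
  what reading off coefficients requires.\<close>

definition coordinates :: "nat \<Rightarrow> (nat \<Rightarrow> 'c) \<Rightarrow> (nat \<Rightarrow> 'c \<Rightarrow> 'a) \<Rightarrow> bool" where
  "coordinates d e crd \<longleftrightarrow> (\<forall>j<d. e j \<in> carrier V) \<and>
     (\<forall>j. \<forall>v\<in>carrier V. crd j v \<in> carrier K) \<and>
     (\<forall>j. \<forall>v\<in>carrier V. \<forall>w\<in>carrier V. crd j (v \<oplus>\<^bsub>V\<^esub> w) = crd j v \<oplus>\<^bsub>K\<^esub> crd j w) \<and>
     (\<forall>j. \<forall>c\<in>carrier K. \<forall>v\<in>carrier V. crd j (c \<odot>\<^bsub>V\<^esub> v) = c \<otimes>\<^bsub>K\<^esub> crd j v) \<and>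
     (\<forall>i<d. \<forall>j<d. crd i (e j) = (if i = j then \<one>\<^bsub>K\<^esub> else \<zero>\<^bsub>K\<^esub>))"

lemma dim_coordinates:
  assumes fin_dim
  shows "\<exists>e crd. coordinates dim e crd"
proof -
  obtain A where A: "finite A" "basis A" using finite_basis_exists assms by blast
  then have AC: "A \<subseteq> carrier V" by (auto simp: basis_def)
  obtain e0 where e0: "bij_betw e0 {0..<card A} A" using ex_bij_betw_nat_finite[OF A(1)] by blast
  have dA: "dim = card A" by (rule dim_basis[OF A])
  define co where "co v = (THE a. a \<in> A \<rightarrow>\<^sub>E carrier K \<and> lincomb a A = v)" for v
  have ex1: "\<exists>!a. a \<in> A \<rightarrow>\<^sub>E carrier K \<and> lincomb a A = v" if "v \<in> carrier V" for v
    using basis_criterion[OF A(1) AC] A that by blast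
  have co: "co v \<in> A \<rightarrow>\<^sub>E carrier K" "lincomb (co v) A = v" if "v \<in> carrier V" for v
    using theI'[OF ex1[OF that]] by (auto simp: co_def)
  have coI: "co v = restrict a A" if "a \<in> A \<rightarrow> carrier K" "lincomb a A = v" for v a
  proof -
    have "lincomb (restrict a A) A = v"
      using that AC by (subst lincomb_cong[OF HOL.refl AC, of _ a]) auto
    moreover have "v \<in> carrier V" using that AC by auto
    moreover have "restrict a A \<in> A \<rightarrow>\<^sub>E carrier K" using that by auto
    ultimately show ?thesis using ex1[of v] co[of v] by blast
  qed
  define crd where "crd j v = (if j < dim then co v (e0 j) else \<zero>\<^bsub>K\<^esub>)" for j v
  have eA: "e0 j \<in> A" if "j < dim" for j using that e0 dA by (auto simp: bij_betw_def)
  show ?thesis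
    unfolding coordinates_def
  proof (intro exI[of _ e0] exI[of _ crd] conjI allI impI ballI)
    fix j assume "j < dim" then show "e0 j \<in> carrier V" using eA AC by auto
  next
    fix j v assume "v \<in> carrier V"
    then show "crd j v \<in> carrier K" using co eA by (auto simp: crd_def)
  next
    fix j v w assume v: "v \<in> carrier V" "w \<in> carrier V"
    have "co v \<in> A \<rightarrow> carrier K" "co w \<in> A \<rightarrow> carrier K" using co v by auto
    then have "co (v \<oplus>\<^bsub>V\<^esub> w) = restrict (\<lambda>x. co v x \<oplus>\<^bsub>K\<^esub> co w x) A"
      using lincomb_sum[OF A(1) AC, of "co v" "co w"] co v by (intro coI) auto
    then show "crd j (v \<oplus>\<^bsub>V\<^esub> w) = crd j v \<oplus>\<^bsub>K\<^esub> crd j w" using eA by (auto simp: crd_def)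
  next
    fix j c v assume c: "c \<in> carrier K" "v \<in> carrier V"
    have "co v \<in> A \<rightarrow> carrier K" using co c by auto
    then have "co (c \<odot>\<^bsub>V\<^esub> v) = restrict (\<lambda>x. c \<otimes>\<^bsub>K\<^esub> co v x) A"
      using lincomb_smult[OF AC, of "co v" c] co c by (intro coI) auto
    then show "crd j (c \<odot>\<^bsub>V\<^esub> v) = c \<otimes>\<^bsub>K\<^esub> crd j v" using eA c by (auto simp: crd_def)
  next
    fix i j assume ij: "i < dim" "j < dim"
    let ?a = "\<lambda>x. if x = e0 j then \<one>\<^bsub>K\<^esub> else \<zero>\<^bsub>K\<^esub>"
    have "lincomb ?a A = ?a (e0 j) \<odot>\<^bsub>V\<^esub> e0 j \<oplus>\<^bsub>V\<^esub> lincomb ?a (A - {e0 j})"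
      using A AC eA[OF ij(2)] by (intro lincomb_del2) auto
    also have "lincomb ?a (A - {e0 j}) = lincomb (\<lambda>_. \<zero>\<^bsub>K\<^esub>) (A - {e0 j})"
      using AC by (intro lincomb_cong[where B = "A - {e0 j}"]) auto
    also have "\<dots> = \<zero>\<^bsub>V\<^esub>" unfolding lincomb_def using AC by (intro M.finsum_all0) auto
    finally have "lincomb ?a A = e0 j" using AC eA[OF ij(2)] by auto
    then have "co (e0 j) = restrict ?a A" by (intro coI) auto
    moreover have "e0 i = e0 j \<longleftrightarrow> i = j"
      using e0 ij dA by (auto simp: bij_betw_def inj_on_def)
    ultimately show "crd i (e0 j) = (if i = j then \<one>\<^bsub>K\<^esub> else \<zero>\<^bsub>K\<^esub>)"
      using ij eA[OF ij(1)] by (simp add: crd_def)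
  qed
qed

end

lemma module_hom_zero:
  assumes V: "vectorspace K V" and W: "vectorspace K W"
    and f: "f \<in> LinearCombinations.module_hom K V W"
  shows "f \<zero>\<^bsub>V\<^esub> = \<zero>\<^bsub>W\<^esub>"
proof -
  interpret mod_hom K V W f
    using assms by (simp add: mod_hom_def mod_hom_axioms_def vectorspace_def)
  show ?thesis by simp
qed

lemma finsum_module_hom:
  assumes V: "vectorspace K V" and W: "vectorspace K W"
    and f: "f \<in> LinearCombinations.module_hom K V W" and I: "finite I" and u: "u \<in> I \<rightarrow> carrier V"
  shows "f (finsum V u I) = finsum W (\<lambda>i. f (u i)) I"
proof -
  interpret V: vectorspace K V by (rule V)
  interpret W: vectorspace K W by (rule W)
  note fd = f[unfolded LinearCombinations.module_hom_def, simplified]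
  show ?thesis using I u
  proof (induction I rule: finite_induct)
    case (insert i I)
    then have "u \<in> I \<rightarrow> carrier V" "u i \<in> carrier V" by auto
    moreover then have "(\<lambda>i. f (u i)) \<in> I \<rightarrow> carrier W" "f (u i) \<in> carrier W" using fd by auto
    ultimately show ?case using insert fd by simp
  qed (simp add: module_hom_zero[OF V W f])
qed

section \<open>Operations with one marked input\<close>

type_synonym word = "(nat set \<times> nat) list"
type_synonym 'k vec = "word \<Rightarrow> 'k"

abbreviation fun_space :: "('k, 'm) ring_scheme \<Rightarrow> ('k, 'i \<Rightarrow> 'k) module" where
  "fun_space K \<equiv> LinearCombinations.ring.func_space K UNIV"

text \<open>The support may be infinite: a vector enters only through its coefficients. The index
  type varies, because the same definition serves for vectors of words and for operations.\<close>

definition vecs :: "('k, 'm) ring_scheme \<Rightarrow> ('i \<Rightarrow> 'k) set" where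
  "vecs K = {v. \<forall>w. v w \<in> carrier K}"

definition vac :: "('k, 'm) ring_scheme \<Rightarrow> 'k vec" where
  "vac K w = (if w = [] then \<one>\<^bsub>K\<^esub> else \<zero>\<^bsub>K\<^esub>)"

definition marked :: "nat \<Rightarrow> (nat \<Rightarrow> nat) \<Rightarrow> bool" where
  "marked n b \<longleftrightarrow> (\<exists>!j. j \<in> {1..n} \<and> b j = 0)"

text \<open>Let \<open>b\<close> label the inputs of a composite at input \<open>i\<close>, with the
  mark inside the inserted block. Then \<open>col\<close> is the labelling seen by the outer
  operation, whose input \<open>i\<close> becomes the marked one, and \<open>blk\<close> is the
  labelling seen by the inner operation.\<close>

definition col :: "nat \<Rightarrow> nat \<Rightarrow> (nat \<Rightarrow> nat) \<Rightarrow> nat \<Rightarrow> nat" where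
  "col i n b a = (if a < i then b a else if a = i then 0 else b (a + n - 1))"

definition blk :: "nat \<Rightarrow> (nat \<Rightarrow> nat) \<Rightarrow> nat \<Rightarrow> nat" where
  "blk i b a = b (i + a - 1)"

text \<open>The factor of a unary operation that is a multiple of the identity, found as the
  coefficient of the empty word in the image of the empty word; the constant labelling 0 marks the
  only input.\<close>

definition scal :: "('k, 'm) ring_scheme \<Rightarrow> ((nat \<Rightarrow> nat) \<times> 'k vec \<times> word \<Rightarrow> 'k) \<Rightarrow> 'k" where
  "scal K g = g (\<lambda>_. 0, vac K, [])"

text \<open>The identity has to act on \<open>V\<close> as well as on \<open>M\<close>, unlike the
  operations of higher arity. Restricting arity 1 to scalars makes this harmless: inserting a unary
  operation at any input, marked or not, is multiplication by its scalar.\<close>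

definition comb_carrier ::
  "('k, 'm) ring_scheme \<Rightarrow> nat \<Rightarrow> ((nat \<Rightarrow> nat) \<times> 'k vec \<times> word \<Rightarrow> 'k) set" where
  "comb_carrier K n = {g \<in> vecs K.
     (\<forall>b v w. v \<notin> vecs K \<or> \<not> marked n b \<longrightarrow> g (b, v, w) = \<zero>\<^bsub>K\<^esub>) \<and>
     (\<forall>b v v' w. v \<in> vecs K \<longrightarrow> v' \<in> vecs K \<longrightarrow>
        g (b, \<lambda>w. v w \<oplus>\<^bsub>K\<^esub> v' w, w) = g (b, v, w) \<oplus>\<^bsub>K\<^esub> g (b, v', w)) \<and>
     (\<forall>b c v w. c \<in> carrier K \<longrightarrow> v \<in> vecs K \<longrightarrow>
        g (b, \<lambda>w. c \<otimes>\<^bsub>K\<^esub> v w, w) = c \<otimes>\<^bsub>K\<^esub> g (b, v, w)) \<and>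
     (\<forall>b b' v w. (\<forall>j\<in>{1..n}. b j = b' j) \<longrightarrow> g (b, v, w) = g (b', v, w)) \<and>
     (n = 1 \<longrightarrow> (\<forall>b v w. b 1 = 0 \<longrightarrow> v \<in> vecs K \<longrightarrow> g (b, v, w) = scal K g \<otimes>\<^bsub>K\<^esub> v w))}"

text \<open>Operations on \<open>V \<oplus> M\<close>, where \<open>V\<close> is spanned by the positive labels and \<open>M\<close> by the words, that
  vanish unless exactly one argument lies in \<open>M\<close>: for \<open>b\<close> labelling the inputs, \<open>0\<close> marking the one
  from \<open>M\<close>, \<open>g (b, v, w)\<close> is the coefficient of \<open>w\<close> in the value at \<open>v\<close>. In arity 1 only multiples
  of the identity are allowed.\<close>

definition comb_operad ::
  "('k, 'm) ring_scheme \<Rightarrow> ('k, (nat \<Rightarrow> nat) \<times> 'k vec \<times> word \<Rightarrow> 'k) opd" where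
  "comb_operad K =
     \<lparr>cpt = (\<lambda>n. (fun_space K)\<lparr>carrier := comb_carrier K n\<rparr>),
      sact = (\<lambda>n \<sigma> g. \<lambda>(b, v, w). g (b \<circ> \<sigma>, v, w)),
      ounit = (\<lambda>(b, v, w). if b 1 = 0 \<and> v \<in> vecs K then v w else \<zero>\<^bsub>K\<^esub>),
      circ = (\<lambda>m n i g h. \<lambda>(b, v, w). if n = 1 then scal K h \<otimes>\<^bsub>K\<^esub> g (b, v, w)
        else g (col i n b, \<lambda>w. h (blk i b, v, w), w))\<rparr>"

lemma marked_one: "marked 1 b \<longleftrightarrow> b 1 = 0"
  by (auto simp: marked_def)

lemma marked_permutes:
  assumes "\<sigma> permutes {1..n}"
  shows "marked n (b \<circ> \<sigma>) \<longleftrightarrow> marked n b"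
proof -
  have *: "\<sigma> j \<in> {1..n} \<longleftrightarrow> j \<in> {1..n}" for j by (rule permutes_in_image[OF assms])
  have \<sigma>: "\<sigma> (inv_into UNIV \<sigma> j) = j" "inv_into UNIV \<sigma> (\<sigma> j) = j" for j
    using permutes_inverses[OF assms] by auto
  have "(\<exists>!j. Q (\<sigma> j)) \<longleftrightarrow> (\<exists>!j. Q j)" for Q
  proof
    assume "\<exists>!j. Q (\<sigma> j)"
    then obtain j where "Q (\<sigma> j)" "\<And>j'. Q (\<sigma> j') \<Longrightarrow> j' = j" by blast
    then show "\<exists>!j. Q j" using \<sigma>(1) by (intro ex1I[of _ "\<sigma> j"]) metis+
  next
    assume "\<exists>!j. Q j"
    then obtain j where "Q j" "\<And>j'. Q j' \<Longrightarrow> j' = j" by blast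
    then show "\<exists>!j. Q (\<sigma> j)" using \<sigma> by (intro ex1I[of _ "inv_into UNIV \<sigma> j"]) metis+
  qed
  from this[of "\<lambda>j. j \<in> {1..n} \<and> b j = 0"]
  have "(\<exists>!j. \<sigma> j \<in> {1..n} \<and> b (\<sigma> j) = 0) \<longleftrightarrow> (\<exists>!j. j \<in> {1..n} \<and> b j = 0)" .
  then show ?thesis unfolding marked_def by (simp only: * comp_apply)
qed

text \<open>Read contrapositively: if a labelling of the composite is not marked, then the one seen
  by the outer or by the inner operation is not marked either, so the composite vanishes
  there.\<close>

lemma marked_compose:
  assumes i: "i \<in> {1..m}" and n: "1 \<le> n" and c: "marked m (col i n b)" and bl: "marked n (blk i b)"
  shows "marked (m + n - 1) b"
proof -
  obtain j where j: "j \<in> {1..n}" "b (i + j - 1) = 0"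
    and ju: "\<And>j'. \<lbrakk>j' \<in> {1..n}; b (i + j' - 1) = 0\<rbrakk> \<Longrightarrow> j' = j"
    using bl unfolding marked_def blk_def by blast
  have cu: "a = i" if "a \<in> {1..m}" "col i n b a = 0" for a
    using c i that unfolding marked_def by (metis (no_types, lifting) col_def less_irrefl)
  have "i + j - 1 \<in> {1..m + n - 1}" using i j by auto
  moreover have "a = i + j - 1" if a: "a \<in> {1..m + n - 1}" "b a = 0" for a
  proof -
    consider "a < i" | "i \<le> a" "a < i + n" | "i + n \<le> a" by linarith
    then show ?thesis
    proof cases
      case 1
      then have "a = i" using a i by (intro cu) (auto simp: col_def)
      then show ?thesis using 1 by simp
    next
      case 2
      then have "a + 1 - i = j" using a i by (intro ju) auto
      then show ?thesis using 2 by auto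
    next
      case 3
      then have "a + 1 - n = i" using a i n by (intro cu) (auto simp: col_def)
      then show ?thesis using 3 n by auto
    qed
  qed
  ultimately show ?thesis using j unfolding marked_def by blast
qed

section \<open>The operad axioms for \<open>comb_operad\<close>\<close>

context
  fixes K :: "('k, 'm) ring_scheme" (structure)
  assumes K: "field K"
begin

interpretation K: field K by (rule K)

lemma vectorspace_fun_space: "vectorspace K (fun_space K)"
  using K.func_space_is_module[of UNIV] K.field_axioms by (simp add: vectorspace_def)

lemma fun_space_simps:
  "carrier (fun_space K) = vecs K"
  "\<zero>\<^bsub>fun_space K\<^esub> = (\<lambda>_. \<zero>)"
  "v \<oplus>\<^bsub>fun_space K\<^esub> v' = (\<lambda>w. v w \<oplus> v' w)"
  "c \<odot>\<^bsub>fun_space K\<^esub> v = (\<lambda>w. c \<otimes> v w)"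
  by (auto simp: K.func_space_def vecs_def restrict_def)

lemma vecs_zero: "(\<lambda>_. \<zero>) \<in> vecs K"
  by (simp add: vecs_def)

lemma vac_vecs: "vac K \<in> vecs K"
  by (simp add: vecs_def vac_def)

lemma comb_carrier_val:
  assumes "g \<in> comb_carrier K n"
  shows "g x \<in> carrier K"
proof -
  have "g \<in> vecs K" using assms unfolding comb_carrier_def by blast
  then show ?thesis unfolding vecs_def by blast
qed

lemma comb_carrier_off:
  assumes "g \<in> comb_carrier K n" "v \<notin> vecs K \<or> \<not> marked n b"
  shows "g (b, v, w) = \<zero>"
  using assms(1)[unfolded comb_carrier_def mem_Collect_eq, THEN conjunct2, THEN conjunct1, rule_format] assms(2) by blast

lemma comb_carrier_add:
  assumes "g \<in> comb_carrier K n" "v \<in> vecs K" "v' \<in> vecs K"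
  shows "g (b, \<lambda>w. v w \<oplus> v' w, w) = g (b, v, w) \<oplus> g (b, v', w)"
  by (rule assms(1)[unfolded comb_carrier_def mem_Collect_eq, THEN conjunct2, THEN conjunct2, THEN conjunct1, rule_format, OF assms(2,3)])

lemma comb_carrier_smult:
  assumes "g \<in> comb_carrier K n" "c \<in> carrier K" "v \<in> vecs K"
  shows "g (b, \<lambda>w. c \<otimes> v w, w) = c \<otimes> g (b, v, w)"
  by (rule assms(1)[unfolded comb_carrier_def mem_Collect_eq, THEN conjunct2, THEN conjunct2, THEN conjunct2, THEN conjunct1, rule_format, OF assms(2,3)])

lemma comb_carrier_cong:
  assumes "g \<in> comb_carrier K n" "\<And>j. j \<in> {1..n} \<Longrightarrow> b j = b' j"
  shows "g (b, v, w) = g (b', v, w)"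
  by (rule assms(1)[unfolded comb_carrier_def mem_Collect_eq, THEN conjunct2, THEN conjunct2, THEN conjunct2, THEN conjunct2, THEN conjunct1, rule_format]) (rule assms(2))

lemma comb_carrier_one:
  assumes "g \<in> comb_carrier K 1" "b 1 = 0" "v \<in> vecs K"
  shows "g (b, v, w) = scal K g \<otimes> v w"
  by (rule assms(1)[unfolded comb_carrier_def mem_Collect_eq, THEN conjunct2, THEN conjunct2, THEN conjunct2, THEN conjunct2, THEN conjunct2, rule_format]) (rule HOL.refl assms(2,3))+

lemma comb_carrier_zero:
  assumes g: "g \<in> comb_carrier K n"
  shows "g (b, \<lambda>_. \<zero>, w) = \<zero>"
  using comb_carrier_smult[OF g K.zero_closed vecs_zero, of b w] comb_carrier_val[OF g] by simp

lemma comb_carrier_vec: "g \<in> comb_carrier K n \<Longrightarrow> (\<lambda>w. g (b, v, w)) \<in> vecs K"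
  by (simp add: vecs_def comb_carrier_val)

lemma scal_closed: "g \<in> comb_carrier K n \<Longrightarrow> scal K g \<in> carrier K"
  by (simp add: scal_def comb_carrier_val)

lemma comb_carrierI:
  assumes "\<And>b v w. g (b, v, w) \<in> carrier K"
    and "\<And>b v w. v \<notin> vecs K \<or> \<not> marked n b \<Longrightarrow> g (b, v, w) = \<zero>"
    and "\<And>b v v' w. \<lbrakk>v \<in> vecs K; v' \<in> vecs K\<rbrakk>
      \<Longrightarrow> g (b, \<lambda>w. v w \<oplus> v' w, w) = g (b, v, w) \<oplus> g (b, v', w)"
    and "\<And>b c v w. \<lbrakk>c \<in> carrier K; v \<in> vecs K\<rbrakk> \<Longrightarrow> g (b, \<lambda>w. c \<otimes> v w, w) = c \<otimes> g (b, v, w)"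
    and "\<And>b b' v w. (\<And>j. j \<in> {1..n} \<Longrightarrow> b j = b' j) \<Longrightarrow> g (b, v, w) = g (b', v, w)"
    and "\<And>b v w. \<lbrakk>n = 1; b 1 = 0; v \<in> vecs K\<rbrakk> \<Longrightarrow> g (b, v, w) = scal K g \<otimes> v w"
  shows "g \<in> comb_carrier K n"
proof -
  have "g x \<in> carrier K" for x using assms(1) by (cases x) auto
  then have "g \<in> vecs K" unfolding vecs_def by blast
  then show ?thesis
    unfolding comb_carrier_def mem_Collect_eq
  proof (intro conjI)
    show "\<forall>b v w. v \<notin> vecs K \<or> \<not> marked n b \<longrightarrow> g (b, v, w) = \<zero>"
      by (intro allI impI) (rule assms(2))
    show "\<forall>b v v' w. v \<in> vecs K \<longrightarrow> v' \<in> vecs K \<longrightarrow>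
        g (b, \<lambda>w. v w \<oplus> v' w, w) = g (b, v, w) \<oplus> g (b, v', w)"
      by (intro allI impI) (rule assms(3))
    show "\<forall>b c v w. c \<in> carrier K \<longrightarrow> v \<in> vecs K \<longrightarrow>
        g (b, \<lambda>w. c \<otimes> v w, w) = c \<otimes> g (b, v, w)"
      by (intro allI impI) (rule assms(4))
    show "\<forall>b b' v w. (\<forall>j\<in>{1..n}. b j = b' j) \<longrightarrow> g (b, v, w) = g (b', v, w)"
      by (intro allI impI) (rule assms(5), blast)
    show "n = 1 \<longrightarrow> (\<forall>b v w. b 1 = 0 \<longrightarrow> v \<in> vecs K \<longrightarrow> g (b, v, w) = scal K g \<otimes> v w)"
      by (intro allI impI) (rule assms(6))
  qed
qed

lemma comb_cpt:
  "carrier (cpt (comb_operad K) n) = comb_carrier K n"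
  "\<zero>\<^bsub>cpt (comb_operad K) n\<^esub> = (\<lambda>_. \<zero>)"
  "g \<oplus>\<^bsub>cpt (comb_operad K) n\<^esub> h = (\<lambda>x. g x \<oplus> h x)"
  "c \<odot>\<^bsub>cpt (comb_operad K) n\<^esub> g = (\<lambda>x. c \<otimes> g x)"
  using fun_space_simps by (simp_all add: comb_operad_def)

lemma comb_sact: "sact (comb_operad K) n \<sigma> g = (\<lambda>(b, v, w). g (b \<circ> \<sigma>, v, w))"
  by (simp add: comb_operad_def)

lemma comb_circ_one: "circ (comb_operad K) m 1 i g h = (\<lambda>x. scal K h \<otimes> g x)"
  by (auto simp: comb_operad_def)

lemma comb_circ: "n \<noteq> 1 \<Longrightarrow> circ (comb_operad K) m n i g h
    = (\<lambda>(b, v, w). g (col i n b, \<lambda>w. h (blk i b, v, w), w))"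
  by (auto simp: comb_operad_def)

lemma comb_ounit: "ounit (comb_operad K) = (\<lambda>(b, v, w). if b 1 = 0 \<and> v \<in> vecs K then v w else \<zero>)"
  by (simp add: comb_operad_def)

lemma subspace_comb_carrier: "VectorSpace.subspace K (comb_carrier K n) (fun_space K)"
proof -
  have "comb_carrier K n \<subseteq> vecs K" by (auto simp: comb_carrier_def)
  moreover have "(\<lambda>_. \<zero>) \<in> comb_carrier K n"
    by (rule comb_carrierI) (auto simp: vecs_def scal_def)
  moreover have "(\<lambda>x. g x \<oplus> h x) \<in> comb_carrier K n"
    if "g \<in> comb_carrier K n" "h \<in> comb_carrier K n" for g h
  proof (rule comb_carrierI)
    fix b b' :: "nat \<Rightarrow> nat" and v :: "'k vec" and w :: word assume "\<And>j. j \<in> {1..n} \<Longrightarrow> b j = b' j"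
    then show "g (b, v, w) \<oplus> h (b, v, w) = g (b', v, w) \<oplus> h (b', v, w)"
      using comb_carrier_cong[OF that(1), of b b'] comb_carrier_cong[OF that(2), of b b'] by metis
  next
    fix b :: "nat \<Rightarrow> nat" and v :: "'k vec" and w :: word
    assume "n = 1" "b 1 = 0" "v \<in> vecs K"
    then show "g (b, v, w) \<oplus> h (b, v, w) = scal K (\<lambda>x. g x \<oplus> h x) \<otimes> v w"
      using comb_carrier_one[of g b v w] comb_carrier_one[of h b v w] that
      by (simp add: scal_def comb_carrier_val vecs_def K.l_distr)
  qed (use that in \<open>auto simp: comb_carrier_val comb_carrier_off comb_carrier_add
        comb_carrier_smult K.r_distr K.a_ac\<close>)
  moreover have "(\<lambda>x. c \<otimes> g x) \<in> comb_carrier K n"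
    if c: "c \<in> carrier K" and g: "g \<in> comb_carrier K n" for g c
  proof (rule comb_carrierI)
    fix b b' :: "nat \<Rightarrow> nat" and v :: "'k vec" and w :: word assume "\<And>j. j \<in> {1..n} \<Longrightarrow> b j = b' j"
    then show "c \<otimes> g (b, v, w) = c \<otimes> g (b', v, w)"
      using comb_carrier_cong[OF g, of b b'] by metis
  next
    fix b :: "nat \<Rightarrow> nat" and v :: "'k vec" and w :: word
    assume "n = 1" "b 1 = 0" "v \<in> vecs K"
    then show "c \<otimes> g (b, v, w) = scal K (\<lambda>x. c \<otimes> g x) \<otimes> v w"
      using comb_carrier_one[of g b v w] c g
      by (simp add: scal_def comb_carrier_val vecs_def K.m_assoc)
  qed (use c g in \<open>auto simp: comb_carrier_val comb_carrier_off comb_carrier_add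
        comb_carrier_smult K.r_distr K.m_ac\<close>)
  ultimately show ?thesis
    using vectorspace_fun_space
    by (auto simp: VectorSpace.subspace_def submodule_def vectorspace_def fun_space_simps)
qed

lemma vectorspace_comb: "vectorspace K (cpt (comb_operad K) n)"
  using vectorspace.subspace_is_vs[OF vectorspace_fun_space subspace_comb_carrier]
  by (simp add: comb_operad_def)

lemma comb_sact_closed:
  assumes \<sigma>: "\<sigma> permutes {1..n}" and g: "g \<in> comb_carrier K n"
  shows "(\<lambda>(b, v, w). g (b \<circ> \<sigma>, v, w)) \<in> comb_carrier K n"
proof (rule comb_carrierI, goal_cases)
  case (2 b v w)
  then show ?case using comb_carrier_off[OF g] marked_permutes[OF \<sigma>] by auto
next
  case (5 b b' v w)
  have "g (b \<circ> \<sigma>, v, w) = g (b' \<circ> \<sigma>, v, w)"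
    using 5 permutes_in_image[OF \<sigma>] by (intro comb_carrier_cong[OF g]) auto
  then show ?case by simp
next
  case (6 b v w)
  then have "\<sigma> = id" using \<sigma> by auto
  then show ?case using comb_carrier_one[of g b v w] g 6 by (simp add: scal_def)
qed (use g in \<open>auto simp: comb_carrier_val comb_carrier_add comb_carrier_smult\<close>)

lemma comb_smult_closed:
  assumes "c \<in> carrier K" "g \<in> comb_carrier K n"
  shows "(\<lambda>x. c \<otimes> g x) \<in> comb_carrier K n"
proof -
  have "c \<odot>\<^bsub>fun_space K\<^esub> g \<in> comb_carrier K n"
    using subspace_comb_carrier[of n] assms
    by (simp add: VectorSpace.subspace_def submodule_def)
  then show ?thesis by (simp only: fun_space_simps(4))
qed

lemma comb_circ_closed:
  assumes m: "1 \<le> m" and n: "1 \<le> n" and i: "i \<in> {1..m}"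
    and g: "g \<in> comb_carrier K m" and h: "h \<in> comb_carrier K n"
  shows "circ (comb_operad K) m n i g h \<in> comb_carrier K (m + n - 1)"
proof (cases "n = 1")
  case True
  then show ?thesis using comb_smult_closed[OF scal_closed[OF h] g] comb_circ_one by simp
next
  case False
  have "(\<lambda>(b, v, w). g (col i n b, \<lambda>w. h (blk i b, v, w), w)) \<in> comb_carrier K (m + n - 1)"
  proof (rule comb_carrierI, goal_cases)
    case (2 b v w)
    have "g (col i n b, \<lambda>w. h (blk i b, v, w), w) = \<zero>"
    proof (cases "v \<in> vecs K \<and> marked n (blk i b)")
      case True
      then have "\<not> marked m (col i n b)" using 2 marked_compose[OF i n] by blast
      then show ?thesis using comb_carrier_off[OF g] by blast
    next
      case False
      then have "h (blk i b, v, w) = \<zero>" for w using comb_carrier_off[OF h] by blast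
      then show ?thesis using comb_carrier_zero[OF g] by simp
    qed
    then show ?case by simp
  next
    case (3 b v v' w)
    then show ?case
      using comb_carrier_add[OF g comb_carrier_vec[OF h] comb_carrier_vec[OF h]]
      by (simp add: comb_carrier_add[OF h])
  next
    case (4 b c v w)
    then show ?case
      using comb_carrier_smult[OF g _ comb_carrier_vec[OF h]]
      by (simp add: comb_carrier_smult[OF h])
  next
    case (5 b b' v w)
    have "h (blk i b, v, w) = h (blk i b', v, w)" for w
    proof (rule comb_carrier_cong[OF h])
      fix j assume "j \<in> {1..n}"
      then have "i + j - 1 \<in> {1..m + n - 1}" using i by simp arith
      then show "blk i b j = blk i b' j" using 5 by (simp only: blk_def)
    qed
    moreover have "g (col i n b, u, w) = g (col i n b', u, w)" for u
    proof (rule comb_carrier_cong[OF g])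
      fix j assume j: "j \<in> {1..m}"
      then have "j \<in> {1..m + n - 1}" "j + n - 1 \<in> {1..m + n - 1}" using n by auto
      then have "b j = b' j" "b (j + n - 1) = b' (j + n - 1)" by (blast intro: 5)+
      then show "col i n b j = col i n b' j" by (simp only: col_def)
    qed
    ultimately show ?case by simp
  qed (use g False n m in \<open>auto simp: comb_carrier_val\<close>)
  then show ?thesis using comb_circ[OF False] by simp
qed

lemma scal_smult: "scal K (\<lambda>x. c \<otimes> g x) = c \<otimes> scal K g"
  by (simp add: scal_def)

lemma scal_add: "scal K (\<lambda>x. g x \<oplus> h x) = scal K g \<oplus> scal K h"
  by (simp add: scal_def)

text \<open>\<open>circ\<close> singles out unary operations only in the inner position. In the
  outer position they act by their scalar because every operation of arity 1 is a multiple of the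
  identity.\<close>

lemma comb_circ_unary:
  assumes g: "g \<in> comb_carrier K 1" and h: "h \<in> comb_carrier K n"
  shows "circ (comb_operad K) 1 n 1 g h = (\<lambda>x. scal K g \<otimes> h x)"
proof (cases "n = 1")
  case True
  show ?thesis unfolding True comb_circ_one
  proof (rule ext)
    fix x :: "(nat \<Rightarrow> nat) \<times> 'k vec \<times> word"
    obtain b v w where x: "x = (b, v, w)" by (cases x) auto
    show "scal K h \<otimes> g x = scal K g \<otimes> h x"
    proof (cases "b 1 = 0 \<and> v \<in> vecs K")
      case True: True
      then have "g x = scal K g \<otimes> v w" "h x = scal K h \<otimes> v w"
        using comb_carrier_one g h \<open>n = 1\<close> x by blast+
      moreover have "v w \<in> carrier K" using True by (simp add: vecs_def)
      ultimately show ?thesis using scal_closed[OF g] scal_closed[OF h] by (simp add: K.m_ac)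
    next
      case False
      then have "g x = \<zero>" "h x = \<zero>"
        using comb_carrier_off[of _ 1 v b w] marked_one g h \<open>n = 1\<close> x by auto
      then show ?thesis using scal_closed[OF g] scal_closed[OF h] by simp
    qed
  qed
next
  case False
  show ?thesis
    unfolding comb_circ[OF False]
    using comb_carrier_one[OF g _ comb_carrier_vec[OF h]]
      comb_carrier_cong[OF h, of "blk 1 _"]
    by (auto simp: col_def blk_def fun_eq_iff)
qed

lemma comb_ounit_closed: "ounit (comb_operad K) \<in> comb_carrier K 1"
  unfolding comb_ounit
proof (rule comb_carrierI, goal_cases)
  case (1 b v w)
  then show ?case by (simp add: vecs_def)
next
  case (2 b v w)
  then show ?case unfolding marked_one by auto
next
  case (3 b v v' w)
  then have "(\<lambda>w. v w \<oplus> v' w) \<in> vecs K" by (simp add: vecs_def)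
  then show ?case using 3 by simp
next
  case (4 b c v w)
  then have "(\<lambda>w. c \<otimes> v w) \<in> vecs K" by (simp add: vecs_def)
  then show ?case using 4 by simp
next
  case (5 b b' v w)
  then have "b 1 = b' 1" by simp
  then show ?case by simp
next
  case (6 b v w)
  then show ?case using vac_vecs by (simp add: scal_def vac_def vecs_def)
qed

lemma scal_ounit: "scal K (ounit (comb_operad K)) = \<one>"
  using vac_vecs by (simp add: scal_def comb_ounit vac_def)

lemma comb_circ_smult_left:
  assumes "c \<in> carrier K" "g \<in> comb_carrier K m" "h \<in> comb_carrier K n"
  shows "circ (comb_operad K) m' n i (\<lambda>x. c \<otimes> g x) h = (\<lambda>x. c \<otimes> circ (comb_operad K) m n i g h x)"
proof (cases "n = 1")
  case True
  have "scal K h \<in> carrier K" "g x \<in> carrier K" for x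
    using assms by (auto intro: scal_closed comb_carrier_val)
  then show ?thesis unfolding True comb_circ_one using assms(1) by (auto simp: K.m_ac)
next
  case False
  then show ?thesis unfolding comb_circ[OF False] by auto
qed

lemma comb_circ_smult_right:
  assumes "c \<in> carrier K" "g \<in> comb_carrier K m" "h \<in> comb_carrier K n"
  shows "circ (comb_operad K) m' n i g (\<lambda>x. c \<otimes> h x) = (\<lambda>x. c \<otimes> circ (comb_operad K) m n i g h x)"
proof (cases "n = 1")
  case True
  have "scal K h \<in> carrier K" "g x \<in> carrier K" for x
    using assms by (auto intro: scal_closed comb_carrier_val)
  then show ?thesis unfolding True comb_circ_one scal_smult using assms(1) by (auto simp: K.m_ac)
next
  case False
  then show ?thesis
    unfolding comb_circ[OF False]
    using comb_carrier_smult[OF assms(2,1) comb_carrier_vec[OF assms(3)]] by (auto simp: fun_eq_iff)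
qed

lemma comb_circ_add_left:
  assumes "g \<in> comb_carrier K m" "g' \<in> comb_carrier K m" "h \<in> comb_carrier K n"
  shows "circ (comb_operad K) m n i (\<lambda>x. g x \<oplus> g' x) h
    = (\<lambda>x. circ (comb_operad K) m n i g h x \<oplus> circ (comb_operad K) m n i g' h x)"
proof (cases "n = 1")
  case True
  have "scal K h \<in> carrier K" "g x \<in> carrier K" "g' x \<in> carrier K" for x
    using assms by (auto intro: scal_closed comb_carrier_val)
  then show ?thesis unfolding True comb_circ_one by (simp add: K.r_distr)
next
  case False
  then show ?thesis unfolding comb_circ[OF False] by auto
qed

lemma comb_circ_add_right:
  assumes "g \<in> comb_carrier K m" "h \<in> comb_carrier K n" "h' \<in> comb_carrier K n"
  shows "circ (comb_operad K) m n i g (\<lambda>x. h x \<oplus> h' x)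
    = (\<lambda>x. circ (comb_operad K) m n i g h x \<oplus> circ (comb_operad K) m n i g h' x)"
proof (cases "n = 1")
  case True
  have "scal K h \<in> carrier K" "scal K h' \<in> carrier K" "g x \<in> carrier K" for x
    using assms by (auto intro: scal_closed comb_carrier_val)
  then show ?thesis unfolding True comb_circ_one scal_add by (simp add: K.l_distr)
next
  case False
  show ?thesis
    unfolding comb_circ[OF False]
    using comb_carrier_add[OF assms(1) comb_carrier_vec[OF assms(2)] comb_carrier_vec[OF assms(3)]]
    by (simp add: fun_eq_iff)
qed

text \<open>Together with \<open>blk_col\<close> and \<open>blk_blk\<close>, this is the sequential
  axiom on the level of labels.\<close>

lemma col_col: "\<lbrakk>1 \<le> i; j \<in> {1..m}; 1 \<le> n\<rbrakk> \<Longrightarrow> col i m (col (i - 1 + j) n b) = col i (m + n - 1) b"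
  by (rule ext) (auto simp: col_def intro!: arg_cong[of _ _ b])

lemma blk_col: "\<lbrakk>1 \<le> i; 1 \<le> j\<rbrakk> \<Longrightarrow> blk i (col (i - 1 + j) n b) = col j n (blk i b)"
  by (rule ext) (auto simp: col_def blk_def intro!: arg_cong[of _ _ b])

lemma blk_blk: "\<lbrakk>1 \<le> i; 1 \<le> j\<rbrakk> \<Longrightarrow> blk (i - 1 + j) b = blk j (blk i b)"
  by (rule ext) (auto simp: blk_def intro!: arg_cong[of _ _ b])

lemma comb_carrier_two_marks:
  assumes "g \<in> comb_carrier K n" "i \<in> {1..n}" "j \<in> {1..n}" "i \<noteq> j" "b i = 0" "b j = 0"
  shows "g (b, v, w) = \<zero>"
  using assms(2-) by (intro comb_carrier_off[OF assms(1)]) (auto simp: marked_def)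

lemma comb_sequential:
  assumes l: "1 \<le> l" and m: "1 \<le> m" and n: "1 \<le> n" and i: "i \<in> {1..l}" and j: "j \<in> {1..m}"
    and la: "la \<in> comb_carrier K l" and \<mu>: "\<mu> \<in> comb_carrier K m" and \<nu>: "\<nu> \<in> comb_carrier K n"
  shows "circ (comb_operad K) (l + m - 1) n (i - 1 + j) (circ (comb_operad K) l m i la \<mu>) \<nu>
    = circ (comb_operad K) l (m + n - 1) i la (circ (comb_operad K) m n j \<mu> \<nu>)"
proof -
  consider "n = 1" | "n \<noteq> 1" "m = 1" | "n \<noteq> 1" "m \<noteq> 1" by blast
  then show ?thesis
  proof cases
    case 1
    have "m + 1 - 1 = m" by simp
    then show ?thesis
      unfolding 1 comb_circ_one using comb_circ_smult_right[OF scal_closed[OF \<nu>] la \<mu>] by metis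
  next
    case 2
    then have j1: "j = 1" "i - 1 + 1 = i" using j i by auto
    have "circ (comb_operad K) (l + m - 1) n (i - 1 + j) (circ (comb_operad K) l m i la \<mu>) \<nu>
        = (\<lambda>x. scal K \<mu> \<otimes> circ (comb_operad K) l n i la \<nu> x)"
      unfolding 2 j1 comb_circ_one by (rule comb_circ_smult_left[OF scal_closed[OF \<mu>] la \<nu>])
    moreover have "circ (comb_operad K) l (m + n - 1) i la (circ (comb_operad K) m n j \<mu> \<nu>)
        = (\<lambda>x. scal K \<mu> \<otimes> circ (comb_operad K) l n i la \<nu> x)"
      using comb_circ_unary[OF _ \<nu>, of \<mu>] \<mu> comb_circ_smult_right[OF scal_closed[OF \<mu>] la \<nu>] 2 j1
      by simp
    ultimately show ?thesis by simp
  next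
    case 3
    then have mn: "m + n - 1 \<noteq> 1" using m n by auto
    have ij: "1 \<le> i" "1 \<le> j" using i j by auto
    show ?thesis
      unfolding comb_circ[OF 3(1)] comb_circ[OF 3(2)] comb_circ[OF mn]
      by (simp only: prod.case col_col[OF ij(1) j n] blk_col[OF ij] blk_blk[OF ij])
  qed
qed

text \<open>If both inserted operations are proper, two arguments of \<open>la\<close> would have to lie in \<open>M\<close>.\<close>

lemma comb_parallel:
  assumes l: "1 \<le> l" and m: "1 \<le> m" and n: "1 \<le> n" and ij: "1 \<le> i" "i < j" "j \<le> l"
    and la: "la \<in> comb_carrier K l" and \<mu>: "\<mu> \<in> comb_carrier K m" and \<nu>: "\<nu> \<in> comb_carrier K n"
  shows "circ (comb_operad K) (l + m - 1) n (j - 1 + m) (circ (comb_operad K) l m i la \<mu>) \<nu>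
    = circ (comb_operad K) (l + n - 1) m i (circ (comb_operad K) l n j la \<nu>) \<mu>"
proof -
  consider "n = 1" | "n \<noteq> 1" "m = 1" | "n \<noteq> 1" "m \<noteq> 1" by blast
  then show ?thesis
  proof cases
    case 1
    show ?thesis
      unfolding 1 comb_circ_one
      by (rule comb_circ_smult_left[OF scal_closed[OF \<nu>] la \<mu>, THEN HOL.sym])
  next
    case 2
    have "j - 1 + 1 = j" using ij by simp
    then show ?thesis
      unfolding 2 comb_circ_one
      using comb_circ_smult_left[OF scal_closed[OF \<mu>] la \<nu>] by simp
  next
    case 3
    have "la (col i m (col (j - 1 + m) n b), u, w) = \<zero>" "la (col j n (col i m b), u, w) = \<zero>" for b u w
      using ij m by (intro comb_carrier_two_marks[OF la, of i j]; auto simp: col_def)+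
    then show ?thesis unfolding comb_circ[OF 3(1)] comb_circ[OF 3(2)] by (auto simp del: One_nat_def)
  qed
qed

lemma comb_equivariant:
  assumes m: "1 \<le> m" and n: "1 \<le> n" and i: "i \<in> {1..m}"
    and \<sigma>: "\<sigma> permutes {1..m}" and \<tau>: "\<tau> permutes {1..n}"
    and \<mu>: "\<mu> \<in> comb_carrier K m" and \<nu>: "\<nu> \<in> comb_carrier K n"
  shows "circ (comb_operad K) m n (\<sigma> i) (sact (comb_operad K) m \<sigma> \<mu>) (sact (comb_operad K) n \<tau> \<nu>)
    = sact (comb_operad K) (m + n - 1) (perm_circ m n i \<sigma> \<tau>) (circ (comb_operad K) m n i \<mu> \<nu>)"
proof (cases "n = 1")
  case True
  then have "\<tau> = id" using \<tau> by auto
  have eq: "\<mu> (b \<circ> \<sigma>, v, w) = \<mu> (b \<circ> perm_circ m 1 i \<sigma> \<tau>, v, w)" for b v w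
    using i by (intro comb_carrier_cong[OF \<mu>]) (auto simp: perm_circ_def Let_def \<open>\<tau> = id\<close> less_Suc_eq)
  have "scal K (sact (comb_operad K) 1 \<tau> \<nu>) = scal K \<nu>" by (simp add: scal_def comb_sact comp_def)
  then show ?thesis
    unfolding True comb_circ_one by (auto simp: comb_sact eq simp del: One_nat_def)
next
  case False
  let ?p = "perm_circ m n i \<sigma> \<tau>"
  have si: "\<sigma> a = \<sigma> i \<longleftrightarrow> a = i" for a using permutes_inj[OF \<sigma>] by (auto dest: injD)
  \<comment> \<open>On the block the permutation acts as a shifted \<open>\<tau>\<close>, elsewhere
    as \<open>\<sigma>\<close> with a gap of length \<open>n - 1\<close> that \<open>col\<close>
    closes; the input \<open>i\<close> of the outer operation is marked on both sides.\<close>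
  have 1: "\<nu> (blk (\<sigma> i) b \<circ> \<tau>, v, w) = \<nu> (blk i (b \<circ> ?p), v, w)" for b v w
  proof (rule comb_carrier_cong[OF \<nu>])
    fix k assume "k \<in> {1..n}"
    then have k: "i + k - 1 \<in> {1..m + n - 1}" "\<not> i + k - 1 < i" "i + k - 1 < i + n" "i + k - 1 - i + 1 = k"
      using i by auto
    have "?p (i + k - 1) = \<sigma> i + \<tau> k - 1"
      unfolding perm_circ_def Let_def using k by (simp only: not_True_eq_False if_True if_False)
    then show "(blk (\<sigma> i) b \<circ> \<tau>) k = blk i (b \<circ> ?p) k" by (simp only: blk_def comp_apply)
  qed
  have 2: "\<mu> (col (\<sigma> i) n b \<circ> \<sigma>, u, w) = \<mu> (col i n (b \<circ> ?p), u, w)" for b u w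
  proof (rule comb_carrier_cong[OF \<mu>])
    fix a assume a: "a \<in> {1..m}"
    consider "a < i" | "a = i" | "i < a" by linarith
    then show "(col (\<sigma> i) n b \<circ> \<sigma>) a = col i n (b \<circ> ?p) a"
    proof cases
      case 1
      then show ?thesis using a i n si[of a] by (auto simp: col_def perm_circ_def Let_def)
    next
      case 2
      then show ?thesis by (simp add: col_def)
    next
      case 3
      then show ?thesis using a i n si[of a] by (auto simp: col_def perm_circ_def Let_def)
    qed
  qed
  show ?thesis
    unfolding comb_circ[OF False] comb_sact using 1 2 by (auto simp: fun_eq_iff comp_def)
qed

theorem operad_comb: "operad K (comb_operad K)"
proof (intro operad.intro s_module.intro operad_axioms.intro, goal_cases)
  case (1 n)
  then show ?case by (simp add: vectorspace_comb)
next
  case (2 n \<sigma>)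
  then show ?case
    unfolding LinearCombinations.module_hom_def comb_cpt comb_sact
    using comb_sact_closed[OF 2(2)] by (auto simp: fun_eq_iff)
next
  case (3 n x)
  then show ?case by (auto simp: comb_sact)
next
  case (4 n \<sigma> \<tau> x)
  then show ?case by (auto simp: comb_sact o_assoc)
next
  case 5
  show ?case unfolding comb_cpt by (rule comb_ounit_closed)
next
  case (6 m n i \<nu>)
  then have \<nu>: "\<nu> \<in> comb_carrier K n" by (simp add: comb_cpt)
  show ?case
    unfolding LinearCombinations.module_hom_def comb_cpt
    using comb_circ_closed[OF 6(1-3) _ \<nu>] comb_circ_add_left[OF _ _ \<nu>] comb_circ_smult_left[OF _ _ \<nu>]
    by (intro CollectI conjI funcsetI allI impI) (simp_all del: One_nat_def)
next
  case (7 m n i \<mu>)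
  then have \<mu>: "\<mu> \<in> comb_carrier K m" by (simp add: comb_cpt)
  show ?case
    unfolding LinearCombinations.module_hom_def comb_cpt
    using comb_circ_closed[OF 7(1-3) \<mu>] comb_circ_add_right[OF \<mu>] comb_circ_smult_right[OF _ \<mu>]
    by (intro CollectI conjI funcsetI allI impI) (simp_all del: One_nat_def)
next
  case (8 n \<nu>)
  then have "\<nu> \<in> comb_carrier K n" by (simp add: comb_cpt)
  then show ?case using comb_circ_unary[OF comb_ounit_closed] scal_ounit by (simp add: comb_carrier_val)
next
  case (9 m i \<mu>)
  then have "\<mu> \<in> comb_carrier K m" by (simp add: comb_cpt)
  then show ?case using scal_ounit by (simp add: comb_circ_one comb_carrier_val del: One_nat_def)
next
  case (10 l m n i j la \<mu> \<nu>)
  then show ?case unfolding comb_cpt by (rule comb_sequential)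
next
  case (11 l m n i j la \<mu> \<nu>)
  then show ?case unfolding comb_cpt by (rule comb_parallel)
next
  case (12 m n i \<sigma> \<tau> \<mu> \<nu>)
  then show ?case unfolding comb_cpt by (rule comb_equivariant)
qed

end

section \<open>Labellings of the inputs\<close>

text \<open>The recursion on expressions is transported to their classes, so that no later argument
  has to choose representatives.\<close>

lemma free_operad_induct [consumes 2, case_names gen unit zero add smult act circ]:
  assumes X: "s_module K X" and "A \<in> carrier (cpt (free_operad K X) n)"
    and "\<And>n x. \<lbrakk>1 \<le> n; x \<in> carrier (cpt X n)\<rbrakk> \<Longrightarrow> Q n (free_gen K X n x)"
    and "Q 1 (ounit (free_operad K X))"
    and "\<And>n. 1 \<le> n \<Longrightarrow> Q n \<zero>\<^bsub>cpt (free_operad K X) n\<^esub>"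
    and "\<And>n A B. \<lbrakk>1 \<le> n; A \<in> carrier (cpt (free_operad K X) n); B \<in> carrier (cpt (free_operad K X) n);
      Q n A; Q n B\<rbrakk> \<Longrightarrow> Q n (A \<oplus>\<^bsub>cpt (free_operad K X) n\<^esub> B)"
    and "\<And>n c A. \<lbrakk>1 \<le> n; c \<in> carrier K; A \<in> carrier (cpt (free_operad K X) n); Q n A\<rbrakk>
      \<Longrightarrow> Q n (c \<odot>\<^bsub>cpt (free_operad K X) n\<^esub> A)"
    and "\<And>n \<sigma> A. \<lbrakk>1 \<le> n; \<sigma> permutes {1..n}; A \<in> carrier (cpt (free_operad K X) n); Q n A\<rbrakk>
      \<Longrightarrow> Q n (sact (free_operad K X) n \<sigma> A)"
    and "\<And>m n i A B. \<lbrakk>1 \<le> m; 1 \<le> n; i \<in> {1..m}; A \<in> carrier (cpt (free_operad K X) m);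
      B \<in> carrier (cpt (free_operad K X) n); Q m A; Q n B\<rbrakk>
      \<Longrightarrow> Q (m + n - 1) (circ (free_operad K X) m n i A B)"
  shows "Q n A"
proof -
  have "Q n (opexp_rel K X n `` {t})" if "opexp_of K X n t" for t
    using that
  proof (induction rule: opexp_of.induct)
    case (Gen n x)
    then show ?case using assms(3) by (simp add: free_gen_def)
  next
    case Unit
    then show ?case using assms(4) by (simp add: free_ounit_cls[OF X])
  next
    case (Zero n)
    then show ?case using assms(5) by (simp add: free_zero_cls[OF X])
  next
    case (Add n s t)
    then show ?case
      using assms(6)[OF opexp_of_pos[OF Add(1)] cls_in_carrier[OF X Add(1)] cls_in_carrier[OF X Add(2)]]
      by (simp add: free_add_cls[OF X])
  next
    case (Smult c n t)
    then show ?case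
      using assms(7)[OF opexp_of_pos[OF Smult(2)] Smult(1) cls_in_carrier[OF X Smult(2)]]
      by (simp add: free_smult_cls[OF X])
  next
    case (Act \<sigma> n t)
    then show ?case
      using assms(8)[OF opexp_of_pos[OF Act(2)] Act(1) cls_in_carrier[OF X Act(2)]]
      by (simp add: free_sact_cls[OF X])
  next
    case (Circ m s n t i)
    then show ?case
      using assms(9)[OF opexp_of_pos[OF Circ(1)] opexp_of_pos[OF Circ(2)] Circ(3)
          cls_in_carrier[OF X Circ(1)] cls_in_carrier[OF X Circ(2)]]
      by (simp only: free_circ_cls[OF X Circ(1-3)])
  qed
  then show ?thesis using assms(2) by (auto elim!: free_carrierE[OF X])
qed

text \<open>The rank of the label \<open>b a\<close> among all labels: the usual standardization of
  a word without repetitions. It is the identity outside the inputs, so as to be a permutation of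
  them.\<close>

definition standardize :: "nat \<Rightarrow> (nat \<Rightarrow> nat) \<Rightarrow> nat \<Rightarrow> nat" where
  "standardize n b a = (if a \<in> {1..n} then card {c \<in> b ` {1..n}. c \<le> b a} else a)"

lemma standardize_permutes:
  assumes b: "inj_on b {1..n}"
  shows "standardize n b permutes {1..n}"
proof (rule bij_imp_permutes)
  let ?s = "standardize n b"
  have fin: "finite {c \<in> b ` {1..n}. c \<le> x}" for x by simp
  have "?s a \<in> {1..n}" if a: "a \<in> {1..n}" for a
  proof -
    have "b a \<in> {c \<in> b ` {1..n}. c \<le> b a}" using a by auto
    then have "0 < card {c \<in> b ` {1..n}. c \<le> b a}" using fin card_gt_0_iff by blast
    moreover have "card {c \<in> b ` {1..n}. c \<le> b a} \<le> card (b ` {1..n})" by (intro card_mono) auto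
    moreover have "card (b ` {1..n}) = n" using card_image[OF b] by simp
    ultimately show ?thesis using a by (simp add: standardize_def)
  qed
  moreover have less: "?s a < ?s a'" if "a \<in> {1..n}" "a' \<in> {1..n}" "b a < b a'" for a a'
  proof -
    have "{c \<in> b ` {1..n}. c \<le> b a} \<subset> {c \<in> b ` {1..n}. c \<le> b a'}"
    proof (rule psubsetI)
      have "b a' \<in> {c \<in> b ` {1..n}. c \<le> b a'}" "b a' \<notin> {c \<in> b ` {1..n}. c \<le> b a}"
        using that by auto
      then show "{c \<in> b ` {1..n}. c \<le> b a} \<noteq> {c \<in> b ` {1..n}. c \<le> b a'}" by blast
    qed (use that in auto)
    then show ?thesis using that psubset_card_mono[OF fin] by (simp add: standardize_def)
  qed
  have "inj_on ?s {1..n}"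
  proof (rule inj_onI)
    fix a a' assume a: "a \<in> {1..n}" "a' \<in> {1..n}" "?s a = ?s a'"
    then have "b a = b a'" using less[of a a'] less[of a' a] by (cases "b a" "b a'" rule: linorder_cases) auto
    then show "a = a'" using b a by (auto dest: inj_onD)
  qed
  ultimately show "bij_betw ?s {1..n} {1..n}"
    by (intro bij_betw_imageI endo_inj_surj) auto
next
  fix a assume "a \<notin> {1..n}"
  then show "standardize n b a = a" by (simp only: standardize_def if_False)
qed

text \<open>This is what makes \<open>gen_op\<close> equivariant: permuting the inputs changes the
  sorting permutation by the same factor.\<close>

lemma standardize_comp:
  assumes \<sigma>: "\<sigma> permutes {1..n}"
  shows "standardize n (b \<circ> \<sigma>) = standardize n b \<circ> \<sigma>"
proof
  fix a
  have "\<sigma> ` {1..n} = {1..n}" by (rule permutes_image[OF \<sigma>])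
  then have "(b \<circ> \<sigma>) ` {1..n} = b ` {1..n}" by (metis image_comp)
  moreover have "\<sigma> a \<in> {1..n} \<longleftrightarrow> a \<in> {1..n}" by (rule permutes_in_image[OF \<sigma>])
  moreover have "\<sigma> a = a" if "a \<notin> {1..n}" using \<sigma> that by (rule permutes_not_in)
  ultimately show "standardize n (b \<circ> \<sigma>) a = (standardize n b \<circ> \<sigma>) a"
    by (auto simp: standardize_def simp del: atLeastAtMost_iff)
qed

lemma standardize_cong:
  assumes "\<And>j. j \<in> {1..n} \<Longrightarrow> b j = b' j"
  shows "standardize n b = standardize n b'"
proof
  fix a
  have "b ` {1..n} = b' ` {1..n}" using assms by (intro image_cong) auto
  then show "standardize n b a = standardize n b' a" using assms by (simp add: standardize_def)
qed

section \<open>Labellings of the inputs by a finite set and one mark\<close>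

definition labelling :: "nat set \<Rightarrow> (nat \<Rightarrow> nat) \<Rightarrow> bool" where
  "labelling L b \<longleftrightarrow> finite L \<and> 0 \<notin> L \<and> bij_betw b {1..card L + 1} (insert 0 L)"

text \<open>Only the position of the mark is prescribed, so that insertion at the marked input is
  insertion at input 1. The order of the other labels is left to choice; \<open>act_relabel\<close>
  absorbs any difference into a permutation of the operation.\<close>

definition std_labelling :: "nat set \<Rightarrow> nat \<Rightarrow> nat" where
  "std_labelling L = (SOME b. labelling L b \<and> b 1 = 0)"

lemma std_labelling:
  assumes "finite L" "0 \<notin> L"
  shows "labelling L (std_labelling L)" "std_labelling L 1 = 0"
proof -
  obtain h where h: "bij_betw h {1..card L} L" using ex_bij_betw_nat_finite_1[OF assms(1)] by blast
  define b where "b a = (if a = 1 then 0 else h (a - 1))" for a :: nat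
  have "bij_betw (\<lambda>a. a - 1) {2..card L + 1} {1..card L}"
    by (rule bij_betw_byWitness[where f' = "\<lambda>a. a + 1"]) auto
  then have "bij_betw (h \<circ> (\<lambda>a. a - 1)) {2..card L + 1} L" using h by (rule bij_betw_trans)
  then have "bij_betw b {2..card L + 1} L"
    by (rule iffD1[OF bij_betw_cong, rotated]) (simp add: b_def)
  moreover have "bij_betw b {1} {0}" by (simp add: bij_betw_def b_def)
  ultimately have "bij_betw b ({1} \<union> {2..card L + 1}) ({0} \<union> L)"
    using assms by (intro bij_betw_combine) auto
  moreover have "{1} \<union> {2..card L + 1} = {1..card L + 1}" by auto
  ultimately have "labelling L b \<and> b 1 = 0" using assms by (simp add: labelling_def b_def)
  then have "labelling L (std_labelling L) \<and> std_labelling L 1 = 0"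
    unfolding std_labelling_def by (rule someI[where P = "\<lambda>b. labelling L b \<and> b 1 = 0"])
  then show "labelling L (std_labelling L)" "std_labelling L 1 = 0" by blast+
qed

lemma labelling_permute:
  assumes "labelling L b" "labelling L b'"
  obtains \<sigma> where "\<sigma> permutes {1..card L + 1}" "\<And>a. a \<in> {1..card L + 1} \<Longrightarrow> b a = (b' \<circ> \<sigma>) a"
proof -
  let ?I = "{1..card L + 1}"
  have b: "bij_betw b ?I (insert 0 L)" and b': "bij_betw b' ?I (insert 0 L)"
    using assms by (auto simp: labelling_def)
  define \<sigma> where "\<sigma> a = (if a \<in> ?I then inv_into ?I b' (b a) else a)" for a
  have "bij_betw (inv_into ?I b' \<circ> b) ?I ?I"
    using b bij_betw_inv_into[OF b'] by (rule bij_betw_trans)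
  then have "bij_betw \<sigma> ?I ?I" by (rule iffD1[OF bij_betw_cong, rotated]) (simp add: \<sigma>_def)
  then have "\<sigma> permutes ?I" by (rule bij_imp_permutes) (simp only: \<sigma>_def if_False)
  moreover have "b a = (b' \<circ> \<sigma>) a" if a: "a \<in> ?I" for a
  proof -
    have "b a \<in> insert 0 L" using b a by (auto simp: bij_betw_def simp del: atLeastAtMost_iff)
    then show ?thesis using bij_betw_inv_into_right[OF b'] a by (simp only: \<sigma>_def comp_apply if_True)
  qed
  ultimately show thesis by (rule that)
qed

lemma labelling_comp:
  assumes "labelling L b" "\<sigma> permutes {1..card L + 1}"
  shows "labelling L (b \<circ> \<sigma>)"
  using assms bij_betw_trans[OF permutes_imp_bij[OF assms(2)]] by (auto simp: labelling_def)

text \<open>In a composite at the marked input 1, the inputs of the inner operation come first,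
  followed by the unmarked inputs of the outer one. So \<open>b\<close> and \<open>c\<close> are
  recovered as the labellings seen by the two factors.\<close>

lemma labelling_insert:
  assumes L: "labelling L b" and A: "labelling A c" and LA: "L \<inter> A = {}" and b1: "b 1 = 0"
  defines "d \<equiv> \<lambda>a. if a \<le> card A + 1 then c a else b (a - card A)"
  shows "labelling (L \<union> A) d"
    and "\<And>a. a \<in> {1..card L + 1} \<Longrightarrow> col 1 (card A + 1) d a = b a"
    and "\<And>a. a \<in> {1..card A + 1} \<Longrightarrow> blk 1 d a = c a"
proof -
  have fin: "finite L" "finite A" "0 \<notin> L" "0 \<notin> A" using L A by (auto simp: labelling_def)
  have card: "card (L \<union> A) = card L + card A" using fin LA by (simp add: card_Un_disjoint)
  have b: "bij_betw b {1..card L + 1} (insert 0 L)" and c: "bij_betw c {1..card A + 1} (insert 0 A)"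
    using L A by (auto simp: labelling_def)
  have "bij_betw b ({1..card L + 1} - {1}) (insert 0 L - {b 1})"
    by (rule bij_betw_subset[OF b]) (use b in \<open>auto simp: bij_betw_def inj_on_def\<close>)
  then have b': "bij_betw b {2..card L + 1} L"
  proof -
    have "{1..card L + 1} - {1} = {2..card L + 1}" by auto
    moreover have "insert 0 L - {b 1} = L" using b1 fin by auto
    ultimately show ?thesis using \<open>bij_betw b ({1..card L + 1} - {1}) (insert 0 L - {b 1})\<close> by metis
  qed
  have "bij_betw (\<lambda>a. a - card A) {card A + 2..card L + card A + 1} {2..card L + 1}"
    by (rule bij_betw_byWitness[where f' = "\<lambda>a. a + card A"]) auto
  then have "bij_betw (b \<circ> (\<lambda>a. a - card A)) {card A + 2..card L + card A + 1} L"
    using b' by (rule bij_betw_trans)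
  then have "bij_betw d {card A + 2..card L + card A + 1} L"
    by (rule iffD1[OF bij_betw_cong, rotated]) (auto simp: d_def)
  moreover have "bij_betw d {1..card A + 1} (insert 0 A)"
    using c by (rule iffD1[OF bij_betw_cong, rotated]) (auto simp: d_def)
  ultimately have "bij_betw d ({1..card A + 1} \<union> {card A + 2..card L + card A + 1}) (insert 0 A \<union> L)"
    using LA fin by (intro bij_betw_combine) auto
  moreover have "{1..card A + 1} \<union> {card A + 2..card L + card A + 1} = {1..card (L \<union> A) + 1}"
    using card by auto
  moreover have "insert 0 A \<union> L = insert 0 (L \<union> A)" by auto
  ultimately have "bij_betw d {1..card (L \<union> A) + 1} (insert 0 (L \<union> A))" by metis
  then show "labelling (L \<union> A) d" using fin by (simp add: labelling_def)
  show "col 1 (card A + 1) d a = b a" if "a \<in> {1..card L + 1}" for a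
    using that b1 by (auto simp: col_def d_def)
  show "blk 1 d a = c a" if "a \<in> {1..card A + 1}" for a
    using that by (auto simp: blk_def d_def)
qed

text \<open>When the mark lies in the inserted block, the labels split into those outside and those
  inside the block; composition thus becomes a product of multidegrees \<open>A\<close> and
  \<open>B\<close>.\<close>

lemma labelling_split:
  assumes L: "labelling L b" and card: "card L + 1 = m + n - 1" and i: "i \<in> {1..m}" and n: "1 \<le> n"
    and bl: "marked n (blk i b)"
  obtains A B where "L = A \<union> B" "A \<inter> B = {}" "card A + 1 = m" "card B + 1 = n"
    "labelling A (col i n b)" "labelling B (blk i b)"
proof -
  define A where "A = col i n b ` {1..m} - {0}"
  define B where "B = blk i b ` {1..n} - {0}"
  have fin: "finite L" "0 \<notin> L" and b: "bij_betw b {1..m + n - 1} (insert 0 L)"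
    using L card by (auto simp: labelling_def)
  have inj: "a = a'" if "a \<in> {1..m + n - 1}" "a' \<in> {1..m + n - 1}" "b a = b a'" for a a'
    using b that by (auto simp: bij_betw_def inj_on_def)
  have im: "b ` {1..m + n - 1} = insert 0 L" using b by (simp add: bij_betw_def)
  obtain j where j: "j \<in> {1..n}" "b (i + j - 1) = 0" using bl by (auto simp: marked_def blk_def)
  define Q where "Q = {1..m + n - 1} - {i..i + n - 1}"
  have ij: "i + j - 1 \<in> {1..m + n - 1}" using i j by simp arith
  \<comment> \<open>The mark occurs only once and lies in the block, so no input outside the block
    carries 0.\<close>
  have nz: "b a \<noteq> 0" if "a \<in> Q" for a
  proof
    assume "b a = 0"
    then have "b a = b (i + j - 1)" using j(2) by (simp only:)
    moreover have "a \<in> {1..m + n - 1}" using that by (simp only: Q_def Diff_iff)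
    ultimately have "a = i + j - 1" using ij inj by blast
    then have "a \<in> {i..i + n - 1}" using j(1) by simp arith
    then show False using that unfolding Q_def by blast
  qed
  have blk_im: "blk i b ` {1..n} = b ` {i..i + n - 1}"
  proof -
    have "(\<lambda>a. i + a - 1) ` {1..n} = {i..i + n - 1}"
    proof (intro equalityI subsetI)
      fix x assume "x \<in> {i..i + n - 1}"
      then have "x = i + (x + 1 - i) - 1" "x + 1 - i \<in> {1..n}" using n by auto
      then show "x \<in> (\<lambda>a. i + a - 1) ` {1..n}" by blast
    qed auto
    then show ?thesis by (metis (no_types, lifting) blk_def image_cong image_image)
  qed
  have blk_inj: "inj_on (blk i b) {1..n}"
  proof (rule inj_onI)
    fix x y assume xy: "x \<in> {1..n}" "y \<in> {1..n}" "blk i b x = blk i b y"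
    have "i + x - 1 = i + y - 1" by (rule inj) (use xy i in \<open>auto simp: blk_def\<close>)
    then show "x = y" using xy i by auto
  qed
  \<comment> \<open>\<open>e\<close> sends an input of the outer operation other than
    \<open>i\<close> to its place in the composite.\<close>
  define e where "e a = (if a < i then a else a + n - 1)" for a
  have eQ: "e ` ({1..m} - {i}) = Q"
  proof (intro equalityI subsetI)
    fix x assume x: "x \<in> Q"
    show "x \<in> e ` ({1..m} - {i})"
    proof (cases "x < i")
      case True
      then have "x = e x" "x \<in> {1..m} - {i}" using x i by (auto simp: Q_def e_def)
      then show ?thesis by blast
    next
      case False
      then have "x = e (x + 1 - n)" "x + 1 - n \<in> {1..m} - {i}" using x i n by (auto simp: Q_def e_def)
      then show ?thesis by blast
    qed
  qed (use i n in \<open>auto simp: Q_def e_def\<close>)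
  have ce: "col i n b a = b (e a)" if "a \<noteq> i" for a using that by (simp add: col_def e_def)
  have ci: "col i n b i = 0" by (simp add: col_def)
  have "{1..m} = insert i ({1..m} - {i})" using i by auto
  then have "col i n b ` {1..m} = insert 0 (col i n b ` ({1..m} - {i}))" using ci by (metis image_insert)
  also have "col i n b ` ({1..m} - {i}) = b ` Q" unfolding eQ[symmetric] image_image
    by (intro image_cong) (auto simp: ce)
  finally have col_im: "col i n b ` {1..m} = insert 0 (b ` Q)" .
  have einj: "a = a'" if "e a = e a'" "a \<noteq> i" "a' \<noteq> i" for a a'
    using that n by (auto simp: e_def split: if_splits)
  have col_inj: "inj_on (col i n b) {1..m}"
  proof (rule inj_onI)
    fix x y assume xy: "x \<in> {1..m}" "y \<in> {1..m}" "col i n b x = col i n b y"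
    have eQ': "e a \<in> Q" if "a \<in> {1..m}" "a \<noteq> i" for a using eQ that by blast
    show "x = y"
    proof (cases "x = i \<or> y = i")
      case True
      then show ?thesis using xy ce ci nz eQ' by metis
    next
      case False
      then have "b (e x) = b (e y)" "e x \<in> Q" "e y \<in> Q" using xy ce eQ' by auto
      then have "e x = e y" using inj[of "e x" "e y"] by (simp only: Q_def Diff_iff)
      then show ?thesis using einj False by blast
    qed
  qed
  have "0 \<notin> b ` Q" using nz by (metis imageE)
  then have A: "A = b ` Q" unfolding A_def col_im by blast
  have B0: "0 \<in> blk i b ` {1..n}" using j by (force simp: blk_def)
  have iA: "insert 0 A = col i n b ` {1..m}" using col_im A by (simp only:)
  have iB: "insert 0 B = blk i b ` {1..n}" using B0 unfolding B_def by blast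
  have fAB: "finite A" "finite B" "0 \<notin> A" "0 \<notin> B" by (auto simp: A_def B_def)
  have "card (insert 0 A) = m" "card (insert 0 B) = n"
    unfolding iA iB using card_image[OF col_inj] card_image[OF blk_inj] by auto
  then have cAB: "card A + 1 = m" "card B + 1 = n" using fAB by auto
  have lA: "labelling A (col i n b)"
    using fAB cAB iA col_inj by (simp add: labelling_def bij_betw_def)
  have lB: "labelling B (blk i b)"
    using fAB cAB iB blk_inj by (simp add: labelling_def bij_betw_def)
  have "{1..m + n - 1} = Q \<union> {i..i + n - 1}" using i n by (auto simp: Q_def)
  then have "insert 0 L = b ` Q \<union> b ` {i..i + n - 1}" using im by (metis image_Un)
  then have "insert 0 L = A \<union> insert 0 B" using A iB blk_im by simp
  then have "insert 0 L - {0} = (A \<union> insert 0 B) - {0}" by (simp only:)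
  then have "L = A \<union> B" using fin fAB by blast
  moreover have "A \<inter> B = {}"
  proof -
    have False if "x \<in> Q" "y \<in> {i..i + n - 1}" "b x = b y" for x y
    proof -
      have "x = y" by (rule inj) (use that i n in \<open>auto simp: Q_def\<close>)
      then show False using that by (auto simp: Q_def)
    qed
    then have "b ` Q \<inter> b ` {i..i + n - 1} = {}" by blast
    then show ?thesis using A blk_im by (auto simp: B_def)
  qed
  ultimately show thesis using that cAB lA lB by blast
qed

section \<open>The comb algebra\<close>

text \<open>The finite operad is present only through \<open>bound\<close>, which says that the free
  operad modulo the ideal of the relations has dimension at most \<open>D n\<close> in arity
  \<open>n\<close>. The data \<open>xd\<close> and \<open>rs\<close> measure generators and
  relations, and \<open>crd\<close> reads off the coordinates of a generator.\<close>

locale golod_shafarevich =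
  fixes K :: "('k, 'm) ring_scheme" (structure)
    and X :: "('k, 'x, 'z) smod_scheme"
    and R :: "nat \<Rightarrow> ('k, 'x) opexp set set"
    and xd :: "nat \<Rightarrow> nat" and bas :: "nat \<Rightarrow> nat \<Rightarrow> 'x" and crd :: "nat \<Rightarrow> nat \<Rightarrow> 'x \<Rightarrow> 'k"
    and rs :: "nat \<Rightarrow> ('k, 'x) opexp set list" and D :: "nat \<Rightarrow> nat"
  assumes X: "s_module K X" and X1: "carrier (cpt X 1) = {\<zero>\<^bsub>cpt X 1\<^esub>}"
    and crd: "1 \<le> n \<Longrightarrow> vectorspace.coordinates K (cpt X n) (xd n) (bas n) (crd n)"
    and R: "sub_s_module K (free_operad K X) R" and R1: "R 1 = {\<zero>\<^bsub>cpt (free_operad K X) 1\<^esub>}"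
    and rs: "1 \<le> n \<Longrightarrow> set (rs n) \<subseteq> carrier (cpt (free_operad K X) n)"
    and R_span: "1 \<le> n \<Longrightarrow> R n \<subseteq> vectorspace.span_mod K (cpt (free_operad K X) n)
      {\<zero>\<^bsub>cpt (free_operad K X) n\<^esub>} (rs n)"
    and bound: "\<lbrakk>1 \<le> n; \<And>i. i < d \<Longrightarrow> u i \<in> carrier (cpt (free_operad K X) n);
      vectorspace.indep_mod K (cpt (free_operad K X) n) (ideal_generated K (free_operad K X) R n) u d\<rbrakk>
      \<Longrightarrow> d \<le> D n"
begin

sublocale X: s_module K X by (rule X)

abbreviation F :: "('k, ('k, 'x) opexp set) opd" where
  "F \<equiv> free_operad K X"

abbreviation ops :: "nat \<Rightarrow> ('k, 'x) opexp set set" where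
  "ops n \<equiv> carrier (cpt F n)"

sublocale F: operad K F by (rule operad_free_operad[OF X])

lemma field_K: "field K"
  using X.vectorspace_cpt[of 1] by (simp add: vectorspace_def)

sublocale K: field K by (rule field_K)

sublocale V: vectorspace K "fun_space K :: ('k, word \<Rightarrow> 'k) module"
  by (rule vectorspace_fun_space[OF field_K])

abbreviation V :: "('k, word \<Rightarrow> 'k) module" where
  "V \<equiv> fun_space K"

lemmas fun_simps = fun_space_simps[OF field_K]

lemma
  assumes n: "1 \<le> n"
  shows bas: "j < xd n \<Longrightarrow> bas n j \<in> carrier (cpt X n)"
    and crd_closed: "y \<in> carrier (cpt X n) \<Longrightarrow> crd n j y \<in> carrier K"
    and crd_add: "\<lbrakk>y \<in> carrier (cpt X n); z \<in> carrier (cpt X n)\<rbrakk>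
      \<Longrightarrow> crd n j (y \<oplus>\<^bsub>cpt X n\<^esub> z) = crd n j y \<oplus> crd n j z"
    and crd_smult: "\<lbrakk>c \<in> carrier K; y \<in> carrier (cpt X n)\<rbrakk>
      \<Longrightarrow> crd n j (c \<odot>\<^bsub>cpt X n\<^esub> y) = c \<otimes> crd n j y"
    and crd_bas: "\<lbrakk>i < xd n; j < xd n\<rbrakk> \<Longrightarrow> crd n i (bas n j) = (if i = j then \<one> else \<zero>)"
  using crd[OF n] unfolding vectorspace.coordinates_def[OF X.vectorspace_cpt[OF n]] by blast+

lemma crd_zero: "1 \<le> n \<Longrightarrow> crd n j \<zero>\<^bsub>cpt X n\<^esub> = \<zero>"
proof -
  assume n: "1 \<le> n"
  interpret W: vectorspace K "cpt X n" by (rule X.vectorspace_cpt[OF n])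
  have "crd n j (\<zero> \<odot>\<^bsub>cpt X n\<^esub> \<zero>\<^bsub>cpt X n\<^esub>) = \<zero> \<otimes> crd n j \<zero>\<^bsub>cpt X n\<^esub>"
    using n by (intro crd_smult) auto
  then show ?thesis using crd_closed[OF n] by simp
qed

lemma sact_closed: "\<lbrakk>1 \<le> n; \<sigma> permutes {1..n}; y \<in> carrier (cpt X n)\<rbrakk>
    \<Longrightarrow> sact X n \<sigma> y \<in> carrier (cpt X n)"
  using X.sact_hom[of n \<sigma>] by (auto simp: LinearCombinations.module_hom_def)

text \<open>A generator acts by prepending letters: the letter \<open>(L, j)\<close> stands for the \<open>j\<close>-th basis element
  of the generators, with its first input marked and the others labelled increasingly by \<open>L\<close>.\<close>

definition gen_op :: "nat \<Rightarrow> 'x \<Rightarrow> (nat \<Rightarrow> nat) \<times> 'k vec \<times> word \<Rightarrow> 'k" where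
  "gen_op n y = (\<lambda>(b, v, w). if inj_on b {1..n} \<and> 0 \<in> b ` {1..n} \<and> v \<in> vecs K then
     (case w of [] \<Rightarrow> \<zero> | (L, j) # w' \<Rightarrow>
       if L = b ` {1..n} - {0} \<and> j < xd n then crd n j (sact X n (standardize n b) y) \<otimes> v w' else \<zero>)
     else \<zero>)"

lemma std_closed: "\<lbrakk>1 \<le> n; inj_on b {1..n}; y \<in> carrier (cpt X n)\<rbrakk>
    \<Longrightarrow> sact X n (standardize n b) y \<in> carrier (cpt X n)"
  by (intro sact_closed standardize_permutes)

lemma gen_op_closed:
  assumes n: "1 \<le> n" and y: "y \<in> carrier (cpt X n)"
  shows "gen_op n y \<in> comb_carrier K n"
proof (rule comb_carrierI[OF field_K], goal_cases)
  case (1 b v w)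
  show ?case
    using crd_closed[OF n std_closed[OF n _ y]]
    by (auto simp: gen_op_def vecs_def split: list.splits)
next
  case (2 b v w)
  have "marked n b" if "inj_on b {1..n}" "0 \<in> b ` {1..n}"
    using that unfolding marked_def inj_on_def by (metis imageE)
  then show ?case using 2 by (auto simp: gen_op_def simp del: One_nat_def)
next
  case (3 b v v' w)
  then have "(\<lambda>w. v w \<oplus> v' w) \<in> vecs K" by (simp add: vecs_def)
  then show ?case
    using 3 crd_closed[OF n std_closed[OF n _ y]]
    by (auto simp: gen_op_def vecs_def K.r_distr split: list.splits)
next
  case (4 b c v w)
  then have "(\<lambda>w. c \<otimes> v w) \<in> vecs K" by (simp add: vecs_def)
  then show ?case
    using 4 crd_closed[OF n std_closed[OF n _ y]]
    by (auto simp: gen_op_def vecs_def K.m_ac split: list.splits)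
next
  case (5 b b' v w)
  have "b ` {1..n} = b' ` {1..n}" using 5 by (rule image_cong[OF HOL.refl])
  moreover have "inj_on b {1..n} \<longleftrightarrow> inj_on b' {1..n}" using 5 by (rule inj_on_cong)
  moreover have "standardize n b = standardize n b'" using 5 by (rule standardize_cong)
  ultimately show ?case by (simp only: gen_op_def prod.case)
next
  case (6 b v w)
  \<comment> \<open>Prepending a letter is no multiple of the identity, so arity 1 calls for the
    zero operation; this is the case as \<open>X\<close> vanishes there.\<close>
  have y0: "y = \<zero>\<^bsub>cpt X 1\<^esub>" using y X1 6 by simp
  have z: "crd 1 j (sact X 1 (standardize 1 b) y) = \<zero>" if "inj_on b {1..1}" for b j
    using std_closed[of 1 b y] that y X1 6 crd_zero[of 1] by simp
  have "gen_op 1 y x = \<zero>" for x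
  proof (cases x)
    case (fields b v w)
    then show ?thesis
      using z[of b] by (cases w) (auto simp: gen_op_def vecs_def simp del: One_nat_def)
  qed
  then show ?case using 6 by (simp add: scal_def vecs_def del: One_nat_def)
qed

lemma gen_op_hom: "s_module_hom K X (comb_operad K) gen_op"
proof -
  note c = comb_cpt[OF field_K]
  have "gen_op n \<in> LinearCombinations.module_hom K (cpt X n) (cpt (comb_operad K) n)" if n: "1 \<le> n" for n
  proof -
    interpret W: vectorspace K "cpt X n" by (rule X.vectorspace_cpt[OF n])
    have add: "gen_op n (y \<oplus>\<^bsub>cpt X n\<^esub> z) = (\<lambda>x. gen_op n y x \<oplus> gen_op n z x)"
      if y: "y \<in> carrier (cpt X n)" "z \<in> carrier (cpt X n)" for y z
    proof -
      have "crd n j (sact X n (standardize n b) (y \<oplus>\<^bsub>cpt X n\<^esub> z))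
          = crd n j (sact X n (standardize n b) y) \<oplus> crd n j (sact X n (standardize n b) z)"
        if "inj_on b {1..n}" for b j
        using X.sact_hom[OF n standardize_permutes[OF that]] y crd_add[OF n] std_closed[OF n that]
        by (simp add: LinearCombinations.module_hom_def)
      then show ?thesis
        using crd_closed[OF n std_closed[OF n]] y
        by (auto simp: gen_op_def fun_eq_iff vecs_def K.l_distr split: list.splits)
    qed
    have smult: "gen_op n (a \<odot>\<^bsub>cpt X n\<^esub> y) = (\<lambda>x. a \<otimes> gen_op n y x)"
      if y: "y \<in> carrier (cpt X n)" "a \<in> carrier K" for y a
    proof -
      have "crd n j (sact X n (standardize n b) (a \<odot>\<^bsub>cpt X n\<^esub> y))
          = a \<otimes> crd n j (sact X n (standardize n b) y)"
        if "inj_on b {1..n}" for b j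
        using X.sact_hom[OF n standardize_permutes[OF that]] y crd_smult[OF n] std_closed[OF n that]
        by (simp add: LinearCombinations.module_hom_def)
      then show ?thesis
        using crd_closed[OF n std_closed[OF n]] y
        by (auto simp: gen_op_def fun_eq_iff vecs_def K.m_assoc split: list.splits)
    qed
    show ?thesis
      unfolding LinearCombinations.module_hom_def c
      using gen_op_closed[OF n] add smult by auto
  qed
  moreover have "gen_op n (sact X n \<sigma> y) = sact (comb_operad K) n \<sigma> (gen_op n y)"
    if a: "1 \<le> n" "\<sigma> permutes {1..n}" "y \<in> carrier (cpt X n)" for n \<sigma> y
  proof (rule ext)
    fix x :: "(nat \<Rightarrow> nat) \<times> 'k vec \<times> word"
    obtain b v w where x: "x = (b, v, w)" by (cases x) auto
    have im: "(b \<circ> \<sigma>) ` {1..n} = b ` {1..n}" using permutes_image[OF a(2)] by (metis image_comp)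
    have inj: "inj_on (b \<circ> \<sigma>) {1..n} \<longleftrightarrow> inj_on b {1..n}"
      using comp_inj_on_iff[OF permutes_inj_on[OF a(2)], of b "{1..n}"] permutes_image[OF a(2)]
      by simp
    have st: "sact X n (standardize n b) (sact X n \<sigma> y) = sact X n (standardize n (b \<circ> \<sigma>)) y"
      if "inj_on b {1..n}"
      unfolding standardize_comp[OF a(2)]
      by (rule X.sact_comp[OF a(1) standardize_permutes[OF that] a(2,3), THEN HOL.sym])
    show "gen_op n (sact X n \<sigma> y) x = sact (comb_operad K) n \<sigma> (gen_op n y) x"
      unfolding x comb_sact[OF field_K] gen_op_def prod.case im inj
      by (rule if_cong[OF HOL.refl _ HOL.refl]) (simp only: st)
  qed
  ultimately show ?thesis by (simp add: s_module_hom_def)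
qed

section \<open>The action of the free operad on words\<close>

definition phi :: "nat \<Rightarrow> ('k, 'x) opexp set \<Rightarrow> (nat \<Rightarrow> nat) \<times> 'k vec \<times> word \<Rightarrow> 'k" where
  "phi = free_ext (comb_operad K) gen_op"

lemma phi_hom: "operad_hom K F (comb_operad K) phi"
  unfolding phi_def by (rule operad_hom_free_ext[OF X operad_comb[OF field_K] gen_op_hom])

lemma phi_module_hom: "1 \<le> n \<Longrightarrow> phi n \<in> LinearCombinations.module_hom K (cpt F n) (cpt (comb_operad K) n)"
  using phi_hom by (simp add: operad_hom_def s_module_hom_def)

lemma phi_gen: "\<lbrakk>1 \<le> n; y \<in> carrier (cpt X n)\<rbrakk> \<Longrightarrow> phi n (free_gen K X n y) = gen_op n y"
  unfolding phi_def by (rule free_ext_gen[OF X operad_comb[OF field_K] gen_op_hom])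

lemma phi_closed: "\<lbrakk>1 \<le> n; f \<in> ops n\<rbrakk> \<Longrightarrow> phi n f \<in> comb_carrier K n"
  using phi_module_hom[of n] by (auto simp: LinearCombinations.module_hom_def comb_cpt[OF field_K])

definition act :: "nat \<Rightarrow> ('k, 'x) opexp set \<Rightarrow> (nat \<Rightarrow> nat) \<Rightarrow> 'k vec \<Rightarrow> 'k vec" where
  "act n f b v = (\<lambda>w. phi n f (b, v, w))"

lemma act_closed: "\<lbrakk>1 \<le> n; f \<in> ops n\<rbrakk> \<Longrightarrow> act n f b v \<in> vecs K"
  unfolding act_def using comb_carrier_vec[OF field_K phi_closed] by blast

lemma act_add_op: "\<lbrakk>1 \<le> n; f \<in> ops n; g \<in> ops n\<rbrakk>
    \<Longrightarrow> act n (f \<oplus>\<^bsub>cpt F n\<^esub> g) b v = act n f b v \<oplus>\<^bsub>V\<^esub> act n g b v"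
  using phi_module_hom[of n]
  by (simp add: act_def fun_simps LinearCombinations.module_hom_def comb_cpt[OF field_K])

lemma act_smult_op: "\<lbrakk>1 \<le> n; c \<in> carrier K; f \<in> ops n\<rbrakk>
    \<Longrightarrow> act n (c \<odot>\<^bsub>cpt F n\<^esub> f) b v = c \<odot>\<^bsub>V\<^esub> act n f b v"
  using phi_module_hom[of n]
  by (simp add: act_def fun_simps LinearCombinations.module_hom_def comb_cpt[OF field_K])

lemma act_zero_op: "1 \<le> n \<Longrightarrow> act n \<zero>\<^bsub>cpt F n\<^esub> b v = \<zero>\<^bsub>V\<^esub>"
  using module_hom_zero[OF F.vectorspace_cpt vectorspace_comb[OF field_K] phi_module_hom, of n]
  by (simp add: act_def fun_simps comb_cpt[OF field_K])

lemma act_add_vec: "\<lbrakk>1 \<le> n; f \<in> ops n; v \<in> vecs K; v' \<in> vecs K\<rbrakk>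
    \<Longrightarrow> act n f b (v \<oplus>\<^bsub>V\<^esub> v') = act n f b v \<oplus>\<^bsub>V\<^esub> act n f b v'"
  using comb_carrier_add[OF field_K phi_closed] by (simp add: act_def fun_simps)

lemma act_smult_vec: "\<lbrakk>1 \<le> n; f \<in> ops n; c \<in> carrier K; v \<in> vecs K\<rbrakk>
    \<Longrightarrow> act n f b (c \<odot>\<^bsub>V\<^esub> v) = c \<odot>\<^bsub>V\<^esub> act n f b v"
  using comb_carrier_smult[OF field_K phi_closed] by (simp add: act_def fun_simps)

lemma act_zero_vec: "\<lbrakk>1 \<le> n; f \<in> ops n\<rbrakk> \<Longrightarrow> act n f b \<zero>\<^bsub>V\<^esub> = \<zero>\<^bsub>V\<^esub>"
  using comb_carrier_zero[OF field_K phi_closed] by (simp add: act_def fun_simps)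

lemma act_unmarked: "\<lbrakk>1 \<le> n; f \<in> ops n; \<not> marked n b\<rbrakk> \<Longrightarrow> act n f b v = \<zero>\<^bsub>V\<^esub>"
  using comb_carrier_off[OF field_K phi_closed] by (simp add: act_def fun_simps)

lemma act_cong: "\<lbrakk>1 \<le> n; f \<in> ops n; \<And>j. j \<in> {1..n} \<Longrightarrow> b j = b' j\<rbrakk>
    \<Longrightarrow> act n f b v = act n f b' v"
  unfolding act_def by (rule ext) (rule comb_carrier_cong[OF field_K phi_closed])

lemma act_sact: "\<lbrakk>1 \<le> n; \<sigma> permutes {1..n}; f \<in> ops n\<rbrakk>
    \<Longrightarrow> act n (sact F n \<sigma> f) b v = act n f (b \<circ> \<sigma>) v"
  using phi_hom by (simp add: act_def operad_hom_def s_module_hom_def comb_sact[OF field_K])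

lemma phi_circ: "\<lbrakk>1 \<le> m; 1 \<le> n; i \<in> {1..m}; f \<in> ops m; g \<in> ops n\<rbrakk>
    \<Longrightarrow> phi (m + n - 1) (circ F m n i f g) = circ (comb_operad K) m n i (phi m f) (phi n g)"
  using phi_hom unfolding operad_hom_def by blast

lemma act_circ: "\<lbrakk>1 \<le> m; 1 \<le> n; n \<noteq> 1; i \<in> {1..m}; f \<in> ops m; g \<in> ops n\<rbrakk>
    \<Longrightarrow> act (m + n - 1) (circ F m n i f g) b v = act m f (col i n b) (act n g (blk i b) v)"
  by (simp add: act_def phi_circ comb_circ[OF field_K] del: One_nat_def)

lemma act_circ_unary_right:
  "\<lbrakk>1 \<le> m; i \<in> {1..m}; f \<in> ops m; g \<in> ops 1\<rbrakk>
    \<Longrightarrow> act m (circ F m 1 i f g) b v = scal K (phi 1 g) \<odot>\<^bsub>V\<^esub> act m f b v"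
  using phi_circ[of m 1 i f g] by (simp add: act_def fun_simps comb_circ_one[OF field_K] del: One_nat_def)

lemma act_circ_unary_left:
  "\<lbrakk>1 \<le> n; f \<in> ops 1; g \<in> ops n\<rbrakk>
    \<Longrightarrow> act n (circ F 1 n 1 f g) b v = scal K (phi 1 f) \<odot>\<^bsub>V\<^esub> act n g b v"
  using phi_circ[of 1 n 1 f g] comb_circ_unary[OF field_K phi_closed[of 1 f] phi_closed[of n g]]
  by (simp add: act_def fun_simps del: One_nat_def)

lemma scal_phi_closed: "f \<in> ops 1 \<Longrightarrow> scal K (phi 1 f) \<in> carrier K"
  using scal_closed[OF field_K phi_closed[of 1 f]] by simp

lemma act_unary: "\<lbrakk>f \<in> ops 1; b 1 = 0; v \<in> vecs K\<rbrakk>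
    \<Longrightarrow> act 1 f b v = scal K (phi 1 f) \<odot>\<^bsub>V\<^esub> v"
  using comb_carrier_one[OF field_K phi_closed[of 1 f]] by (simp add: act_def fun_simps del: One_nat_def)

text \<open>The comb algebra in multidegree \<open>L\<close>.\<close>

definition M :: "nat set \<Rightarrow> 'k vec set" where
  "M L = {act (card L + 1) f (std_labelling L) (vac K) | f. f \<in> ops (card L + 1)}"

lemma M_vecs: "M L \<subseteq> vecs K"
  unfolding M_def using act_closed[of "card L + 1"] by auto

lemma
  assumes n: "1 \<le> n"
  shows F_zero: "\<zero>\<^bsub>cpt F n\<^esub> \<in> ops n"
    and F_add: "\<lbrakk>f \<in> ops n; g \<in> ops n\<rbrakk> \<Longrightarrow> f \<oplus>\<^bsub>cpt F n\<^esub> g \<in> ops n"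
    and F_smult: "\<lbrakk>c \<in> carrier K; f \<in> ops n\<rbrakk> \<Longrightarrow> c \<odot>\<^bsub>cpt F n\<^esub> f \<in> ops n"
proof -
  interpret W: vectorspace K "cpt F n" by (rule F.vectorspace_cpt[OF n])
  show "\<zero>\<^bsub>cpt F n\<^esub> \<in> ops n"
    "\<lbrakk>f \<in> ops n; g \<in> ops n\<rbrakk> \<Longrightarrow> f \<oplus>\<^bsub>cpt F n\<^esub> g \<in> ops n"
    "\<lbrakk>c \<in> carrier K; f \<in> ops n\<rbrakk> \<Longrightarrow> c \<odot>\<^bsub>cpt F n\<^esub> f \<in> ops n"
    by simp_all
qed

lemma F_sact: "\<lbrakk>1 \<le> n; \<sigma> permutes {1..n}; f \<in> ops n\<rbrakk> \<Longrightarrow> sact F n \<sigma> f \<in> ops n"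
  using F.sact_hom[of n \<sigma>] by (auto simp: LinearCombinations.module_hom_def)

lemma F_circ: "\<lbrakk>1 \<le> m; 1 \<le> n; i \<in> {1..m}; f \<in> ops m; g \<in> ops n\<rbrakk>
    \<Longrightarrow> circ F m n i f g \<in> ops (m + n - 1)"
  using F.circ_hom_left[of m n i g] by (auto simp: LinearCombinations.module_hom_def)

lemma subspace_M: "VectorSpace.subspace K (M L) V"
proof (rule V.subspaceI)
  let ?n = "card L + 1"
  have n: "1 \<le> ?n" by simp
  show "M L \<subseteq> carrier V" using M_vecs fun_simps by blast
  show "\<zero>\<^bsub>V\<^esub> \<in> M L"
    unfolding M_def
    by (intro CollectI exI[of _ "\<zero>\<^bsub>cpt F ?n\<^esub>"] conjI act_zero_op[OF n, THEN HOL.sym] F_zero[OF n])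
  show "v \<oplus>\<^bsub>V\<^esub> v' \<in> M L" if "v \<in> M L" "v' \<in> M L" for v v'
  proof -
    obtain f f' where "f \<in> ops ?n" "f' \<in> ops ?n"
      "v = act ?n f (std_labelling L) (vac K)" "v' = act ?n f' (std_labelling L) (vac K)"
      using \<open>v \<in> M L\<close> \<open>v' \<in> M L\<close> unfolding M_def by blast
    then show ?thesis
      unfolding M_def
      by (intro CollectI exI[of _ "f \<oplus>\<^bsub>cpt F ?n\<^esub> f'"]) (simp add: act_add_op F_add)
  qed
  show "c \<odot>\<^bsub>V\<^esub> v \<in> M L" if "c \<in> carrier K" "v \<in> M L" for c v
  proof -
    obtain f where "f \<in> ops ?n" "v = act ?n f (std_labelling L) (vac K)"
      using \<open>v \<in> M L\<close> unfolding M_def by blast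
    then show ?thesis
      unfolding M_def using that(1)
      by (intro CollectI exI[of _ "c \<odot>\<^bsub>cpt F ?n\<^esub> f"]) (simp add: act_smult_op F_smult)
  qed
qed

lemma act_relabel:
  assumes b: "labelling L b" "labelling L b'" and f: "f \<in> ops (card L + 1)"
  obtains \<sigma> where "\<sigma> permutes {1..card L + 1}"
    "\<And>v. act (card L + 1) f b v = act (card L + 1) (sact F (card L + 1) \<sigma> f) b' v"
proof -
  obtain \<sigma> where s: "\<sigma> permutes {1..card L + 1}" "\<And>a. a \<in> {1..card L + 1} \<Longrightarrow> b a = (b' \<circ> \<sigma>) a"
    using labelling_permute[OF b] by blast
  have n: "1 \<le> card L + 1" by simp
  have "act (card L + 1) f b v = act (card L + 1) (sact F (card L + 1) \<sigma> f) b' v" for v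
    unfolding act_sact[OF n s(1) f] by (rule act_cong[OF n f s(2)])
  then show thesis using that s(1) by blast
qed

text \<open>The product of the comb algebra: inserting the operation behind \<open>v\<close> at the
  marked input of \<open>f\<close> adds up the multidegrees.\<close>

lemma act_M:
  assumes f: "f \<in> ops (card L + 1)" and b: "labelling L b"
    and A: "finite A" "0 \<notin> A" "L \<inter> A = {}" and v: "v \<in> M A"
  shows "act (card L + 1) f b v \<in> M (L \<union> A)"
proof -
  let ?m = "card L + 1" and ?n = "card A + 1"
  have mn: "1 \<le> ?m" "1 \<le> ?n" by auto
  have L: "finite L" "0 \<notin> L" using b by (auto simp: labelling_def)
  let ?b = "std_labelling L" and ?c = "std_labelling A"
  obtain \<sigma> where \<sigma>: "\<sigma> permutes {1..?m}" "\<And>v. act ?m f b v = act ?m (sact F ?m \<sigma> f) ?b v"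
    using act_relabel[OF b std_labelling(1)[OF L] f] by blast
  define f' where "f' = sact F ?m \<sigma> f"
  have f': "f' \<in> ops ?m" unfolding f'_def using F_sact[OF mn(1) \<sigma>(1) f] .
  obtain g where g: "g \<in> ops ?n" "v = act ?n g ?c (vac K)"
    using v unfolding M_def by blast
  show ?thesis
  \<comment> \<open>For empty \<open>A\<close> the inserted operation is unary, and composing with
    it is multiplication by a scalar, outside the scope of \<open>act_circ\<close>.\<close>
  proof (cases "A = {}")
    case True
    have vac: "vac K \<in> vecs K" by (rule vac_vecs[OF field_K])
    have g1: "g \<in> ops 1" "v = act 1 g ?c (vac K)" using g True by auto
    have "v = scal K (phi 1 g) \<odot>\<^bsub>V\<^esub> vac K"
      unfolding g1(2) using act_unary[of g ?c "vac K"] g1(1) std_labelling(2)[OF A(1,2)] vac by blast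
    then have "act ?m f b v = scal K (phi 1 g) \<odot>\<^bsub>V\<^esub> act ?m f' ?b (vac K)"
      unfolding \<sigma>(2) f'_def[symmetric] using act_smult_vec[OF mn(1) f' scal_phi_closed[OF g1(1)] vac] by simp
    moreover have "act ?m f' ?b (vac K) \<in> M L" unfolding M_def using f' by blast
    ultimately show ?thesis
      using V.subspace_smult[OF subspace_M scal_phi_closed[OF g1(1)]] True by simp
  next
    case False
    then have n1: "?n \<noteq> 1" using A by simp
    define d where "d a = (if a \<le> card A + 1 then ?c a else ?b (a - card A))" for a
    have d: "labelling (L \<union> A) d" "\<And>a. a \<in> {1..?m} \<Longrightarrow> col 1 ?n d a = ?b a"
      "\<And>a. a \<in> {1..?n} \<Longrightarrow> blk 1 d a = ?c a"
      using labelling_insert[OF std_labelling(1)[OF L] std_labelling(1)[OF A(1,2)] A(3) std_labelling(2)[OF L]]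
      unfolding d_def by blast+
    have card: "card (L \<union> A) + 1 = ?m + ?n - 1" using L A by (simp add: card_Un_disjoint)
    have one: "1 \<in> {1..?m}" by simp
    let ?h = "circ F ?m ?n 1 f' g"
    have h: "?h \<in> ops (card (L \<union> A) + 1)"
      unfolding card by (rule F_circ[OF mn one f' g(1)])
    have "act (card (L \<union> A) + 1) ?h d (vac K) = act ?m f' (col 1 ?n d) (act ?n g (blk 1 d) (vac K))"
      unfolding card by (rule act_circ[OF mn n1 one f' g(1)])
    also have "act ?n g (blk 1 d) (vac K) = v"
      unfolding g(2) by (rule act_cong[OF mn(2) g(1) d(3)])
    also have "act ?m f' (col 1 ?n d) v = act ?m f' ?b v"
      by (rule act_cong[OF mn(1) f' d(2)])
    finally have eq: "act ?m f b v = act (card (L \<union> A) + 1) ?h d (vac K)"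
      unfolding \<sigma>(2) f'_def by simp
    have "finite (L \<union> A)" "0 \<notin> L \<union> A" using L A by auto
    note std = std_labelling(1)[OF this]
    obtain \<tau> where "\<tau> permutes {1..card (L \<union> A) + 1}"
      "\<And>v. act (card (L \<union> A) + 1) ?h d v
        = act (card (L \<union> A) + 1) (sact F (card (L \<union> A) + 1) \<tau> ?h) (std_labelling (L \<union> A)) v"
      using act_relabel[OF d(1) std h] by blast
    then show ?thesis
      unfolding eq M_def using F_sact[OF _ _ h] by auto
  qed
qed

text \<open>\<open>J\<close> is the part of the ideal generated by the relations: rule \<open>comps\<close> puts a generator in front
  of elements of \<open>J\<close>, rule \<open>rel\<close> a relation in front of anything.\<close>

definition tail_at :: "nat set \<Rightarrow> nat \<Rightarrow> 'k vec \<Rightarrow> 'k vec" where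
  "tail_at B j v = (\<lambda>w. v ((B, j) # w))"

text \<open>The letters that can start a word of multidegree \<open>L\<close>.\<close>

definition letter :: "nat set \<Rightarrow> nat set \<Rightarrow> nat \<Rightarrow> bool" where
  "letter L B j \<longleftrightarrow> B \<subseteq> L \<and> B \<noteq> {} \<and> j < xd (card B + 1)"

inductive J :: "nat set \<Rightarrow> 'k vec \<Rightarrow> bool" where
  zero: "J L \<zero>\<^bsub>V\<^esub>"
| add: "\<lbrakk>J L v; J L v'\<rbrakk> \<Longrightarrow> J L (v \<oplus>\<^bsub>V\<^esub> v')"
| smult: "\<lbrakk>c \<in> carrier K; J L v\<rbrakk> \<Longrightarrow> J L (c \<odot>\<^bsub>V\<^esub> v)"
| comps: "\<lbrakk>v \<in> vecs K; v [] = \<zero>; \<And>B j. letter L B j \<Longrightarrow> J (L - B) (tail_at B j v);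
    \<And>B j. \<not> letter L B j \<Longrightarrow> tail_at B j v = \<zero>\<^bsub>V\<^esub>\<rbrakk> \<Longrightarrow> J L v"
| rel: "\<lbrakk>B \<subseteq> L; B \<noteq> {}; r \<in> R (card B + 1); v \<in> M (L - B)\<rbrakk>
    \<Longrightarrow> J L (act (card B + 1) r (std_labelling B) v)"

text \<open>In the Golod-Shafarevich decomposition of the ideal of relations as
  \<open>X J + R M\<close>, this is the summand \<open>X J\<close>: every tail lies in
  \<open>J\<close> already.\<close>

definition W :: "nat set \<Rightarrow> 'k vec set" where
  "W L = {v \<in> vecs K. v [] = \<zero> \<and> (\<forall>B j. letter L B j \<longrightarrow> J (L - B) (tail_at B j v)) \<and>
     (\<forall>B j. \<not> letter L B j \<longrightarrow> tail_at B j v = \<zero>\<^bsub>V\<^esub>)}"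

lemma W_J: "v \<in> W L \<Longrightarrow> J L v"
  unfolding W_def mem_Collect_eq by (elim conjE, rule J.comps) blast+

lemma R_subspace: "1 \<le> n \<Longrightarrow> VectorSpace.subspace K (R n) (cpt F n)"
  using R by (simp add: sub_s_module_def)

lemma R_carrier: "1 \<le> n \<Longrightarrow> R n \<subseteq> ops n"
  using vectorspace.subspace_carrier[OF F.vectorspace_cpt R_subspace] by blast

lemma J_vecs: "J L v \<Longrightarrow> v \<in> vecs K"
proof (induction rule: J.induct)
  case (rel B L r v)
  then show ?case using R_carrier[of "card B + 1"] by (intro act_closed) auto
qed (auto simp: fun_simps vecs_def)

lemma subspace_J: "VectorSpace.subspace K {v. J L v} V"
  using J_vecs fun_simps by (intro V.subspaceI) (auto intro: J.zero J.add J.smult)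

lemma tail_at_hom: "tail_at B j \<in> LinearCombinations.module_hom K V V"
  unfolding LinearCombinations.module_hom_def by (auto simp: fun_simps tail_at_def vecs_def)

lemma tail_at_lin:
  "tail_at B j \<zero>\<^bsub>V\<^esub> = \<zero>\<^bsub>V\<^esub>"
  "tail_at B j (v \<oplus>\<^bsub>V\<^esub> v') = tail_at B j v \<oplus>\<^bsub>V\<^esub> tail_at B j v'"
  "tail_at B j (c \<odot>\<^bsub>V\<^esub> v) = c \<odot>\<^bsub>V\<^esub> tail_at B j v"
  by (simp_all add: fun_simps tail_at_def)

lemma subspace_W: "VectorSpace.subspace K (W L) V"
proof (rule V.subspaceI)
  show "W L \<subseteq> carrier V" unfolding W_def fun_simps by blast
  have "(\<zero>\<^bsub>V\<^esub> :: 'k vec) \<in> vecs K" "(\<zero>\<^bsub>V\<^esub> :: 'k vec) [] = \<zero>"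
    by (simp_all add: fun_simps vecs_def)
  then show "\<zero>\<^bsub>V\<^esub> \<in> W L"
    unfolding W_def by (simp add: tail_at_lin J.zero)
  show "v \<oplus>\<^bsub>V\<^esub> v' \<in> W L" if "v \<in> W L" "v' \<in> W L" for v v'
    using that unfolding W_def by (auto simp: tail_at_lin intro: J.add) (auto simp: fun_simps vecs_def)
  show "c \<odot>\<^bsub>V\<^esub> v \<in> W L" if "c \<in> carrier K" "v \<in> W L" for c v
    using that unfolding W_def by (auto simp: tail_at_lin intro: J.smult) (auto simp: fun_simps vecs_def)
qed

lemma gen_op_labelling:
  assumes b: "labelling L b" and v: "v \<in> vecs K"
  shows "gen_op (card L + 1) y (b, v, w) = (case w of [] \<Rightarrow> \<zero> | (B, j) # w' \<Rightarrow>
       if B = L \<and> j < xd (card L + 1) then crd (card L + 1) j (sact X (card L + 1) (standardize (card L + 1) b) y) \<otimes> v w' else \<zero>)"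
proof -
  have im: "b ` {1..card L + 1} = insert 0 L" and inj: "inj_on b {1..card L + 1}" and L0: "0 \<notin> L"
    using b by (auto simp: labelling_def bij_betw_def)
  have L: "insert 0 L - {0} = L" using L0 by auto
  show ?thesis unfolding gen_op_def prod.case im L using v inj by simp
qed

text \<open>A proper operation acts by prepending at least one letter, and what follows the first
  letter stays in \<open>J\<close>. For a composite of two proper operations, the inner one takes
  \<open>J\<close> into \<open>W\<close>, hence into \<open>J\<close>, and the outer one takes that
  into \<open>W\<close>.\<close>

lemma act_J:
  assumes f: "f \<in> ops (card L + 1)" and L: "labelling L b" "L \<noteq> {}" "L \<inter> A = {}"
    and v: "J A v"
  shows "act (card L + 1) f b v \<in> W (L \<union> A)"
proof -
  \<comment> \<open>Arity 1 is exempt: there operations act by scalars and need not move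
    \<open>J\<close> into \<open>W\<close>. A composite of higher arity has at least one proper
    factor, and a unary factor only multiplies by a scalar.\<close>
  define Q where "Q m f \<longleftrightarrow> m = 1 \<or> (\<forall>L b A v. card L + 1 = m \<longrightarrow> labelling L b \<longrightarrow> L \<inter> A = {} \<longrightarrow>
    J A v \<longrightarrow> act m f b v \<in> W (L \<union> A))" for m f
  have QI: "Q m f" if "\<And>L b A v. \<lbrakk>m \<noteq> 1; card L + 1 = m; labelling L b; L \<inter> A = {}; J A v\<rbrakk>
      \<Longrightarrow> act m f b v \<in> W (L \<union> A)" for m f
    using that unfolding Q_def by blast
  have QD: "act m f b v \<in> W (L \<union> A)" if "Q m f" "m \<noteq> 1" "card L + 1 = m" "labelling L b" "L \<inter> A = {}" "J A v"
    for m f L b A v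
    using that unfolding Q_def by blast
  have "Q n f" if "f \<in> ops n" for n f
    using X that
  proof (induction rule: free_operad_induct)
    case (gen n y)
    show ?case
    proof (rule QI)
      fix L b A v assume n1: "n \<noteq> 1" and n: "card L + 1 = n" and b: "labelling L b" "L \<inter> A = {}" and v: "J A v"
      have L: "L \<noteq> {}" using n n1 by auto
      have inj: "inj_on b {1..n}" using b n by (auto simp: labelling_def bij_betw_def)
      have vv: "v \<in> vecs K" using J_vecs v by blast
      let ?k = "\<lambda>j. crd n j (sact X n (standardize n b) y)"
      have k: "?k j \<in> carrier K" for j by (rule crd_closed[OF gen(1) std_closed[OF gen(1) inj gen(2)]])
      let ?u = "act n (free_gen K X n y) b v"
      have u: "?u w = (case w of [] \<Rightarrow> \<zero> | (B, j) # w' \<Rightarrow>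
          if B = L \<and> j < xd n then ?k j \<otimes> v w' else \<zero>)" for w
        unfolding act_def phi_gen[OF gen] by (rule gen_op_labelling[OF b(1) vv, of y w, unfolded n])
      have c: "tail_at B j ?u = (if B = L \<and> j < xd n then ?k j \<odot>\<^bsub>V\<^esub> v else \<zero>\<^bsub>V\<^esub>)" for B j
        unfolding tail_at_def u by (auto simp: fun_simps)
      have "?u \<in> vecs K" unfolding vecs_def u using k vv by (auto simp: vecs_def split: list.splits)
      moreover have "?u [] = \<zero>" unfolding u by simp
      moreover have "J (L \<union> A - B) (tail_at B j ?u)" for B j
      proof (cases "B = L")
        case True
        then have "L \<union> A - B = A" using b by auto
        then show ?thesis unfolding c using J.smult[OF k v] J.zero by simp
      next
        case False
        then show ?thesis unfolding c using J.zero by simp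
      qed
      moreover have "tail_at B j ?u = \<zero>\<^bsub>V\<^esub>" if "\<not> letter (L \<union> A) B j" for B j
        using that n L unfolding c letter_def by auto
      ultimately show "?u \<in> W (L \<union> A)" unfolding W_def by blast
    qed
  next
    case unit
    show ?case by (simp add: Q_def)
  next
    case (zero n)
    show ?case by (rule QI) (simp add: act_zero_op[OF zero] V.subspace_zero[OF subspace_W])
  next
    case (add n f g)
    show ?case
      by (rule QI) (simp add: act_add_op[OF add(1-3)] V.subspace_add[OF subspace_W] QD[OF add(4)] QD[OF add(5)])
  next
    case (smult n c f)
    show ?case
      by (rule QI) (simp add: act_smult_op[OF smult(1-3)] V.subspace_smult[OF subspace_W] smult(2) QD[OF smult(4)])
  next
    case (act n \<sigma> f)
    show ?case
    proof (rule QI)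
      fix L b A v assume *: "n \<noteq> 1" "card L + 1 = n" "labelling L b" "L \<inter> A = {}" "J A v"
      then have "labelling L (b \<circ> \<sigma>)" using act(2) by (intro labelling_comp) auto
      then show "act n (sact F n \<sigma> f) b v \<in> W (L \<union> A)"
        unfolding act_sact[OF act(1-3)] using QD[OF act(4)] * by blast
    qed
  next
    case (circ m n i f g)
    show ?case
    proof (rule QI)
      fix L b A v assume *: "m + n - 1 \<noteq> 1" "card L + 1 = m + n - 1" "labelling L b" "L \<inter> A = {}" "J A v"
      consider "n = 1" | "n \<noteq> 1" "m = 1" | "n \<noteq> 1" "m \<noteq> 1" by blast
      then show "act (m + n - 1) (circ F m n i f g) b v \<in> W (L \<union> A)"
      proof cases
        case 1
        then have g: "g \<in> ops 1" and m: "m + n - 1 = m" using circ by auto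
        have "act m f b v \<in> W (L \<union> A)" by (rule QD[OF circ(6)]) (use * m in auto)
        then show ?thesis
          unfolding m unfolding 1 act_circ_unary_right[OF circ(1,3,4) g]
          by (rule V.subspace_smult[OF subspace_W scal_phi_closed[OF g]])
      next
        case 2
        then have f: "f \<in> ops 1" and n: "m + n - 1 = n" and i: "i = 1" using circ by auto
        have "act n g b v \<in> W (L \<union> A)" by (rule QD[OF circ(7)]) (use * n in auto)
        then show ?thesis
          unfolding n unfolding 2 i act_circ_unary_left[OF circ(2) f circ(5)]
          by (rule V.subspace_smult[OF subspace_W scal_phi_closed[OF f]])
      next
        case 3
        note eq = act_circ[OF circ(1,2) 3(1) circ(3-5), of b v]
        show ?thesis
        proof (cases "marked n (blk i b)")
          case False
          show ?thesis
            unfolding eq act_unmarked[OF circ(2,5) False] act_zero_vec[OF circ(1,4)]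
            by (rule V.subspace_zero[OF subspace_W])
        next
          case True
          obtain B C where BC: "L = B \<union> C" "B \<inter> C = {}" "card B + 1 = m" "card C + 1 = n"
            "labelling B (col i n b)" "labelling C (blk i b)"
            using labelling_split[OF *(3,2) circ(3,2) True] by blast
          have "act n g (blk i b) v \<in> W (C \<union> A)"
            by (rule QD[OF circ(7) 3(1) BC(4,6) _ *(5)]) (use *(4) BC(1) in auto)
          then have JC: "J (C \<union> A) (act n g (blk i b) v)" by (rule W_J)
          have "act m f (col i n b) (act n g (blk i b) v) \<in> W (B \<union> (C \<union> A))"
            by (rule QD[OF circ(6) 3(2) BC(3,5) _ JC]) (use *(4) BC(1,2) in auto)
          then show ?thesis unfolding eq BC(1) by (simp only: Un_assoc)
        qed
      qed
    qed
  qed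
  then have "Q (card L + 1) f" using f by blast
  moreover have "card L + 1 \<noteq> 1" using L by (auto simp: labelling_def)
  ultimately show ?thesis using QD L v by blast
qed

definition Ann :: "nat \<Rightarrow> ('k, 'x) opexp set set" where
  "Ann n = {f \<in> ops n. (n = 1 \<longrightarrow> f = \<zero>\<^bsub>cpt F n\<^esub>) \<and>
     (\<forall>L b A v. card L + 1 = n \<longrightarrow> labelling L b \<longrightarrow> finite A \<longrightarrow> 0 \<notin> A \<longrightarrow> L \<inter> A = {} \<longrightarrow>
        v \<in> M A \<longrightarrow> J (L \<union> A) (act n f b v))}"

lemma AnnI:
  assumes "f \<in> ops n" "n = 1 \<Longrightarrow> f = \<zero>\<^bsub>cpt F n\<^esub>"
    "\<And>L b A v. \<lbrakk>card L + 1 = n; labelling L b; finite A; 0 \<notin> A; L \<inter> A = {}; v \<in> M A\<rbrakk>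
      \<Longrightarrow> J (L \<union> A) (act n f b v)"
  shows "f \<in> Ann n"
  using assms unfolding Ann_def by blast

lemma AnnD:
  assumes "f \<in> Ann n"
  shows "f \<in> ops n" "n = 1 \<Longrightarrow> f = \<zero>\<^bsub>cpt F n\<^esub>"
    "\<lbrakk>card L + 1 = n; labelling L b; finite A; 0 \<notin> A; L \<inter> A = {}; v \<in> M A\<rbrakk>
      \<Longrightarrow> J (L \<union> A) (act n f b v)"
  using assms unfolding Ann_def by blast+

lemma subspace_Ann:
  assumes n: "1 \<le> n"
  shows "VectorSpace.subspace K (Ann n) (cpt F n)"
proof -
  interpret N: vectorspace K "cpt F n" by (rule F.vectorspace_cpt[OF n])
  show ?thesis
  proof (rule N.subspaceI)
    show "Ann n \<subseteq> ops n" using AnnD(1) by blast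
    show "\<zero>\<^bsub>cpt F n\<^esub> \<in> Ann n"
      by (rule AnnI) (simp_all add: act_zero_op[OF n] J.zero)
  next
    fix f g assume fg: "f \<in> Ann n" "g \<in> Ann n"
    show "f \<oplus>\<^bsub>cpt F n\<^esub> g \<in> Ann n"
    proof (rule AnnI)
      show "f \<oplus>\<^bsub>cpt F n\<^esub> g \<in> ops n" using AnnD(1)[OF fg(1)] AnnD(1)[OF fg(2)] by simp
      show "f \<oplus>\<^bsub>cpt F n\<^esub> g = \<zero>\<^bsub>cpt F n\<^esub>" if "n = 1"
        using AnnD(2)[OF fg(1) that] AnnD(2)[OF fg(2) that] by simp
    next
      fix L b A v assume *: "card L + 1 = n" "labelling L b" "finite A" "0 \<notin> A" "L \<inter> A = {}" "v \<in> M A"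
      show "J (L \<union> A) (act n (f \<oplus>\<^bsub>cpt F n\<^esub> g) b v)"
        unfolding act_add_op[OF n AnnD(1)[OF fg(1)] AnnD(1)[OF fg(2)]]
        by (rule J.add[OF AnnD(3)[OF fg(1) *] AnnD(3)[OF fg(2) *]])
    qed
  next
    fix c f assume c: "c \<in> carrier K" and f: "f \<in> Ann n"
    show "c \<odot>\<^bsub>cpt F n\<^esub> f \<in> Ann n"
    proof (rule AnnI)
      show "c \<odot>\<^bsub>cpt F n\<^esub> f \<in> ops n" using AnnD(1)[OF f] c by simp
      show "c \<odot>\<^bsub>cpt F n\<^esub> f = \<zero>\<^bsub>cpt F n\<^esub>" if "n = 1"
        using AnnD(2)[OF f that] c by simp
    next
      fix L b A v assume *: "card L + 1 = n" "labelling L b" "finite A" "0 \<notin> A" "L \<inter> A = {}" "v \<in> M A"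
      show "J (L \<union> A) (act n (c \<odot>\<^bsub>cpt F n\<^esub> f) b v)"
        unfolding act_smult_op[OF n c AnnD(1)[OF f]] by (rule J.smult[OF c AnnD(3)[OF f *]])
    qed
  qed
qed

lemma zero_Ann: "1 \<le> n \<Longrightarrow> \<zero>\<^bsub>cpt F n\<^esub> \<in> Ann n"
  using vectorspace.subspace_zero[OF F.vectorspace_cpt subspace_Ann] .

lemma sact_Ann:
  assumes n: "1 \<le> n" and \<sigma>: "\<sigma> permutes {1..n}" and f: "f \<in> Ann n"
  shows "sact F n \<sigma> f \<in> Ann n"
proof (rule AnnI)
  show "sact F n \<sigma> f \<in> ops n" by (rule F_sact[OF n \<sigma> AnnD(1)[OF f]])
  show "sact F n \<sigma> f = \<zero>\<^bsub>cpt F n\<^esub>" if "n = 1"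
    unfolding AnnD(2)[OF f that]
    by (rule module_hom_zero[OF F.vectorspace_cpt[OF n] F.vectorspace_cpt[OF n] F.sact_hom[OF n \<sigma>]])
next
  fix L b A v assume *: "card L + 1 = n" "labelling L b" "finite A" "0 \<notin> A" "L \<inter> A = {}" "v \<in> M A"
  have "labelling L (b \<circ> \<sigma>)" using *(1,2) \<sigma> by (intro labelling_comp) auto
  then show "J (L \<union> A) (act n (sact F n \<sigma> f) b v)"
    unfolding act_sact[OF n \<sigma> AnnD(1)[OF f]] using AnnD(3)[OF f *(1) _ *(3-6)] by blast
qed

text \<open>The inner operation keeps its argument inside the comb algebra by \<open>act_M\<close>,
  and \<open>f\<close> then sends it into \<open>J\<close>.\<close>

lemma circ_Ann_left:
  assumes m: "1 \<le> m" and n: "1 \<le> n" and i: "i \<in> {1..m}" and f: "f \<in> Ann m" and g: "g \<in> ops n"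
  shows "circ F m n i f g \<in> Ann (m + n - 1)"
proof (cases "m = 1")
  case True
  have mn: "1 \<le> m + n - 1" using m n by simp
  have "circ F m n i \<zero>\<^bsub>cpt F m\<^esub> g = \<zero>\<^bsub>cpt F (m + n - 1)\<^esub>"
    by (rule module_hom_zero[OF F.vectorspace_cpt[OF m] F.vectorspace_cpt[OF mn] F.circ_hom_left[OF m n i g]])
  then show ?thesis using zero_Ann[OF mn] AnnD(2)[OF f True] by simp
next
  case False
  note fc = AnnD(1)[OF f]
  show ?thesis
  proof (rule AnnI)
    show "circ F m n i f g \<in> ops (m + n - 1)" by (rule F_circ[OF m n i fc g])
    show "circ F m n i f g = \<zero>\<^bsub>cpt F (m + n - 1)\<^esub>" if "m + n - 1 = 1" using that False m n by simp
  next
    fix L b A v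
    assume *: "card L + 1 = m + n - 1" "labelling L b" "finite A" "0 \<notin> A" "L \<inter> A = {}" "v \<in> M A"
    show "J (L \<union> A) (act (m + n - 1) (circ F m n i f g) b v)"
    proof (cases "n = 1")
      case True
      then have g1: "g \<in> ops 1" and mn: "m + n - 1 = m" using g by auto
      show ?thesis
        unfolding mn unfolding True act_circ_unary_right[OF m i fc g1]
        by (rule J.smult[OF scal_phi_closed[OF g1] AnnD(3)[OF f _ *(2-6)]]) (use *(1) mn in simp)
    next
      case n1: False
      show ?thesis
      proof (cases "marked n (blk i b)")
        case False
        show ?thesis
          unfolding act_circ[OF m n n1 i fc g] act_unmarked[OF n g False] act_zero_vec[OF m fc]
          by (rule J.zero)
      next
        case True
        obtain B C where BC: "L = B \<union> C" "B \<inter> C = {}" "card B + 1 = m" "card C + 1 = n"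
          "labelling B (col i n b)" "labelling C (blk i b)"
          using labelling_split[OF *(2,1) i n True] by blast
        have CA: "C \<inter> A = {}" "B \<inter> (C \<union> A) = {}" "finite (C \<union> A)" "0 \<notin> C \<union> A"
          using BC *(3,4,5) by (auto simp: labelling_def)
        have "act (card C + 1) g (blk i b) v \<in> M (C \<union> A)"
          by (rule act_M[OF _ BC(6) *(3,4) CA(1) *(6)]) (use g BC(4) in simp)
        then have gM: "act n g (blk i b) v \<in> M (C \<union> A)" unfolding BC(4) .
        have "J (B \<union> (C \<union> A)) (act m f (col i n b) (act n g (blk i b) v))"
          by (rule AnnD(3)[OF f BC(3,5) CA(3,4,2) gM])
        then show ?thesis unfolding act_circ[OF m n n1 i fc g] BC(1) by (simp only: Un_assoc)
      qed
    qed
  qed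
qed

text \<open>The inner operation moves the comb algebra into \<open>J\<close>, and the outer one
  keeps it there by \<open>act_J\<close>.\<close>

lemma circ_Ann_right:
  assumes m: "1 \<le> m" and n: "1 \<le> n" and i: "i \<in> {1..m}" and f: "f \<in> ops m" and g: "g \<in> Ann n"
  shows "circ F m n i f g \<in> Ann (m + n - 1)"
proof (cases "n = 1")
  case True
  have mn: "1 \<le> m + n - 1" using m n by simp
  have "circ F m n i f \<zero>\<^bsub>cpt F n\<^esub> = \<zero>\<^bsub>cpt F (m + n - 1)\<^esub>"
    by (rule module_hom_zero[OF F.vectorspace_cpt[OF n] F.vectorspace_cpt[OF mn] F.circ_hom_right[OF m n i f]])
  then show ?thesis using zero_Ann[OF mn] AnnD(2)[OF g True] by simp
next
  case n1: False
  note gc = AnnD(1)[OF g]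
  show ?thesis
  proof (rule AnnI)
    show "circ F m n i f g \<in> ops (m + n - 1)" by (rule F_circ[OF m n i f gc])
    show "circ F m n i f g = \<zero>\<^bsub>cpt F (m + n - 1)\<^esub>" if "m + n - 1 = 1" using that n1 m n by simp
  next
    fix L b A v
    assume *: "card L + 1 = m + n - 1" "labelling L b" "finite A" "0 \<notin> A" "L \<inter> A = {}" "v \<in> M A"
    show "J (L \<union> A) (act (m + n - 1) (circ F m n i f g) b v)"
    proof (cases "m = 1")
      case True
      then have f1: "f \<in> ops 1" and mn: "m + n - 1 = n" and i1: "i = 1" using f i by auto
      show ?thesis
        unfolding mn unfolding True i1 act_circ_unary_left[OF n f1 gc]
        by (rule J.smult[OF scal_phi_closed[OF f1] AnnD(3)[OF g _ *(2-6)]]) (use *(1) mn in simp)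
    next
      case m1: False
      show ?thesis
      proof (cases "marked n (blk i b)")
        case False
        show ?thesis
          unfolding act_circ[OF m n n1 i f gc] act_unmarked[OF n gc False] act_zero_vec[OF m f]
          by (rule J.zero)
      next
        case True
        obtain B C where BC: "L = B \<union> C" "B \<inter> C = {}" "card B + 1 = m" "card C + 1 = n"
          "labelling B (col i n b)" "labelling C (blk i b)"
          using labelling_split[OF *(2,1) i n True] by blast
        have CA: "C \<inter> A = {}" "B \<inter> (C \<union> A) = {}" using BC *(5) by auto
        have B: "B \<noteq> {}" using BC(3) m1 by auto
        have "J (C \<union> A) (act n g (blk i b) v)"
          by (rule AnnD(3)[OF g BC(4,6) *(3,4) CA(1) *(6)])
        then have "act (card B + 1) f (col i n b) (act n g (blk i b) v) \<in> W (B \<union> (C \<union> A))"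
          using act_J[OF _ BC(5) B CA(2)] f BC(3) by blast
        then have "J (B \<union> (C \<union> A)) (act m f (col i n b) (act n g (blk i b) v))"
          unfolding BC(3) by (rule W_J)
        then show ?thesis unfolding act_circ[OF m n n1 i f gc] BC(1) by (simp only: Un_assoc)
      qed
    qed
  qed
qed

lemma R_Ann:
  assumes n: "1 \<le> n"
  shows "R n \<subseteq> Ann n"
proof
  fix r assume r: "r \<in> R n"
  then have rc: "r \<in> ops n" using R_carrier[OF n] by blast
  show "r \<in> Ann n"
  proof (cases "n = 1")
    case True
    then have "r = \<zero>\<^bsub>cpt F n\<^esub>" using r R1 by simp
    then show ?thesis using zero_Ann[OF n] by simp
  next
    case False
    show ?thesis
    proof (rule AnnI[OF rc])
      fix L b A v assume *: "card L + 1 = n" "labelling L b" "finite A" "0 \<notin> A" "L \<inter> A = {}" "v \<in> M A"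
      have L: "finite L" "0 \<notin> L" "L \<noteq> {}" using * False by (auto simp: labelling_def)
      have rc': "r \<in> ops (card L + 1)" using rc *(1) by simp
      obtain \<sigma> where \<sigma>: "\<sigma> permutes {1..card L + 1}"
        "\<And>v. act (card L + 1) r b v = act (card L + 1) (sact F (card L + 1) \<sigma> r) (std_labelling L) v"
        using act_relabel[OF *(2) std_labelling(1)[OF L(1,2)] rc'] by blast
      \<comment> \<open>Rule \<open>rel\<close> is stated for the standard labelling only; as
        \<open>R\<close> is stable under the symmetric groups, it covers all labellings.\<close>
      have "sact F (card L + 1) \<sigma> r \<in> R (card L + 1)"
        using R \<sigma>(1) r *(1) n unfolding sub_s_module_def by blast
      moreover have "L \<union> A - L = A" using *(5) by auto
      ultimately have "J (L \<union> A) (act (card L + 1) (sact F (card L + 1) \<sigma> r) (std_labelling L) v)"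
        using J.rel[of L "L \<union> A" "sact F (card L + 1) \<sigma> r" v] L *(6) by simp
      then show "J (L \<union> A) (act n r b v)" using \<sigma>(2) *(1) by simp
    qed (use False in simp)
  qed
qed

lemma ideal_Ann:
  assumes "1 \<le> n"
  shows "ideal_generated K F R n \<subseteq> Ann n"
proof -
  have "operad_ideal K F Ann"
    unfolding operad_ideal_def sub_s_module_def
    using subspace_Ann sact_Ann circ_Ann_left circ_Ann_right by blast
  then show ?thesis unfolding ideal_generated_def using R_Ann by blast
qed

section \<open>Dimensions of the comb algebra modulo the relations\<close>

lemma vac_M: "vac K \<in> M {}"
proof -
  have u: "ounit F \<in> ops 1" by (rule F.ounit_closed)
  have "phi 1 (ounit F) = ounit (comb_operad K)" using phi_hom by (simp add: operad_hom_def)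
  then have s: "scal K (phi 1 (ounit F)) = \<one>" using scal_ounit[OF field_K] by simp
  have "act 1 (ounit F) (std_labelling {}) (vac K) = \<one> \<odot>\<^bsub>V\<^esub> vac K"
    using act_unary[of "ounit F" "std_labelling {}" "vac K"] u std_labelling(2)[of "{}"] vac_vecs[OF field_K] s
    by simp
  also have "\<dots> = vac K" using vac_vecs[OF field_K] by (simp add: fun_simps vecs_def)
  finally show ?thesis unfolding M_def using u by force
qed

lemma act_module_hom:
  assumes n: "1 \<le> n"
  shows "(\<lambda>f. act n f b v) \<in> LinearCombinations.module_hom K (cpt F n) V"
  unfolding LinearCombinations.module_hom_def
  using act_closed[OF n] act_add_op[OF n] act_smult_op[OF n] by (auto simp: fun_simps(1))

text \<open>Evaluation of operations at the empty word sends the ideal of the relations into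
  \<open>J\<close>. So lifts of vectors that are independent modulo \<open>J\<close> are independent
  modulo the ideal, where \<open>bound\<close> applies.\<close>

lemma indep_bound:
  assumes L: "finite L" "0 \<notin> L" and u: "\<And>i. i < d \<Longrightarrow> u i \<in> M L"
    and indep: "V.indep_mod {v. J L v} u d"
  shows "d \<le> D (card L + 1)"
proof -
  let ?n = "card L + 1" and ?b = "std_labelling L"
  have n: "1 \<le> ?n" by simp
  interpret N: vectorspace K "cpt F ?n" by (rule F.vectorspace_cpt[OF n])
  have "\<forall>i. \<exists>f. i < d \<longrightarrow> f \<in> ops ?n \<and> u i = act ?n f ?b (vac K)"
    using u unfolding M_def by blast
  then obtain f where f: "\<And>i. i < d \<Longrightarrow> f i \<in> ops ?n" "\<And>i. i < d \<Longrightarrow> u i = act ?n (f i) ?b (vac K)"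
    by metis
  have "N.indep_mod (ideal_generated K F R ?n) f d"
    unfolding N.indep_mod_def
  proof (intro allI impI)
    fix c i assume c: "c \<in> {..<d} \<rightarrow> carrier K" and i: "i < d"
      and sum: "finsum (cpt F ?n) (\<lambda>i. c i \<odot>\<^bsub>cpt F ?n\<^esub> f i) {..<d} \<in> ideal_generated K F R ?n"
    have cf: "(\<lambda>i. c i \<odot>\<^bsub>cpt F ?n\<^esub> f i) \<in> {..<d} \<rightarrow> ops ?n"
      using c f(1) by (intro Pi_I F_smult[OF n]) auto
    have "J (L \<union> {}) (act ?n (finsum (cpt F ?n) (\<lambda>i. c i \<odot>\<^bsub>cpt F ?n\<^esub> f i) {..<d}) ?b (vac K))"
      using subsetD[OF ideal_Ann[OF n] sum] std_labelling(1)[OF L] vac_M by (intro AnnD(3)) auto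
    moreover have "act ?n (finsum (cpt F ?n) (\<lambda>i. c i \<odot>\<^bsub>cpt F ?n\<^esub> f i) {..<d}) ?b (vac K)
        = finsum V (\<lambda>i. act ?n (c i \<odot>\<^bsub>cpt F ?n\<^esub> f i) ?b (vac K)) {..<d}"
      using finsum_module_hom[OF F.vectorspace_cpt[OF n] V.vectorspace_axioms act_module_hom[OF n] _ cf]
      by simp
    moreover have "\<dots> = finsum V (\<lambda>i. c i \<odot>\<^bsub>V\<^esub> u i) {..<d}"
    proof (rule V.M.finsum_cong')
      fix i assume "i \<in> {..<d}"
      then have "c i \<in> carrier K" "i < d" using c by auto
      then show "act ?n (c i \<odot>\<^bsub>cpt F ?n\<^esub> f i) ?b (vac K) = c i \<odot>\<^bsub>V\<^esub> u i"
        using act_smult_op[OF n _ f(1)] f(2) by metis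
    next
      show "(\<lambda>i. c i \<odot>\<^bsub>V\<^esub> u i) \<in> {..<d} \<rightarrow> carrier V"
        using c u M_vecs[of L] by (intro Pi_I V.smult_closed) (auto simp: fun_simps(1))
    qed simp
    ultimately have "finsum V (\<lambda>i. c i \<odot>\<^bsub>V\<^esub> u i) {..<d} \<in> {v. J L v}" by simp
    then show "c i = \<zero>" using indep c i unfolding V.indep_mod_def by blast
  qed
  then show ?thesis using f(1) by (intro bound[OF n]) auto
qed

definition is_fam :: "nat set \<Rightarrow> nat \<times> (nat \<Rightarrow> 'k vec) \<Rightarrow> bool" where
  "is_fam L p \<longleftrightarrow> (\<forall>i<fst p. snd p i \<in> M L) \<and> V.indep_mod {v. J L v} (snd p) (fst p) \<and>
     M L \<subseteq> V.span_mod {v. J L v} (map (snd p) [0..<fst p])"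

text \<open>The dimension of the image of \<open>M L\<close> modulo \<open>J\<close>;
  \<open>fam L\<close> lifts a basis of that image.\<close>

definition dm :: "nat set \<Rightarrow> nat" where
  "dm L = fst (SOME p. is_fam L p)"

definition fam :: "nat set \<Rightarrow> nat \<Rightarrow> 'k vec" where
  "fam L = snd (SOME p. is_fam L p)"

lemma fam:
  assumes L: "finite L" "0 \<notin> L"
  shows "\<And>i. i < dm L \<Longrightarrow> fam L i \<in> M L" "V.indep_mod {v. J L v} (fam L) (dm L)"
    "M L \<subseteq> V.span_mod {v. J L v} (map (fam L) [0..<dm L])"
proof -
  have "M L \<subseteq> carrier V" using M_vecs fun_simps(1) by blast
  then have "\<exists>d u. (\<forall>i<d. u i \<in> M L) \<and> V.indep_mod {v. J L v} u d \<and> M L \<subseteq> V.span_mod {v. J L v} (map u [0..<d])"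
    using indep_bound[OF L] by (intro V.maximal_indep_mod[OF subspace_J]) auto
  then obtain d u where "(\<forall>i<d. u i \<in> M L) \<and> V.indep_mod {v. J L v} u d \<and>
      M L \<subseteq> V.span_mod {v. J L v} (map u [0..<d])" by (elim exE)
  then have "is_fam L (d, u)" unfolding is_fam_def fst_conv snd_conv .
  then have "is_fam L (SOME p. is_fam L p)" by (rule someI)
  then show "\<And>i. i < dm L \<Longrightarrow> fam L i \<in> M L" "V.indep_mod {v. J L v} (fam L) (dm L)"
    "M L \<subseteq> V.span_mod {v. J L v} (map (fam L) [0..<dm L])"
    unfolding is_fam_def dm_def fam_def by blast+
qed

lemma dm_le: "\<lbrakk>finite L; 0 \<notin> L\<rbrakk> \<Longrightarrow> dm L \<le> D (card L + 1)"
  using indep_bound fam by blast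

text \<open>In this degree there is no nonempty \<open>B\<close>, so rule \<open>rel\<close> cannot
  apply, and \<open>comps\<close> excludes the empty word. Hence the unit \<open>vac K\<close>
  survives modulo \<open>J\<close>.\<close>

lemma J_empty: "J {} v \<Longrightarrow> v [] = \<zero>"
proof (induction "{} :: nat set" v rule: J.induct)
  case zero
  then show ?case by (simp add: fun_simps)
next
  case (add v v')
  then show ?case by (simp add: fun_simps)
next
  case (smult c v)
  then show ?case by (simp add: fun_simps)
qed auto

lemma dm_empty: "1 \<le> dm {}"
proof (rule ccontr)
  assume "\<not> 1 \<le> dm {}"
  then have "M {} \<subseteq> {v. J {} v}" using fam(3)[of "{}"] by simp
  then have "vac K [] = \<zero>" using vac_M J_empty by blast
  then show False by (simp add: vac_def)
qed

text \<open>The inverse standardization compensates for the sorting that \<open>gen_op\<close>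
  performs, so that the generator contributes exactly the letter \<open>(B, j)\<close>. This makes
  \<open>tail_at B j\<close> a left inverse.\<close>

definition prepend :: "nat set \<Rightarrow> nat \<Rightarrow> 'k vec \<Rightarrow> 'k vec" where
  "prepend B j v = act (card B + 1) (free_gen K X (card B + 1)
     (sact X (card B + 1) (inv_into UNIV (standardize (card B + 1) (std_labelling B)))
       (bas (card B + 1) j))) (std_labelling B) v"

lemma
  assumes B: "finite B" "0 \<notin> B" and j: "j < xd (card B + 1)"
  shows prepend_M: "\<lbrakk>finite A; 0 \<notin> A; B \<inter> A = {}; v \<in> M A\<rbrakk> \<Longrightarrow> prepend B j v \<in> M (B \<union> A)"
    and tail_at_prepend: "\<lbrakk>v \<in> vecs K; i < xd (card C + 1)\<rbrakk>
      \<Longrightarrow> tail_at C i (prepend B j v) = (if B = C \<and> j = i then v else \<zero>\<^bsub>V\<^esub>)"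
proof -
  let ?n = "card B + 1" and ?b = "std_labelling B"
  have n: "1 \<le> ?n" by simp
  define \<sigma> where "\<sigma> = standardize ?n ?b"
  have b: "labelling B ?b" by (rule std_labelling(1)[OF B])
  then have "inj_on ?b {1..?n}" by (simp add: labelling_def bij_betw_def)
  then have \<sigma>: "\<sigma> permutes {1..?n}" unfolding \<sigma>_def by (rule standardize_permutes)
  note \<sigma>' = permutes_inv[OF \<sigma>]
  define y where "y = sact X ?n (inv_into UNIV \<sigma>) (bas ?n j)"
  have y: "y \<in> carrier (cpt X ?n)" unfolding y_def by (rule sact_closed[OF n \<sigma>' bas[OF n j]])
  have "sact X ?n \<sigma> y = sact X ?n (\<sigma> \<circ> inv_into UNIV \<sigma>) (bas ?n j)"
    unfolding y_def by (rule X.sact_comp[OF n \<sigma> \<sigma>' bas[OF n j], THEN HOL.sym])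
  also have "\<dots> = bas ?n j" unfolding permutes_inv_o(1)[OF \<sigma>] by (rule X.sact_id[OF n bas[OF n j]])
  finally have \<sigma>y: "sact X ?n \<sigma> y = bas ?n j" .
  have p: "prepend B j v = act ?n (free_gen K X ?n y) ?b v" for v
    by (simp only: prepend_def y_def \<sigma>_def)
  have g: "free_gen K X ?n y \<in> ops ?n"
    using s_module_hom_free_gen[OF X] y n
    unfolding s_module_hom_def LinearCombinations.module_hom_def by blast
  show "prepend B j v \<in> M (B \<union> A)" if "finite A" "0 \<notin> A" "B \<inter> A = {}" "v \<in> M A"
    unfolding p by (rule act_M[OF g b that])
  show "tail_at C i (prepend B j v) = (if B = C \<and> j = i then v else \<zero>\<^bsub>V\<^esub>)"
    if v: "v \<in> vecs K" and i: "i < xd (card C + 1)"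
  proof (rule ext)
    fix w
    have "tail_at C i (prepend B j v) w = gen_op ?n y (?b, v, (C, i) # w)"
      unfolding p tail_at_def act_def phi_gen[OF n y] ..
    also have "\<dots> = (if C = B \<and> i < xd ?n then crd ?n i (bas ?n j) \<otimes> v w else \<zero>)"
      unfolding gen_op_labelling[OF b v] \<sigma>_def[symmetric] \<sigma>y by simp
    also have "\<dots> = (if B = C \<and> j = i then v w else \<zero>)"
    proof (cases "C = B")
      case True
      then have "i < xd ?n" using i by simp
      then show ?thesis using crd_bas[OF n _ j] True v by (auto simp: vecs_def)
    qed auto
    finally show "tail_at C i (prepend B j v) w = (if B = C \<and> j = i then v else \<zero>\<^bsub>V\<^esub>) w"
      by (simp add: fun_simps)
  qed
qed

text \<open>Spanning relations times lifts of a basis: the second factors run over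
  \<open>fam\<close> only, since a relation applied to \<open>J\<close> falls into
  \<open>W\<close>.\<close>

definition rel_list :: "nat set \<Rightarrow> nat set \<Rightarrow> 'k vec list" where
  "rel_list L B = concat (map (\<lambda>r. map (\<lambda>k. act (card B + 1) r (std_labelling B) (fam (L - B) k))
     [0..<dm (L - B)]) (rs (card B + 1)))"

lemma length_rel_list: "length (rel_list L B) = length (rs (card B + 1)) * dm (L - B)"
  by (simp add: rel_list_def length_concat comp_def sum_list_triv)

text \<open>Beyond \<open>W\<close>, only rule \<open>rel\<close> adds to \<open>J\<close>, and it
  is bilinear in the relation and the vector. A vector of \<open>M\<close> is a combination of
  \<open>fam\<close> plus an element of \<open>J\<close>, and a relation maps the latter into
  \<open>W\<close>. The vectors \<open>fam L\<close> are on the list so that it also serves for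
  \<open>M L\<close> in \<open>dm_inequality\<close>.\<close>

lemma J_span:
  assumes L: "finite L" "0 \<notin> L"
    and ts: "set ts = fam L ` {..<dm L} \<union> (\<Union>B\<in>Pow L - {{}}. set (rel_list L B))"
  shows "set ts \<subseteq> carrier V" "J L v \<Longrightarrow> v \<in> V.span_mod (W L) ts"
proof -
  have sub: "finite (L - B)" "0 \<notin> L - B" for B using L by auto
  have rl: "set (rel_list L B) = (\<Union>r\<in>set (rs (card B + 1)).
      (\<lambda>k. act (card B + 1) r (std_labelling B) (fam (L - B) k)) ` {..<dm (L - B)})" for B
    by (simp add: rel_list_def atLeast0LessThan)
  have "set (rel_list L B) \<subseteq> vecs K" for B
    unfolding rl using act_closed[of "card B + 1"] rs[of "card B + 1"] by auto
  moreover have "fam L ` {..<dm L} \<subseteq> vecs K" using fam(1)[OF L] M_vecs by auto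
  ultimately show tsc: "set ts \<subseteq> carrier V" unfolding ts fun_simps(1) by blast
  let ?S = "V.span_mod (W L) ts"
  have S: "VectorSpace.subspace K ?S V" by (rule V.span_mod_subspace[OF subspace_W tsc])
  have WS: "W L \<subseteq> ?S" by (rule V.span_mod_base[OF subspace_W tsc])
  have tS: "set ts \<subseteq> ?S" by (rule V.span_mod_gen[OF subspace_W tsc])
  have rel: "act (card B + 1) r (std_labelling B) v \<in> ?S"
    if B: "B \<subseteq> L" "B \<noteq> {}" and r: "r \<in> R (card B + 1)" and v: "v \<in> M (L - B)" for B r v
  proof -
    let ?n = "card B + 1" and ?b = "std_labelling B"
    have n: "1 \<le> ?n" by simp
    have Bf: "finite B" "0 \<notin> B" using B L finite_subset by auto
    have b: "labelling B ?b" by (rule std_labelling(1)[OF Bf])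
    interpret N: vectorspace K "cpt F ?n" by (rule F.vectorspace_cpt[OF n])
    have rc: "r \<in> ops ?n" using R_carrier[OF n] r by blast
    have fam_S: "act ?n r ?b (fam (L - B) k) \<in> ?S" if k: "k < dm (L - B)" for k
    proof -
      \<comment> \<open>Linearity in the operation reduces \<open>r\<close> to the spanning
        relations.\<close>
      let ?T = "{f \<in> ops ?n. act ?n f ?b (fam (L - B) k) \<in> ?S}"
      have T: "VectorSpace.subspace K ?T (cpt F ?n)"
      proof (rule N.subspaceI)
        show "\<zero>\<^bsub>cpt F ?n\<^esub> \<in> ?T"
          using act_zero_op[OF n] V.subspace_zero[OF S] F_zero[OF n] by (simp only: mem_Collect_eq)
        show "f \<oplus>\<^bsub>cpt F ?n\<^esub> g \<in> ?T" if "f \<in> ?T" "g \<in> ?T" for f g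
          using that act_add_op[OF n, of f g] V.subspace_add[OF S] F_add[OF n] by (simp only: mem_Collect_eq)
        show "c \<odot>\<^bsub>cpt F ?n\<^esub> f \<in> ?T" if "c \<in> carrier K" "f \<in> ?T" for c f
          using that act_smult_op[OF n, of c f] V.subspace_smult[OF S] F_smult[OF n] by (simp only: mem_Collect_eq)
      qed blast
      have "set (rs ?n) \<subseteq> ?T"
      proof
        fix f assume f: "f \<in> set (rs ?n)"
        then have "act ?n f ?b (fam (L - B) k) \<in> set (rel_list L B)" unfolding rl using k by blast
        then have "act ?n f ?b (fam (L - B) k) \<in> ?S" using tS ts B by blast
        then show "f \<in> ?T" using rs[OF n] f by blast
      qed
      then have "N.span_mod {\<zero>\<^bsub>cpt F ?n\<^esub>} (rs ?n) \<subseteq> ?T"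
        using N.span_mod_least[OF T] N.subspace_zero[OF T] by blast
      then show ?thesis using R_span[OF n] r by blast
    qed
    \<comment> \<open>For a fixed relation, linearity in the vector reduces \<open>v\<close> to
      elements of \<open>J\<close>, which land in \<open>W\<close>, and to
      \<open>fam\<close>.\<close>
    let ?U = "{v \<in> carrier V. act ?n r ?b v \<in> ?S}"
    have U: "VectorSpace.subspace K ?U V"
    proof (rule V.subspaceI)
      show "\<zero>\<^bsub>V\<^esub> \<in> ?U"
        using act_zero_vec[OF n rc] V.subspace_zero[OF S] V.M.zero_closed by (simp only: mem_Collect_eq)
      show "v \<oplus>\<^bsub>V\<^esub> v' \<in> ?U" if "v \<in> ?U" "v' \<in> ?U" for v v'
        using that act_add_vec[OF n rc, of v v'] V.subspace_add[OF S] V.M.a_closed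
        by (simp only: mem_Collect_eq fun_simps(1))
      show "c \<odot>\<^bsub>V\<^esub> v \<in> ?U" if "c \<in> carrier K" "v \<in> ?U" for c v
        using that act_smult_vec[OF n rc, of c v] V.subspace_smult[OF S] V.smult_closed
        by (simp only: mem_Collect_eq fun_simps(1))
    qed blast
    have "{v. J (L - B) v} \<subseteq> ?U"
    proof
      fix v assume "v \<in> {v. J (L - B) v}"
      then have v: "J (L - B) v" by simp
      have "act ?n r ?b v \<in> W (B \<union> (L - B))" using act_J[OF rc b B(2) _ v] by blast
      moreover have "B \<union> (L - B) = L" using B by blast
      ultimately have "act ?n r ?b v \<in> ?S" using WS by auto
      then show "v \<in> ?U" using J_vecs[OF v] fun_simps(1) by blast
    qed
    moreover have "fam (L - B) k \<in> vecs K" if "k < dm (L - B)" for k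
      using fam(1)[OF sub that] M_vecs by blast
    then have "set (map (fam (L - B)) [0..<dm (L - B)]) \<subseteq> ?U"
      using fam_S by (auto simp: fun_simps(1))
    ultimately have "V.span_mod {v. J (L - B) v} (map (fam (L - B)) [0..<dm (L - B)]) \<subseteq> ?U"
      by (rule V.span_mod_least[OF U])
    then show ?thesis using fam(3)[OF sub, of B] v by blast
  qed
  show "v \<in> ?S" if "J L v"
  proof -
    have "L' = L \<Longrightarrow> v \<in> ?S" if "J L' v" for L' v
      using that
    proof (induction rule: J.induct)
      case (zero L')
      show ?case by (rule V.subspace_zero[OF S])
    next
      case (add L' v v')
      then show ?case using V.subspace_add[OF S] by blast
    next
      case (smult c L' v)
      then show ?case using V.subspace_smult[OF S] by blast
    next
      case (comps v L')
      then have "v \<in> W L" unfolding W_def by blast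
      then show ?case using WS by blast
    next
      case (rel B L' r v)
      then show ?case using \<open>\<And>B r v. \<lbrakk>B \<subseteq> L; B \<noteq> {}; r \<in> R (card B + 1); v \<in> M (L - B)\<rbrakk>
        \<Longrightarrow> act (card B + 1) r (std_labelling B) v \<in> ?S\<close> by blast
    qed
    then show ?thesis using that by blast
  qed
qed

text \<open>Prepending letters to the bases of smaller degrees yields vectors of \<open>M L\<close>,
  which lies in the span of \<open>W L\<close> and a list as long as the right-hand side. If there
  were more of them than entries of the list, a nontrivial combination would lie in
  \<open>W L\<close>; its tail at a suitable letter is a nontrivial combination of
  \<open>fam (L - B)\<close> inside \<open>J\<close>, against independence.\<close>

theorem dm_inequality:
  assumes L: "finite L" "0 \<notin> L"
  shows "(\<Sum>B\<in>Pow L - {{}}. xd (card B + 1) * dm (L - B))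
    \<le> dm L + (\<Sum>B\<in>Pow L - {{}}. length (rs (card B + 1)) * dm (L - B))"
proof (rule ccontr)
  assume neg: "\<not> ?thesis"
  have sub: "finite (L - B)" "0 \<notin> L - B" for B using L by auto
  have finP: "finite (Pow L - {{}})" using L by simp
  obtain Bl where Bl: "set Bl = Pow L - {{}}" "distinct Bl" using finite_distinct_list[OF finP] by blast
  define ts where "ts = map (fam L) [0..<dm L] @ concat (map (rel_list L) Bl)"
  have "set ts = fam L ` {..<dm L} \<union> (\<Union>B\<in>Pow L - {{}}. set (rel_list L B))"
    unfolding ts_def by (auto simp: Bl(1))
  note ts = J_span[OF L this]
  have len: "length ts = dm L + (\<Sum>B\<in>Pow L - {{}}. length (rs (card B + 1)) * dm (L - B))"
    unfolding ts_def using Bl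
    by (simp add: length_concat comp_def length_rel_list sum_list_distinct_conv_sum_set)
  define I where "I = Sigma (Pow L - {{}}) (\<lambda>B. {..<xd (card B + 1)} \<times> {..<dm (L - B)})"
  have finI: "finite I" unfolding I_def using finP by auto
  have cardI: "card I = (\<Sum>B\<in>Pow L - {{}}. xd (card B + 1) * dm (L - B))"
    unfolding I_def using finP by (subst card_SigmaI) (auto simp: card_cartesian_product)
  define u where "u = (\<lambda>(B, j, k). prepend B j (fam (L - B) k))"
  have Bf: "finite B" "0 \<notin> B" if "B \<subseteq> L" for B using that L finite_subset by auto
  have uM: "u p \<in> M L" if "p \<in> I" for p
  proof -
    obtain B j k where p: "p = (B, j, k)" by (cases p) auto
    then have B: "B \<subseteq> L" "j < xd (card B + 1)" "k < dm (L - B)" using that by (auto simp: I_def)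
    have "prepend B j (fam (L - B) k) \<in> M (B \<union> (L - B))"
      by (rule prepend_M[OF Bf[OF B(1)] B(2) sub _ fam(1)[OF sub B(3)]]) blast
    moreover have "B \<union> (L - B) = L" using B by blast
    ultimately show ?thesis by (simp add: u_def p)
  qed
  have "V.span_mod {v. J L v} (map (fam L) [0..<dm L]) \<subseteq> V.span_mod (W L) ts"
  proof (rule V.span_mod_least[OF V.span_mod_subspace[OF subspace_W ts(1)]])
    show "{v. J L v} \<subseteq> V.span_mod (W L) ts" using ts(2) by blast
    show "set (map (fam L) [0..<dm L]) \<subseteq> V.span_mod (W L) ts"
      using V.span_mod_gen[OF subspace_W ts(1)] by (auto simp: ts_def)
  qed
  then have uS: "u p \<in> V.span_mod (W L) ts" if "p \<in> I" for p
    using uM[OF that] fam(3)[OF L] by blast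
  have "length ts < card I" unfolding len cardI using neg by (rule not_le_imp_less)
  then have "\<exists>c. c \<in> I \<rightarrow> carrier K \<and> (\<exists>p\<in>I. c p \<noteq> \<zero>) \<and>
      finsum V (\<lambda>p. c p \<odot>\<^bsub>V\<^esub> u p) I \<in> W L"
    using V.relation_mod_exists[OF subspace_W ts(1) finI, where u = u] uS by simp
  then obtain c where c: "c \<in> I \<rightarrow> carrier K" "\<exists>p\<in>I. c p \<noteq> \<zero>"
    and cW: "finsum V (\<lambda>p. c p \<odot>\<^bsub>V\<^esub> u p) I \<in> W L"
    by (elim exE conjE)
  obtain B j k where Bjk: "(B, j, k) \<in> I" "c (B, j, k) \<noteq> \<zero>" using c(2) by auto
  then have B: "B \<subseteq> L" "B \<noteq> {}" "j < xd (card B + 1)" "k < dm (L - B)" by (auto simp: I_def)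
  have famv: "fam (L - C) i \<in> vecs K" if "i < dm (L - C)" for C i
    using fam(1)[OF sub that] M_vecs by blast
  \<comment> \<open>These are the indices with first letter \<open>(B, j)\<close>, chosen to include
    one with a nonzero coefficient; only they contribute to the tail at that letter.\<close>
  let ?K = "(\<lambda>k. (B, j, k)) ` {..<dm (L - B)}"
  have KI: "?K \<subseteq> I" using B by (auto simp: I_def)
  have cu: "(\<lambda>p. c p \<odot>\<^bsub>V\<^esub> u p) \<in> I \<rightarrow> carrier V"
    using c(1) uM M_vecs[of L] by (intro Pi_I V.smult_closed) (auto simp: fun_simps(1))
  have tail_u: "tail_at B j (u (C, i, l)) = (if C = B \<and> i = j then fam (L - C) l else \<zero>\<^bsub>V\<^esub>)"
    if "(C, i, l) \<in> I" for C i l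
    using that tail_at_prepend[OF Bf, of C i "fam (L - C) l" j B] famv[of l C] B(3)
    by (auto simp: I_def u_def)
  have cfam: "(\<lambda>k. c (B, j, k) \<odot>\<^bsub>V\<^esub> fam (L - B) k) \<in> {..<dm (L - B)} \<rightarrow> carrier V"
    using c(1) KI famv by (intro Pi_I V.smult_closed) (auto simp: fun_simps(1))
  have "tail_at B j (finsum V (\<lambda>p. c p \<odot>\<^bsub>V\<^esub> u p) I)
      = finsum V (\<lambda>p. tail_at B j (c p \<odot>\<^bsub>V\<^esub> u p)) I"
    by (rule finsum_module_hom[OF V.vectorspace_axioms V.vectorspace_axioms tail_at_hom finI cu])
  also have "\<dots> = finsum V (\<lambda>p. tail_at B j (c p \<odot>\<^bsub>V\<^esub> u p)) ?K"
  proof (rule V.M.add.finprod_mono_neutral_cong_right[OF finI KI])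
    show "tail_at B j (c p \<odot>\<^bsub>V\<^esub> u p) = \<zero>\<^bsub>V\<^esub>" if p: "p \<in> I - ?K" for p
    proof -
      obtain C i l where q: "p = (C, i, l)" by (cases p) auto
      have "\<not> (C = B \<and> i = j)" using p q by (auto simp: I_def)
      moreover have "c p \<in> carrier K" using c(1) p by blast
      ultimately show ?thesis using tail_u[of C i l] p q by (auto simp: tail_at_lin)
    qed
    show "(\<lambda>p. tail_at B j (c p \<odot>\<^bsub>V\<^esub> u p)) \<in> I \<rightarrow> carrier V"
      using cu tail_at_hom[of B j] by (auto simp: LinearCombinations.module_hom_def)
  qed simp
  also have "\<dots> = finsum V (\<lambda>k. tail_at B j (c (B, j, k) \<odot>\<^bsub>V\<^esub> u (B, j, k))) {..<dm (L - B)}"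
    using cu tail_at_hom[of B j] KI
    by (intro V.M.finsum_reindex) (auto simp: LinearCombinations.module_hom_def inj_on_def)
  also have "\<dots> = finsum V (\<lambda>k. c (B, j, k) \<odot>\<^bsub>V\<^esub> fam (L - B) k) {..<dm (L - B)}"
  proof (rule V.M.finsum_cong'[OF HOL.refl cfam])
    fix k assume "k \<in> {..<dm (L - B)}"
    then have "(B, j, k) \<in> I" using B by (auto simp: I_def)
    then show "tail_at B j (c (B, j, k) \<odot>\<^bsub>V\<^esub> u (B, j, k)) = c (B, j, k) \<odot>\<^bsub>V\<^esub> fam (L - B) k"
      using tail_u[of B j k] by (simp add: tail_at_lin)
  qed
  finally have eq: "tail_at B j (finsum V (\<lambda>p. c p \<odot>\<^bsub>V\<^esub> u p) I)
    = finsum V (\<lambda>k. c (B, j, k) \<odot>\<^bsub>V\<^esub> fam (L - B) k) {..<dm (L - B)}" .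
  have "letter L B j" using B by (simp add: letter_def)
  then have "J (L - B) (tail_at B j (finsum V (\<lambda>p. c p \<odot>\<^bsub>V\<^esub> u p) I))"
    using cW unfolding W_def by blast
  then have "finsum V (\<lambda>k. c (B, j, k) \<odot>\<^bsub>V\<^esub> fam (L - B) k) {..<dm (L - B)} \<in> {v. J (L - B) v}"
    unfolding eq by simp
  moreover have "(\<lambda>k. c (B, j, k)) \<in> {..<dm (L - B)} \<rightarrow> carrier K" using c(1) KI by auto
  ultimately have "c (B, j, k) = \<zero>"
    using fam(2)[OF sub, of B] B(4) unfolding V.indep_mod_def by blast
  then show False using Bjk(2) by blast
qed

end

section \<open>Finite operads\<close>

lemma (in vectorspace) dim_trivial:
  assumes "carrier V = {\<zero>\<^bsub>V\<^esub>}"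
  shows "dim = 0"
proof -
  have "dim \<le> card ({} :: 'c set)"
    using assms by (intro gen_ge_dim) (auto simp: span_empty)
  then show ?thesis by simp
qed

lemma span_mod_restrict:
  assumes V: "vectorspace K V" and A: "VectorSpace.subspace K A V"
  shows "vectorspace.span_mod K (V\<lparr>carrier := A\<rparr>) N ts = vectorspace.span_mod K V N ts"
proof -
  interpret V: vectorspace K V by (rule V)
  interpret W: vectorspace K "V\<lparr>carrier := A\<rparr>" by (rule V.subspace_is_vs[OF A])
  show ?thesis by (induction ts) simp_all
qed

text \<open>Each component is spanned by the projections of finitely many generators of the direct
  sum, and these have finite support, so nothing is left beyond some \<open>N\<close>.\<close>

lemma direct_sum_spanning:
  assumes Q: "s_module K Q" and fd: "vectorspace.fin_dim K (direct_sum_cpt Q)"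
  obtains ts N where "\<And>n. 1 \<le> n \<Longrightarrow> set (ts n) \<subseteq> carrier (cpt Q n)"
    "\<And>n. 1 \<le> n \<Longrightarrow> carrier (cpt Q n) = vectorspace.span_mod K (cpt Q n) {\<zero>\<^bsub>cpt Q n\<^esub>} (ts n)"
    "\<And>n. N \<le> n \<Longrightarrow> ts n = []"
proof -
  interpret Q: s_module K Q by (rule Q)
  let ?D = "direct_sum_cpt Q"
  interpret D: vectorspace K ?D by (rule vectorspace_direct_sum_cpt[OF Q])
  obtain A where A: "finite A" "A \<subseteq> carrier ?D" "D.span A = carrier ?D"
    using fd by (auto simp: D.fin_dim_def)
  obtain al where al: "set al = A" using finite_list[OF A(1)] by blast
  have mem: "f n \<in> carrier (cpt Q n)" if "f \<in> carrier ?D" "1 \<le> n" for f n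
    using that by (auto simp: direct_sum_cpt_def PiE_def)
  define N where "N = Suc (Max (insert 0 (\<Union>a\<in>A. {n \<in> {1..}. a n \<noteq> \<zero>\<^bsub>cpt Q n\<^esub>})))"
  have fin: "finite {n \<in> {1..}. a n \<noteq> \<zero>\<^bsub>cpt Q n\<^esub>}" if "a \<in> A" for a
    using subsetD[OF A(2) that] by (simp add: direct_sum_cpt_def)
  have zero: "a n = \<zero>\<^bsub>cpt Q n\<^esub>" if "a \<in> A" "1 \<le> n" "N \<le> n" for a n
  proof (rule ccontr)
    assume "a n \<noteq> \<zero>\<^bsub>cpt Q n\<^esub>"
    then have "n \<le> Max (insert 0 (\<Union>a\<in>A. {n \<in> {1..}. a n \<noteq> \<zero>\<^bsub>cpt Q n\<^esub>}))"
      using that fin A(1) by (intro Max_ge) auto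
    then show False using that by (simp add: N_def)
  qed
  define ts where "ts n = (if N \<le> n then [] else map (\<lambda>a. a n) al)" for n
  have span: "carrier (cpt Q n) = vectorspace.span_mod K (cpt Q n) {\<zero>\<^bsub>cpt Q n\<^esub>} (ts n)"
    and ts: "set (ts n) \<subseteq> carrier (cpt Q n)" if n: "1 \<le> n" for n
  proof -
    interpret V: vectorspace K "cpt Q n" by (rule Q.vectorspace_cpt[OF n])
    show ts: "set (ts n) \<subseteq> carrier (cpt Q n)"
      using mem[OF _ n] A(2) by (auto simp: ts_def al)
    have z: "VectorSpace.subspace K {\<zero>\<^bsub>cpt Q n\<^esub>} (cpt Q n)" by (rule V.subspaceI) auto
    let ?S = "V.span_mod {\<zero>\<^bsub>cpt Q n\<^esub>} (ts n)"
    have S: "VectorSpace.subspace K ?S (cpt Q n)" by (rule V.span_mod_subspace[OF z ts])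
    have AS: "a n \<in> ?S" if "a \<in> A" for a
    proof (cases "N \<le> n")
      case True
      then show ?thesis using zero[OF that n] V.subspace_zero[OF S] by simp
    next
      case False
      then have "a n \<in> set (ts n)" using that by (simp add: ts_def al)
      then show ?thesis using V.span_mod_gen[OF z ts] by blast
    qed
    let ?T = "{f \<in> carrier ?D. f n \<in> ?S}"
    have ap: "(f \<oplus>\<^bsub>?D\<^esub> g) n = f n \<oplus>\<^bsub>cpt Q n\<^esub> g n" "(c \<odot>\<^bsub>?D\<^esub> f) n = c \<odot>\<^bsub>cpt Q n\<^esub> f n"
      "\<zero>\<^bsub>?D\<^esub> n = \<zero>\<^bsub>cpt Q n\<^esub>" for f g c
      using n by (simp_all add: direct_sum_cpt_def)
    have T: "VectorSpace.subspace K ?T ?D"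
      by (rule D.subspaceI)
        (auto simp: ap V.subspace_zero[OF S] V.subspace_add[OF S] V.subspace_smult[OF S])
    then have "D.span A \<subseteq> ?T" using A(2) AS by (intro D.span_is_subset) auto
    then have DS: "f n \<in> ?S" if "f \<in> carrier ?D" for f using that A(3) by blast
    have "carrier (cpt Q n) \<subseteq> ?S"
    proof
      fix p assume p: "p \<in> carrier (cpt Q n)"
      define f where "f = (\<lambda>m\<in>{1..}. if m = n then p else \<zero>\<^bsub>cpt Q m\<^esub>)"
      have zc: "\<zero>\<^bsub>cpt Q m\<^esub> \<in> carrier (cpt Q m)" if "1 \<le> m" for m
      proof -
        interpret M: vectorspace K "cpt Q m" by (rule Q.vectorspace_cpt[OF that])
        show ?thesis by simp
      qed
      have "finite {m \<in> {1..}. f m \<noteq> \<zero>\<^bsub>cpt Q m\<^esub>}"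
        by (rule finite_subset[of _ "{n}"]) (auto simp: f_def)
      then have "f \<in> carrier ?D" using p zc by (auto simp: direct_sum_cpt_def f_def)
      then have "f n \<in> ?S" by (rule DS)
      then show "p \<in> ?S" using n by (simp add: f_def)
    qed
    then show "carrier (cpt Q n) = ?S" using V.subspace_carrier[OF S] by blast
  qed
  show thesis by (rule that[OF ts span, of N]) (simp_all add: ts_def)
qed

text \<open>If \<open>m + n - 1\<close> is at most \<open>n0\<close> and both arities exceed 1, then
  both are below \<open>n0\<close>, where there is only zero. So no composite of two proper
  operations survives up to arity \<open>n0\<close>.\<close>

lemma free_operad_low_arity:
  assumes X: "s_module K X" and n0: "2 \<le> n0"
    and low: "\<And>m. \<lbrakk>1 \<le> m; m < n0\<rbrakk> \<Longrightarrow> carrier (cpt X m) = {\<zero>\<^bsub>cpt X m\<^esub>}"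
    and f: "f \<in> carrier (cpt (free_operad K X) n)" and n: "n \<le> n0"
  shows "f \<in> (if n = 1 then {c \<odot>\<^bsub>cpt (free_operad K X) 1\<^esub> ounit (free_operad K X) | c. c \<in> carrier K}
    else if n = n0 then free_gen K X n ` carrier (cpt X n) else {\<zero>\<^bsub>cpt (free_operad K X) n\<^esub>})"
proof -
  interpret X: s_module K X by (rule X)
  let ?F = "free_operad K X"
  interpret F: operad K ?F by (rule operad_free_operad[OF X])
  define T where "T n = (if n = 1 then {c \<odot>\<^bsub>cpt ?F 1\<^esub> ounit ?F | c. c \<in> carrier K}
    else if n = n0 then free_gen K X n ` carrier (cpt X n) else {\<zero>\<^bsub>cpt ?F n\<^esub>})" for n
  have gh: "free_gen K X n \<in> LinearCombinations.module_hom K (cpt X n) (cpt ?F n)" if "1 \<le> n" for n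
    using s_module_hom_free_gen[OF X] that by (simp add: s_module_hom_def)
  have g0: "free_gen K X n \<zero>\<^bsub>cpt X n\<^esub> = \<zero>\<^bsub>cpt ?F n\<^esub>" if "1 \<le> n" for n
    by (rule module_hom_zero[OF X.vectorspace_cpt F.vectorspace_cpt gh]) fact+
  have T: "VectorSpace.subspace K (T n) (cpt ?F n)" if n: "1 \<le> n" for n
  proof -
    interpret V: vectorspace K "cpt ?F n" by (rule F.vectorspace_cpt[OF n])
    interpret W: vectorspace K "cpt X n" by (rule X.vectorspace_cpt[OF n])
    consider "n = 1" | "n \<noteq> 1" "n = n0" | "n \<noteq> 1" "n \<noteq> n0" by blast
    then show ?thesis
    proof cases
      case 1
      have u: "set [ounit ?F] \<subseteq> carrier (cpt ?F n)" using F.ounit_closed 1 by simp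
      have z: "VectorSpace.subspace K {\<zero>\<^bsub>cpt ?F n\<^esub>} (cpt ?F n)" by (rule V.subspaceI) auto
      have "v \<in> V.span_mod {\<zero>\<^bsub>cpt ?F n\<^esub>} [ounit ?F]
          \<longleftrightarrow> (\<exists>c\<in>carrier K. v = \<zero>\<^bsub>cpt ?F n\<^esub> \<oplus>\<^bsub>cpt ?F n\<^esub> c \<odot>\<^bsub>cpt ?F n\<^esub> ounit ?F)" for v
        by auto
      moreover have "v \<in> T n \<longleftrightarrow> (\<exists>c\<in>carrier K. v = c \<odot>\<^bsub>cpt ?F n\<^esub> ounit ?F)" for v
        using 1 by (auto simp: T_def)
      ultimately have "v \<in> T n \<longleftrightarrow> v \<in> V.span_mod {\<zero>\<^bsub>cpt ?F n\<^esub>} [ounit ?F]" for v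
        using u by (simp del: V.span_mod.simps)
      then have "T n = V.span_mod {\<zero>\<^bsub>cpt ?F n\<^esub>} [ounit ?F]" by blast
      then show ?thesis using V.span_mod_subspace[OF z u] by simp
    next
      case 2
      interpret H: linear_map K "cpt X n" "cpt ?F n" "free_gen K X n"
        using gh[OF n] V.vectorspace_axioms W.vectorspace_axioms
        by (auto simp: linear_map_def mod_hom_def mod_hom_axioms_def vectorspace_def)
      have "T n = free_gen K X n ` carrier (cpt X n)" using 2 by (simp add: T_def)
      then have "T n = H.im" by (simp only: H.im_def)
      then show ?thesis using H.imT_is_subspace by simp
    next
      case 3
      then have "T n = {\<zero>\<^bsub>cpt ?F n\<^esub>}" by (simp add: T_def)
      then show ?thesis by (auto intro: V.subspaceI)
    qed
  qed
  have zeroT: "\<zero>\<^bsub>cpt ?F n\<^esub> \<in> T n" if "1 \<le> n" for n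
    using vectorspace.subspace_zero[OF F.vectorspace_cpt T] that by blast
  have smultT: "c \<odot>\<^bsub>cpt ?F n\<^esub> f \<in> T n" if "1 \<le> n" "c \<in> carrier K" "f \<in> T n" for n c f
    using vectorspace.subspace_smult[OF F.vectorspace_cpt T] that by blast
  have "n \<le> n0 \<longrightarrow> f \<in> T n"
    using X f
  proof (induction rule: free_operad_induct)
    case (gen n x)
    show ?case
    proof (cases "n < n0")
      case True
      then have "x = \<zero>\<^bsub>cpt X n\<^esub>" using low[OF gen(1)] gen(2) by blast
      then show ?thesis using g0[OF gen(1)] zeroT[OF gen(1)] by simp
    next
      case False
      then show ?thesis using gen n0 by (auto simp: T_def)
    qed
  next
    case unit
    interpret V: vectorspace K "cpt ?F 1" by (rule F.vectorspace_cpt) simp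
    have "ounit ?F = \<one>\<^bsub>K\<^esub> \<odot>\<^bsub>cpt ?F 1\<^esub> ounit ?F" using V.smult_one[OF F.ounit_closed] by (rule HOL.sym)
    then show ?case using V.R.one_closed unfolding T_def by auto
  next
    case (zero n)
    then show ?case using zeroT by simp
  next
    case (add n f g)
    then show ?case using vectorspace.subspace_add[OF F.vectorspace_cpt T] by blast
  next
    case (smult n c f)
    then show ?case using smultT by blast
  next
    case (act n \<sigma> f)
    show ?case
    proof
      assume n: "n \<le> n0"
      then have f: "f \<in> T n" using act by blast
      have s0: "sact ?F n \<sigma> \<zero>\<^bsub>cpt ?F n\<^esub> = \<zero>\<^bsub>cpt ?F n\<^esub>"
        by (rule module_hom_zero[OF F.vectorspace_cpt F.vectorspace_cpt F.sact_hom]) fact+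
      consider "n = 1" | "n \<noteq> 1" "n = n0" | "n \<noteq> 1" "n \<noteq> n0" by blast
      then show "sact ?F n \<sigma> f \<in> T n"
      proof cases
        case 1
        then have "\<sigma> = id" using act(2) by auto
        then show ?thesis using f F.sact_id[OF act(1,3)] by simp
      next
        case 2
        then obtain x where x: "x \<in> carrier (cpt X n)" "f = free_gen K X n x" using f by (auto simp: T_def)
        have "sact X n \<sigma> x \<in> carrier (cpt X n)"
          using X.sact_hom[OF act(1,2)] x by (auto simp: LinearCombinations.module_hom_def)
        moreover have "free_gen K X n (sact X n \<sigma> x) = sact ?F n \<sigma> f"
          using s_module_hom_free_gen[OF X] act(1,2) x by (simp add: s_module_hom_def)
        ultimately show ?thesis using 2 unfolding T_def by (metis (no_types, lifting) imageI)
      next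
        case 3
        then show ?thesis using f s0 zeroT[OF act(1)] by (simp add: T_def)
      qed
    qed
  next
    case (circ m n i f g)
    show ?case
    proof
      assume mn: "m + n - 1 \<le> n0"
      then have f: "f \<in> T m" and g: "g \<in> T n" using circ by auto
      have mn1: "1 \<le> m + n - 1" using circ by auto
      consider "m = 1" | "n = 1" | "m \<noteq> 1" "n \<noteq> 1" by blast
      then show "circ ?F m n i f g \<in> T (m + n - 1)"
      proof cases
        case 1
        then obtain c where c: "c \<in> carrier K" "f = c \<odot>\<^bsub>cpt ?F 1\<^esub> ounit ?F" using f by (auto simp: T_def)
        have i: "i = 1" and mn: "m + n - 1 = n" using 1 circ by auto
        have "circ ?F 1 n 1 f g = c \<odot>\<^bsub>cpt ?F (1 + n - 1)\<^esub> circ ?F 1 n 1 (ounit ?F) g"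
          using F.circ_hom_left[of 1 n 1 g] circ(2,5) c F.ounit_closed
          by (simp add: LinearCombinations.module_hom_def)
        also have "\<dots> = c \<odot>\<^bsub>cpt ?F n\<^esub> g" using F.circ_unit_left[OF circ(2,5)] by simp
        finally show ?thesis unfolding mn unfolding 1 i using smultT[OF circ(2) c(1) g] by simp
      next
        case 2
        then obtain c where c: "c \<in> carrier K" "g = c \<odot>\<^bsub>cpt ?F 1\<^esub> ounit ?F" using g by (auto simp: T_def)
        have mn: "m + n - 1 = m" using 2 circ by auto
        have "circ ?F m 1 i f g = c \<odot>\<^bsub>cpt ?F (m + 1 - 1)\<^esub> circ ?F m 1 i f (ounit ?F)"
          using F.circ_hom_right[of m 1 i f] circ(1,3,4) c F.ounit_closed
          by (simp add: LinearCombinations.module_hom_def)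
        also have "\<dots> = c \<odot>\<^bsub>cpt ?F m\<^esub> f" using F.circ_unit_right[OF circ(1,3,4)] by simp
        finally show ?thesis unfolding mn unfolding 2 using smultT[OF circ(1) c(1) f] by simp
      next
        case 3
        then have "m \<noteq> n0" using mn circ by auto
        then have "f = \<zero>\<^bsub>cpt ?F m\<^esub>" using f 3 by (simp add: T_def)
        then have "circ ?F m n i f g = \<zero>\<^bsub>cpt ?F (m + n - 1)\<^esub>"
          using module_hom_zero[OF F.vectorspace_cpt[OF circ(1)] F.vectorspace_cpt[OF mn1]
              F.circ_hom_left[OF circ(1-3) circ(5)]] by simp
        then show ?thesis using zeroT[OF mn1] by simp
      qed
    qed
  qed
  then show ?thesis using n by (simp add: T_def)
qed


section \<open>From the series of the operad to the theorem\<close>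

lemma fps_divide_X:
  fixes f :: "real fps"
  assumes "fps_nth f 0 = 0"
  shows "f / fps_X = fps_shift 1 f"
proof -
  have "f = fps_shift 1 f * fps_X"
    by (rule fps_ext) (use assms in \<open>auto simp: fps_X_mult_right_nth\<close>)
  then show ?thesis by (metis fps_X_neq_zero nonzero_mult_div_cancel_right)
qed

lemma gen_fun_divide_X:
  "fps_nth (gen_fun K Q / fps_X) k = real (vectorspace.dim K (cpt Q (k + 1))) / fact (k + 1)"
  by (subst fps_divide_X) (simp_all add: gen_fun_def)

text \<open>The kernel of the canonical map is the ideal of relations, so independence modulo the ideal is
  independence of the images.\<close>

lemma indep_mod_kernel_bound:
  assumes P: "vectorspace K P" and F: "vectorspace K F"
    and f: "f \<in> LinearCombinations.module_hom K F P"
    and ts: "set ts \<subseteq> carrier P" "carrier P = vectorspace.span_mod K P {\<zero>\<^bsub>P\<^esub>} ts"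
    and u: "\<And>i. i < d \<Longrightarrow> u i \<in> carrier F"
    and indep: "vectorspace.indep_mod K F (a_kernel F P f) u d"
  shows "d \<le> length ts"
proof (rule ccontr)
  interpret P: vectorspace K P by (rule P)
  interpret F: vectorspace K F by (rule F)
  assume "\<not> d \<le> length ts"
  then have card: "length ts < card {..<d}" by simp
  have z: "VectorSpace.subspace K {\<zero>\<^bsub>P\<^esub>} P" by (rule P.subspaceI) auto
  have fu: "f (u i) \<in> carrier P" if "i \<in> {..<d}" for i
    using f u that by (auto simp: LinearCombinations.module_hom_def)
  then have "\<exists>c. c \<in> {..<d} \<rightarrow> carrier K \<and> (\<exists>i\<in>{..<d}. c i \<noteq> \<zero>\<^bsub>K\<^esub>) \<and>
      finsum P (\<lambda>i. c i \<odot>\<^bsub>P\<^esub> f (u i)) {..<d} \<in> {\<zero>\<^bsub>P\<^esub>}"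
    unfolding ts(2) by (intro P.relation_mod_exists[OF z ts(1) _ card]) simp_all
  then obtain c i where c: "c \<in> {..<d} \<rightarrow> carrier K" and i: "i < d" "c i \<noteq> \<zero>\<^bsub>K\<^esub>"
    and s: "finsum P (\<lambda>i. c i \<odot>\<^bsub>P\<^esub> f (u i)) {..<d} = \<zero>\<^bsub>P\<^esub>" by blast
  have cu: "(\<lambda>i. c i \<odot>\<^bsub>F\<^esub> u i) \<in> {..<d} \<rightarrow> carrier F" using c u by auto
  have "f (finsum F (\<lambda>i. c i \<odot>\<^bsub>F\<^esub> u i) {..<d}) = finsum P (\<lambda>i. f (c i \<odot>\<^bsub>F\<^esub> u i)) {..<d}"
    by (rule finsum_module_hom[OF F P f _ cu]) simp
  also have "\<dots> = finsum P (\<lambda>i. c i \<odot>\<^bsub>P\<^esub> f (u i)) {..<d}"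
  proof (rule P.M.finsum_cong'[OF HOL.refl])
    show "(\<lambda>i. c i \<odot>\<^bsub>P\<^esub> f (u i)) \<in> {..<d} \<rightarrow> carrier P" using c fu by auto
    show "f (c i \<odot>\<^bsub>F\<^esub> u i) = c i \<odot>\<^bsub>P\<^esub> f (u i)" if "i \<in> {..<d}" for i
    proof -
      have "c i \<in> carrier K" using c that by blast
      then show ?thesis using f u[of i] that by (simp add: LinearCombinations.module_hom_def)
    qed
  qed
  finally have "finsum F (\<lambda>i. c i \<odot>\<^bsub>F\<^esub> u i) {..<d} \<in> a_kernel F P f"
    unfolding a_kernel_def kernel_def using F.M.finsum_closed[OF cu] s by simp
  then show False using indep c i unfolding F.indep_mod_def by blast
qed

text \<open>A nonzero generator is assumed in order to exclude the operad spanned by the identity,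
  with \<open>X = R = 0\<close>: its series is 1, but it is finite. The condition on
  \<open>X 1\<close> expresses that generators live in arities at least 2.\<close>

theorem theorem4p1:
  fixes K :: "('k, 'm) ring_scheme"
    and P :: "('k, 'p, 'z) opd_scheme"
    and X :: "nat \<Rightarrow> 'p set"
    and R :: "nat \<Rightarrow> ('k, 'p) opexp set set"
  assumes "field K"
    and "connected_operad K P"
    and "minimally_generated K P X"
    and "X 1 = {\<zero>\<^bsub>cpt P 1\<^esub>}"
    and "\<exists>n\<ge>1. X n \<noteq> {\<zero>\<^bsub>cpt P n\<^esub>}"
    and "minimal_relations K P X R"
    and "locally_finite K (restrict_smod P X)"
    and "locally_finite K (restrict_smod (free_operad K (restrict_smod P X)) R)"
    and "\<forall>n. 0 \<le> fps_nth
           (inverse (1 - gen_fun K (restrict_smod P X) / fps_X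
             + gen_fun K (restrict_smod (free_operad K (restrict_smod P X)) R) / fps_X)) n"
  shows "infinite_operad K P"
proof (rule ccontr)
  assume "\<not> infinite_operad K P"
  then have fd: "vectorspace.fin_dim K (direct_sum_cpt P)" by (simp add: infinite_operad_def)
  interpret P: connected_operad K P by (rule assms(2))
  have opP: "operad K P" and smP: "s_module K P" by unfold_locales
  obtain ts N where ts: "\<And>n. 1 \<le> n \<Longrightarrow> set (ts n) \<subseteq> carrier (cpt P n)"
    "\<And>n. 1 \<le> n \<Longrightarrow> carrier (cpt P n) = vectorspace.span_mod K (cpt P n) {\<zero>\<^bsub>cpt P n\<^esub>} (ts n)"
    "\<And>n. N \<le> n \<Longrightarrow> ts n = []"
    using direct_sum_spanning[OF smP fd] by blast
  define Y where "Y = restrict_smod P X"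
  have subX: "sub_s_module K P X" using assms(3) by (simp add: minimally_generated_def)
  have smY: "s_module K Y" unfolding Y_def by (rule s_module_restrict_smod[OF smP subX])
  interpret Y: s_module K Y by (rule smY)
  have Xs: "VectorSpace.subspace K (X n) (cpt P n)" if "1 \<le> n" for n
    using subX that by (simp add: sub_s_module_def)
  have XP: "X n \<subseteq> carrier (cpt P n)" if "1 \<le> n" for n
    using vectorspace.subspace_carrier[OF P.vectorspace_cpt Xs] that by blast
  have cptY: "cpt Y n = (cpt P n)\<lparr>carrier := X n\<rparr>" for n by (simp add: Y_def restrict_smod_def)
  let ?F = "free_operad K Y"
  interpret F: operad K ?F by (rule operad_free_operad[OF smY])
  define xd where "xd n = vectorspace.dim K (cpt Y n)" for n
  define rd where "rd n = vectorspace.dim K (cpt (restrict_smod ?F R) n)" for n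

  have incl: "s_module_hom K Y P (\<lambda>n x. x)"
    using XP by (auto simp: s_module_hom_def LinearCombinations.module_hom_def Y_def restrict_smod_def)
  define pr where "pr = free_ext P (\<lambda>(n::nat) x. x :: 'p)"
  have pr: "operad_hom K ?F P pr" unfolding pr_def by (rule operad_hom_free_ext[OF smY opP incl])
  have pr_hom: "pr n \<in> LinearCombinations.module_hom K (cpt ?F n) (cpt P n)" if "1 \<le> n" for n
    using pr that by (simp add: operad_hom_def s_module_hom_def)
  have ker: "ideal_generated K ?F R n = a_kernel (cpt ?F n) (cpt P n) (pr n)" if "1 \<le> n" for n
    using assms(6) that by (simp add: minimal_relations_def relation_kernel_def Y_def pr_def Let_def)
  have subR: "sub_s_module K ?F R"
    using assms(6) by (simp add: minimal_relations_def Y_def Let_def)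
  have Rs: "VectorSpace.subspace K (R n) (cpt ?F n)" if "1 \<le> n" for n
    using subR that by (simp add: sub_s_module_def)
  have R_ker: "f \<in> carrier (cpt ?F n) \<and> pr n f = \<zero>\<^bsub>cpt P n\<^esub>" if "1 \<le> n" "f \<in> R n" for n f
  proof -
    have "f \<in> ideal_generated K ?F R n" using that by (auto simp: ideal_generated_def)
    then show ?thesis unfolding ker[OF that(1)] by (simp add: a_kernel_def kernel_def)
  qed
  have R0: "\<zero>\<^bsub>cpt ?F n\<^esub> \<in> R n" if "1 \<le> n" for n
    using vectorspace.subspace_zero[OF F.vectorspace_cpt Rs] that by blast

  \<comment> \<open>A relation of arity 1 is a multiple of the identity of the free operad. Its
    image is the same multiple of the nonzero identity of \<open>P\<close>, so the factor is
    zero.\<close>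
  have R1: "R 1 = {\<zero>\<^bsub>cpt ?F 1\<^esub>}"
  proof -
    have low: "carrier (cpt Y m) = {\<zero>\<^bsub>cpt Y m\<^esub>}" if "1 \<le> m" "m < 2" for m
    proof -
      have "m = 1" using that by simp
      then show ?thesis using assms(4) by (simp add: cptY)
    qed
    have "f = \<zero>\<^bsub>cpt ?F 1\<^esub>" if f: "f \<in> R 1" for f
    proof -
      interpret P1: vectorspace K "cpt P 1" by (rule P.vectorspace_cpt) simp
      interpret F1: vectorspace K "cpt ?F 1" by (rule F.vectorspace_cpt) simp
      have fk: "f \<in> carrier (cpt ?F 1)" "pr 1 f = \<zero>\<^bsub>cpt P 1\<^esub>" using R_ker[of 1 f] f by auto
      obtain c where c: "c \<in> carrier K" "f = c \<odot>\<^bsub>cpt ?F 1\<^esub> ounit ?F"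
        using free_operad_low_arity[OF smY _ low fk(1)] by auto
      have "pr 1 f = c \<odot>\<^bsub>cpt P 1\<^esub> ounit P"
        using pr pr_hom[of 1] c F.ounit_closed
        by (simp add: operad_hom_def LinearCombinations.module_hom_def)
      then have cu: "c \<odot>\<^bsub>cpt P 1\<^esub> ounit P = \<zero>\<^bsub>cpt P 1\<^esub>" using fk(2) by simp
      have "c = \<zero>\<^bsub>K\<^esub>"
      proof (rule ccontr)
        assume "c \<noteq> \<zero>\<^bsub>K\<^esub>"
        then have U: "c \<in> Units K" using c(1) by (simp add: P1.field_Units)
        then have "ounit P = inv\<^bsub>K\<^esub> c \<odot>\<^bsub>cpt P 1\<^esub> (c \<odot>\<^bsub>cpt P 1\<^esub> ounit P)"
          using c(1) P.ounit_closed by (simp add: P1.smult_assoc1[symmetric] del: One_nat_def)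
        then show False using cu P.ounit_nonzero U by (simp del: One_nat_def)
      qed
      then show ?thesis using c(2) F.ounit_closed by (simp del: One_nat_def)
    qed
    moreover have "\<zero>\<^bsub>cpt ?F 1\<^esub> \<in> R 1" by (rule R0) simp
    ultimately show ?thesis by blast
  qed

  have "\<exists>e crd. vectorspace.coordinates K (cpt Y n) (xd n) e crd" if n: "1 \<le> n" for n
    using vectorspace.dim_coordinates[OF Y.vectorspace_cpt[OF n]] assms(7) n
    by (simp add: locally_finite_def Y_def xd_def)
  then obtain bas crd where
    crd: "\<And>n. 1 \<le> n \<Longrightarrow> vectorspace.coordinates K (cpt Y n) (xd n) (bas n) (crd n)"
    by metis
  define spans where "spans n l \<longleftrightarrow> set l \<subseteq> carrier (cpt ?F n) \<and> length l = rd n \<and>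
      R n = vectorspace.span_mod K (cpt ?F n) {\<zero>\<^bsub>cpt ?F n\<^esub>} l" for n l
  have "\<exists>l. spans n l" if n: "1 \<le> n" for n
  proof -
    have cR: "cpt (restrict_smod ?F R) n = (cpt ?F n)\<lparr>carrier := R n\<rparr>" by (simp add: restrict_smod_def)
    interpret V: vectorspace K "(cpt ?F n)\<lparr>carrier := R n\<rparr>"
      by (rule vectorspace.subspace_is_vs[OF F.vectorspace_cpt[OF n] Rs[OF n]])
    have "vectorspace.fin_dim K (cpt (restrict_smod ?F R) n)"
      using assms(8) n by (simp add: locally_finite_def Y_def)
    then have "V.fin_dim" unfolding cR .
    then obtain l where "set l \<subseteq> R n" "length l = V.dim" "R n = V.span_mod {\<zero>\<^bsub>cpt ?F n\<^esub>} l"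
      using V.dim_spanning_list by auto
    then show ?thesis
      unfolding spans_def
      using vectorspace.subspace_carrier[OF F.vectorspace_cpt[OF n] Rs[OF n]]
        span_mod_restrict[OF F.vectorspace_cpt[OF n] Rs[OF n]]
      by (intro exI[of _ l]) (auto simp: rd_def cR)
  qed
  then obtain rs where "\<And>n. 1 \<le> n \<Longrightarrow> spans n (rs n)" by metis
  note rs = this[unfolded spans_def]

  \<comment> \<open>The bound is the length of a spanning list of the component of \<open>P\<close>,
    because the ideal of the relations is the kernel of the map to \<open>P\<close>; it is zero from
    arity \<open>N\<close> on.\<close>
  interpret G: golod_shafarevich K Y R xd bas crd rs "\<lambda>n. length (ts n)"
  proof (unfold_locales, goal_cases)
    case 1
    show ?case using assms(4) by (simp add: cptY)
  next
    case (7 n d u)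
    show ?case
      using indep_mod_kernel_bound[OF P.vectorspace_cpt[OF 7(1)] F.vectorspace_cpt[OF 7(1)]
          pr_hom[OF 7(1)] ts(1,2)[OF 7(1)] 7(2)] 7(3) ker[OF 7(1)] by simp
  qed (use crd subR R1 rs in \<open>simp_all\<close>)

  have fin_zero: "carrier (cpt P n) = {\<zero>\<^bsub>cpt P n\<^esub>}" if "1 \<le> n" "N \<le> n" for n
    using ts(2)[OF that(1)] ts(3)[OF that(2)]
      vectorspace.span_mod.simps(1)[OF P.vectorspace_cpt[OF that(1)]] by simp
  have Y_zero: "xd n = 0" if "1 \<le> n" "X n = {\<zero>\<^bsub>cpt P n\<^esub>}" for n
    unfolding xd_def using vectorspace.dim_trivial[OF Y.vectorspace_cpt[OF that(1)]] that
    by (simp add: cptY)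
  have X0: "\<zero>\<^bsub>cpt P n\<^esub> \<in> X n" if "1 \<le> n" for n
    using vectorspace.subspace_zero[OF P.vectorspace_cpt Xs] that by blast
  have rd_zero: "rd n = 0" if n: "1 \<le> n" and "R n = {\<zero>\<^bsub>cpt ?F n\<^esub>}" for n
    unfolding rd_def restrict_smod_def
    using vectorspace.dim_trivial[OF vectorspace.subspace_is_vs[OF F.vectorspace_cpt[OF n] Rs[OF n]]] that
    by simp

  define q where "q = 1 - gen_fun K Y / fps_X + gen_fun K (restrict_smod ?F R) / fps_X"
  have q: "fps_nth q k = (if k = 0 then 1 else (real (rd (k + 1)) - real (xd (k + 1))) / fact (k + 1))" for k
  proof -
    have "fps_nth q k = (if k = 0 then 1 else 0) + (real (rd (k + 1)) - real (xd (k + 1))) / fact (k + 1)"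
      unfolding q_def fps_add_nth fps_sub_nth gen_fun_divide_X
      by (simp add: xd_def rd_def diff_divide_distrib)
    \<comment> \<open>Division by \<open>z\<close> moves arity 1 to the constant term, where neither
      series contributes.\<close>
    moreover have "xd 1 = 0" "rd 1 = 0" using Y_zero[of 1] rd_zero[of 1] assms(4) R1 by auto
    ultimately show ?thesis by simp
  qed
  have xr: "xd n = rd n" if "2 \<le> n" for n
  \<comment> \<open>\<open>N + 1\<close> instead of \<open>N\<close> keeps the arities positive, as
    components of arity 0 carry no information.\<close>
  proof (rule golod_shafarevich_numeric[where x = xd and r = rd and q = q and d = G.dm and N = "N + 1"])
    show "fps_nth q k = (if k = 0 then 1 else (real (rd (k + 1)) - real (xd (k + 1))) / fact (k + 1))" for k
      by (rule q)
    show "1 \<le> G.dm {}" by (rule G.dm_empty)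
    show "0 \<le> fps_nth (inverse q) k" for k
      using assms(9) by (simp add: q_def Y_def)
    show "(\<Sum>B\<in>Pow L - {{}}. xd (card B + 1) * G.dm (L - B))
        \<le> G.dm L + (\<Sum>B\<in>Pow L - {{}}. rd (card B + 1) * G.dm (L - B))"
      if "finite L" "0 \<notin> L" "L \<noteq> {}" for L
      using G.dm_inequality[OF that(1,2)] rs by simp
    show "G.dm L = 0" if "finite L" "0 \<notin> L" "N + 1 \<le> card L" for L
      using G.dm_le[OF that(1,2)] ts(3)[of "card L + 1"] that(3) by simp
    show "xd n = 0" if "N + 1 \<le> n" for n
      using that fin_zero[of n] XP[of n] X0[of n] by (intro Y_zero) auto
    show "2 \<le> n" by (rule that)
  qed

  define n0 where "n0 = (LEAST n. 1 \<le> n \<and> X n \<noteq> {\<zero>\<^bsub>cpt P n\<^esub>})"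
  have n0: "1 \<le> n0" "X n0 \<noteq> {\<zero>\<^bsub>cpt P n0\<^esub>}"
    using LeastI_ex[OF assms(5)] by (auto simp: n0_def)
  have low: "X m = {\<zero>\<^bsub>cpt P m\<^esub>}" if "1 \<le> m" "m < n0" for m
    using not_less_Least[of m "\<lambda>n. 1 \<le> n \<and> X n \<noteq> {\<zero>\<^bsub>cpt P n\<^esub>}"] that by (auto simp: n0_def)
  have n02: "2 \<le> n0"
  proof (rule ccontr)
    assume "\<not> 2 \<le> n0"
    then have "n0 = 1" using n0(1) by simp
    then show False using n0(2) assms(4) by simp
  qed
  \<comment> \<open>By minimality of \<open>n0\<close> a relation in this arity is a single
    generator, and on generators the canonical map is the inclusion, hence injective.\<close>
  have "f = \<zero>\<^bsub>cpt ?F n0\<^esub>" if f: "f \<in> R n0" for f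
  proof -
    note fk = R_ker[OF n0(1) f]
    have "f \<in> free_gen K Y n0 ` carrier (cpt Y n0)"
      using free_operad_low_arity[OF smY n02 _ conjunct1[OF fk] order.refl] low n02
      by (simp add: cptY)
    then obtain x where x: "x \<in> carrier (cpt Y n0)" "f = free_gen K Y n0 x" by blast
    have "pr n0 f = x" unfolding x(2) pr_def by (rule free_ext_gen[OF smY opP incl n0(1) x(1)])
    then have "x = \<zero>\<^bsub>cpt Y n0\<^esub>" using fk by (simp add: cptY)
    moreover have "free_gen K Y n0 \<in> LinearCombinations.module_hom K (cpt Y n0) (cpt ?F n0)"
      using s_module_hom_free_gen[OF smY] n0(1) by (simp add: s_module_hom_def)
    ultimately show ?thesis
      unfolding x(2) using module_hom_zero[OF Y.vectorspace_cpt[OF n0(1)] F.vectorspace_cpt[OF n0(1)]] by blast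
  qed
  then have "R n0 = {\<zero>\<^bsub>cpt ?F n0\<^esub>}" using R0[OF n0(1)] by blast
  \<comment> \<open>The equality of dimensions leaves no generator in arity \<open>n0\<close>,
    contrary to its choice.\<close>
  then have "xd n0 = 0" using rd_zero[OF n0(1)] xr[OF n02] by simp
  interpret V: vectorspace K "cpt Y n0" by (rule Y.vectorspace_cpt[OF n0(1)])
  have "V.fin_dim" using assms(7) n0(1) by (simp add: locally_finite_def Y_def)
  then show False
  proof (rule V.dim_spanning_list)
    fix l assume l: "length l = V.dim" "carrier (cpt Y n0) = V.span_mod {\<zero>\<^bsub>cpt Y n0\<^esub>} l"
    have "l = []" using l(1) \<open>xd n0 = 0\<close> by (simp add: xd_def)
    then have "carrier (cpt Y n0) = {\<zero>\<^bsub>cpt Y n0\<^esub>}" using l(2) by (simp only: V.span_mod.simps)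
    then have "X n0 = {\<zero>\<^bsub>cpt P n0\<^esub>}" by (simp add: cptY)
    then show False using n0(2) by simp
  qed
qed

end
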